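(* Let $(\rho_n)_{n\ge0}$ be a real sequence with $\rho_0<0$, $\rho_n\in(0,1)$ for $n\ge1$, and $\rho_n=1+O(1/n^2)$ as $n\to\infty$. Consider the difference equation $z_{n-1}-z_{n+1}=\lambda z_n/\rho_n$, $n\ge0$, $z_{-1}=0$, with $\operatorname{Re}(\lambda)>0$, and set $b_n=-\lambda\sqrt{1-\rho_n}/\rho_n$ and $c_n=\sqrt{1-\rho_n}$ for $n\ge0$. Construct from these $(b_n)$ and $(c_n)$ the functions $\det(I-K_\lambda^+)$, $\det(I-\mathcal{T}_\lambda^+)$, $\mathcal{E}^+(\lambda)$, $\mathcal{F}^+(\lambda)$ and the function $\mathcal{G}^+(\lambda)$ as defined in the context. Then for all $\lambda$ with $\operatorname{Re}(\lambda)>0$, $$\mathcal{G}^+(\lambda)=\det(I-K_\lambda^+)=\det(I-\mathcal{T}_\lambda^+)=\mathcal{E}^+(\lambda)=\mathcal{F}^+(\lambda).$$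
   Context: Notation: $\mathbb{Z}_+=\{0,1,2,\dots\}$. With the given $b_n,c_n$ the equation $z_{n-1}-z_{n+1}=\lambda z_n/\rho_n$ is the same as (E) $z_{n-1}-z_{n+1}+b_nc_nz_n=\lambda z_n$, $n\ge0$; the boundary condition is (BC) $z_{-1}=0$. The sequences $(b_n),(c_n)$ are in $\ell^2(\mathbb{Z}_+;\mathbb{C})$. Let $S:(z_0,z_1,\dots)\mapsto(0,z_0,z_1,\dots)$ be the right shift and $S^{-1}:=S^*:(z_0,z_1,\dots)\mapsto(z_1,z_2,\dots)$ the left shift on $\ell^2(\mathbb{Z}_+;\mathbb{C})$; $S^{-1}$ also denotes the left shift on vector-valued sequences. The operator $S-S^{-1}-\lambda$ is invertible on $\ell^2(\mathbb{Z}_+;\mathbb{C})$ for $\lambda\notin[-2\mathrm{i},2\mathrm{i}]$. Matrices: $A=A(\lambda)=\begin{bmatrix}-\lambda&1\\1&0\end{bmatrix}$, $Q_+=\begin{bmatrix}1&0\\0&0\end{bmatrix}$, $B_n=b_nQ_+$, $C_n=c_nQ_+$, $A_n^\times=A+B_nC_n=\begin{bmatrix}b_nc_n-\lambda&1\\1&0\end{bmatrix}$. For $\lambda\notin[-2\mathrm{i},2\mathrm{i}]$ let $\mu_\pm=\mu_\pm(\lambda)$ be the roots of $\mu^2+\lambda\mu-1=0$ (the eigenvalues of $A$) with $|\mu_+|<1<|\mu_-|$. Let $P_+=P_+(\lambda)$ be the spectral projection of $A(\lambda)$ in $\mathbb{C}^2$ corresponding to $\mu_+$. Let $R_+=R_+(\lambda)$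 be the projection in $\mathbb{C}^2$ onto $\operatorname{ran}P_+$ parallel to $\operatorname{ran}Q_+$, and $R_-=I_{2\times2}-R_+$. (1) $K_\lambda^+=-\operatorname{diag}_{n\in\mathbb{Z}_+}\{c_n\}\,(S-S^{-1}-\lambda)^{-1}\operatorname{diag}_{n\in\mathbb{Z}_+}\{b_n\}$, a trace class operator on $\ell^2(\mathbb{Z}_+;\mathbb{C})$; $\det(I-K^+_\lambda)$ is the Fredholm determinant. (2) Let $\ell^2_{\operatorname{ran}Q_+}(\mathbb{Z}_+;\mathbb{C}^2)=\{(y_n)_{n\ge0}\in\ell^2(\mathbb{Z}_+;\mathbb{C}^2):y_0\in\operatorname{ran}Q_+\}$. For $\lambda\notin[-2\mathrm{i},2\mathrm{i}]$ the operator $S^{-1}-\operatorname{diag}_{n\in\mathbb{Z}_+}\{A\}$ is invertible from $\ell^2_{\operatorname{ran}Q_+}(\mathbb{Z}_+;\mathbb{C}^2)$ onto $\ell^2(\mathbb{Z}_+;\mathbb{C}^2)$; with this inverse define $\mathcal{T}_\lambda^+=\operatorname{diag}_{n\in\mathbb{Z}_+}\{C_n\}\big(S^{-1}-\operatorname{diag}_{n\in\mathbb{Z}_+}\{A\}\big)^{-1}\operatorname{diag}_{n\in\mathbb{Z}_+}\{B_n\}$, a trace class operator on $\ell^2(\mathbb{Z}_+;\mathbb{C}^2)$; $\det(I-\mathcal{T}^+_\lambda)$ is the Fredholm determinant. (3) The matrix-valued Jost solution $(Y_n^+)_{n\ge0}$, $Y_n^+=Y_n^+(\lambda)\in\mathbb{C}^{2\times2}$,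 is the unique solution of $Y_{n+1}=A_n^\times Y_n$, $n\ge0$, such that $\|(\mu_+)^{-n}(Y_n^+-A^nR_+)\|\to0$ as $n\to+\infty$ and $Y_0^+=Y_0^+R_+$. The Evans function is $\mathcal{E}^+(\lambda)=\det\big(Y_0^+(\lambda)+R_-(\lambda)\big)$. (4) The Jost solution $\mathbf{z}^+=(z_n^+)_{n\ge-1}$ is the unique solution of (E) (without (BC)) such that $(\mu_+)^{-n}z_n^+\to1$ as $n\to+\infty$. The regular solution $\mathbf{z}^{\mathrm r}=(z_n^{\mathrm r})_{n\ge-1}$ is the solution of (E) with $z_{-1}^{\mathrm r}=0$, $z_0^{\mathrm r}=1$. For sequences $\mathbf u=(u_n)_{n\ge-1}$, $\mathbf v=(v_n)_{n\ge-1}$ put $\mathcal{W}(\mathbf u,\mathbf v)_n=(-1)^{n}(u_{n-1}v_n-u_nv_{n-1})$, $n\ge0$; thus $\mathcal{W}(\mathbf z^+,\mathbf z^{\mathrm r})_0=z_{-1}^+(\lambda)$. The Jost function is $\mathcal{F}^+(\lambda)=\mu_+(\lambda)\,\mathcal{W}(\mathbf z^+(\lambda),\mathbf z^{\mathrm r}(\lambda))_0=\mu_+(\lambda)z^+_{-1}(\lambda)$. (5) For $\operatorname{Re}(\lambda)>0$ let $g_+(\lambda)$ be the (convergent) continued fraction $$g_+(\lambda)=\cfrac{1}{\frac{\lambda}{\rho_1}+\cfrac{1}{\frac{\lambda}{\rho_2}+\cdots}},$$ and put $\mathcal{G}^+(\lambda)=\mu_+(\lambda)\,z_0^+(\lambda)\,\big(g_+(\lambda)+\lambda/\rho_0\big)$,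 where $z_0^+(\lambda)$ is the $0$-th entry of the Jost solution. *)

theory Defs
  imports "HOL-Analysis.Analysis" "HOL-Library.Landau_Symbols"
begin

section \<open>Operators on square-summable families\<close>

text \<open>
  Operators on a sequence space are total functions on all families; only their action on the
  carrier set \<open>ell2\<close> matters.
\<close>

definition ell2 :: "('i \<Rightarrow> 'a::real_normed_vector) set" where
  "ell2 = {f. (\<lambda>i. (norm (f i))\<^sup>2) summable_on UNIV}"

definition ell2_norm :: "('i \<Rightarrow> 'a::real_normed_vector) \<Rightarrow> real" where
  "ell2_norm f = sqrt (\<Sum>\<^sub>\<infinity>i. (norm (f i))\<^sup>2)"

definition bounded_op :: "(('i \<Rightarrow> complex) \<Rightarrow> ('i \<Rightarrow> complex)) \<Rightarrow> bool" where
  "bounded_op T \<longleftrightarrow>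
     (\<forall>f\<in>ell2. T f \<in> ell2) \<and>
     (\<forall>f\<in>ell2. \<forall>g\<in>ell2. T (\<lambda>i. f i + g i) = (\<lambda>i. T f i + T g i)) \<and>
     (\<forall>a. \<forall>f\<in>ell2. T (\<lambda>i. a * f i) = (\<lambda>i. a * T f i)) \<and>
     (\<exists>C. \<forall>f\<in>ell2. ell2_norm (T f) \<le> C * ell2_norm f)"

definition op_norm :: "(('i \<Rightarrow> complex) \<Rightarrow> ('i \<Rightarrow> complex)) \<Rightarrow> real" where
  "op_norm T = Inf {C. 0 \<le> C \<and> (\<forall>f\<in>ell2. ell2_norm (T f) \<le> C * ell2_norm f)}"

definition rank_le :: "(('i \<Rightarrow> complex) \<Rightarrow> ('i \<Rightarrow> complex)) \<Rightarrow> nat \<Rightarrow> bool" where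
  "rank_le T n \<longleftrightarrow>
     (\<exists>g. \<forall>f\<in>ell2. \<exists>a :: nat \<Rightarrow> complex. T f = (\<lambda>i. \<Sum>k<n. a k * g k i))"

text \<open>
  Singular numbers as distances to the operators of rank at most \<open>n\<close>; the numbering starts at
  \<open>n = 0\<close>, so \<open>singular_number T 0\<close> is the operator norm of \<open>T\<close>.
\<close>

definition singular_number :: "(('i \<Rightarrow> complex) \<Rightarrow> ('i \<Rightarrow> complex)) \<Rightarrow> nat \<Rightarrow> real" where
  "singular_number T n =
     Inf {op_norm (\<lambda>f i. T f i - F f i) | F. bounded_op F \<and> rank_le F n}"

definition trace_class :: "(('i \<Rightarrow> complex) \<Rightarrow> ('i \<Rightarrow> complex)) \<Rightarrow> bool" where
  "trace_class T \<longleftrightarrow> bounded_op T \<and> summable (singular_number T)"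

text \<open>
  The Fredholm determinant is \<open>det (I - T) = (\<Sum>k. (-1)^k * tr (\<Lambda>\<^sup>k T))\<close>. The trace
  of the exterior power is taken in the orthonormal basis of the wedge products of the unit vectors
  \<open>\<delta>\<^sub>i\<close>, \<open>i \<in> F\<close>, where \<open>F\<close> runs through the index sets with \<open>k\<close> elements; the
  diagonal entry belonging to \<open>F\<close> is the principal minor of the matrix of \<open>T\<close> on \<open>F\<close>.
\<close>

definition op_entry :: "(('i \<Rightarrow> complex) \<Rightarrow> ('i \<Rightarrow> complex)) \<Rightarrow> 'i \<Rightarrow> 'i \<Rightarrow> complex" where
  "op_entry T i j = T (\<lambda>k. if k = j then 1 else 0) i"

definition principal_minor :: "(('i \<Rightarrow> complex) \<Rightarrow> ('i \<Rightarrow> complex)) \<Rightarrow> 'i set \<Rightarrow> complex" where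
  "principal_minor T F =
     (\<Sum>p | p permutes F. of_int (sign p) * (\<Prod>i\<in>F. op_entry T i (p i)))"

definition trace_ext_power :: "nat \<Rightarrow> (('i \<Rightarrow> complex) \<Rightarrow> ('i \<Rightarrow> complex)) \<Rightarrow> complex" where
  "trace_ext_power k T = (\<Sum>\<^sub>\<infinity>F\<in>{F. finite F \<and> card F = k}. principal_minor T F)"

definition det_I_minus :: "(('i \<Rightarrow> complex) \<Rightarrow> ('i \<Rightarrow> complex)) \<Rightarrow> complex" where
  "det_I_minus T =
     (if trace_class T then (\<Sum>k. (-1) ^ k * trace_ext_power k T) else undefined)"

text \<open>Identification of sequences in \<open>\<complex>\<^sup>2\<close> with families indexed by \<open>nat \<times> 2\<close>.\<close>

definition flatten :: "(nat \<Rightarrow> complex^2) \<Rightarrow> (nat \<times> 2 \<Rightarrow> complex)" where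
  "flatten y = (\<lambda>(n, j). y n $ j)"

definition unflatten :: "(nat \<times> 2 \<Rightarrow> complex) \<Rightarrow> (nat \<Rightarrow> complex^2)" where
  "unflatten x = (\<lambda>n. \<chi> j. x (n, j))"

definition right_shift :: "(nat \<Rightarrow> 'a::zero) \<Rightarrow> (nat \<Rightarrow> 'a)" where
  "right_shift z = (\<lambda>n. case n of 0 \<Rightarrow> 0 | Suc m \<Rightarrow> z m)"

definition left_shift :: "(nat \<Rightarrow> 'a) \<Rightarrow> (nat \<Rightarrow> 'a)" where
  "left_shift z = (\<lambda>n. z (Suc n))"

section \<open>The scalar and the matrix-valued Birman-Schwinger operators\<close>

definition K_plus ::
  "(nat \<Rightarrow> complex) \<Rightarrow> (nat \<Rightarrow> complex) \<Rightarrow> complex \<Rightarrow> (nat \<Rightarrow> complex) \<Rightarrow> (nat \<Rightarrow> complex)" where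
  "K_plus b c lam v =
     (\<lambda>n. - (c n * inv_into ell2 (\<lambda>z m. right_shift z m - left_shift z m - lam * z m)
                     (\<lambda>m. b m * v m) n))"

definition A_mat :: "complex \<Rightarrow> complex^2^2" where
  "A_mat lam = vector [vector [- lam, 1], vector [1, 0]]"

definition Q_plus :: "complex^2^2" where
  "Q_plus = vector [vector [1, 0], vector [0, 0]]"

definition B_mat :: "(nat \<Rightarrow> complex) \<Rightarrow> nat \<Rightarrow> complex^2^2" where
  "B_mat b n = mat (b n) ** Q_plus"

definition C_mat :: "(nat \<Rightarrow> complex) \<Rightarrow> nat \<Rightarrow> complex^2^2" where
  "C_mat c n = mat (c n) ** Q_plus"

definition A_cross :: "(nat \<Rightarrow> complex) \<Rightarrow> (nat \<Rightarrow> complex) \<Rightarrow> complex \<Rightarrow> nat \<Rightarrow> complex^2^2" where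
  "A_cross b c lam n = A_mat lam + B_mat b n ** C_mat c n"

definition mat_ran :: "complex^'n^'n \<Rightarrow> (complex^'n) set" where
  "mat_ran M = range ((*v) M)"

definition mat_ker :: "complex^'n^'n \<Rightarrow> (complex^'n) set" where
  "mat_ker M = {v. M *v v = 0}"

definition ell2_ran_Q :: "(nat \<Rightarrow> complex^2) set" where
  "ell2_ran_Q = {y \<in> ell2. y 0 \<in> mat_ran Q_plus}"

definition T_plus ::
  "(nat \<Rightarrow> complex) \<Rightarrow> (nat \<Rightarrow> complex) \<Rightarrow> complex \<Rightarrow> (nat \<Rightarrow> complex^2) \<Rightarrow> (nat \<Rightarrow> complex^2)" where
  "T_plus b c lam v =
     (\<lambda>n. C_mat c n *v
            inv_into ell2_ran_Q (\<lambda>y m. left_shift y m - A_mat lam *v y m)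
              (\<lambda>m. B_mat b m *v v m) n)"

definition det_I_minus_K :: "(nat \<Rightarrow> complex) \<Rightarrow> (nat \<Rightarrow> complex) \<Rightarrow> complex \<Rightarrow> complex" where
  "det_I_minus_K b c lam = det_I_minus (K_plus b c lam)"

definition det_I_minus_T :: "(nat \<Rightarrow> complex) \<Rightarrow> (nat \<Rightarrow> complex) \<Rightarrow> complex \<Rightarrow> complex" where
  "det_I_minus_T b c lam = det_I_minus (\<lambda>x. flatten (T_plus b c lam (unflatten x)))"

section \<open>Projections and the Evans function\<close>

definition mu_plus :: "complex \<Rightarrow> complex" where
  "mu_plus lam = (THE \<mu>. \<mu>\<^sup>2 + lam * \<mu> - 1 = 0 \<and> cmod \<mu> < 1)"

definition projection_along ::
  "(complex^'n) set \<Rightarrow> (complex^'n) set \<Rightarrow> complex^'n^'n" where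
  "projection_along U V = (THE P. P ** P = P \<and> mat_ran P = U \<and> mat_ker P = V)"

text \<open>
  Powers of a matrix; the operation \<open>^\<close> on \<open>complex^'n^'n\<close> would be taken entrywise.
\<close>

definition mat_power :: "complex^'n^'n \<Rightarrow> nat \<Rightarrow> complex^'n^'n" where
  "mat_power M n = (((**) M) ^^ n) (mat 1)"

text \<open>
  The spectral projection projects onto the generalized eigenspace of \<open>\<mu>\<close> along the sum of the
  other generalized eigenspaces, which is the range of the power below.
\<close>

definition spectral_projection :: "complex^'n^'n \<Rightarrow> complex \<Rightarrow> complex^'n^'n" where
  "spectral_projection M \<mu> =
     projection_along (mat_ker (mat_power (M - mat \<mu>) CARD('n)))
                      (mat_ran (mat_power (M - mat \<mu>) CARD('n)))"

definition P_plus :: "complex \<Rightarrow> complex^2^2" where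
  "P_plus lam = spectral_projection (A_mat lam) (mu_plus lam)"

definition R_plus :: "complex \<Rightarrow> complex^2^2" where
  "R_plus lam = projection_along (mat_ran (P_plus lam)) (mat_ran Q_plus)"

definition R_minus :: "complex \<Rightarrow> complex^2^2" where
  "R_minus lam = mat 1 - R_plus lam"

definition matrix_Jost ::
  "(nat \<Rightarrow> complex) \<Rightarrow> (nat \<Rightarrow> complex) \<Rightarrow> complex \<Rightarrow> nat \<Rightarrow> complex^2^2" where
  "matrix_Jost b c lam =
     (THE Y. (\<forall>n. Y (Suc n) = A_cross b c lam n ** Y n) \<and>
             (\<lambda>n. norm (mat (mu_plus lam powi (- int n)) **
                        (Y n - mat_power (A_mat lam) n ** R_plus lam))) \<longlonglongrightarrow> 0 \<and>
             Y 0 = Y 0 ** R_plus lam)"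

definition Evans :: "(nat \<Rightarrow> complex) \<Rightarrow> (nat \<Rightarrow> complex) \<Rightarrow> complex \<Rightarrow> complex" where
  "Evans b c lam = det (matrix_Jost b c lam 0 + R_minus lam)"

section \<open>The Jost function\<close>

text \<open>
  A scalar sequence \<open>(z\<^sub>n)\<close>, \<open>n \<ge> -1\<close>, is encoded as \<open>z :: nat \<Rightarrow> complex\<close> with
  \<open>z k\<close> standing for the entry with index \<open>k - 1\<close>.
\<close>

definition solves_E :: "(nat \<Rightarrow> complex) \<Rightarrow> (nat \<Rightarrow> complex) \<Rightarrow> complex \<Rightarrow> (nat \<Rightarrow> complex) \<Rightarrow> bool" where
  "solves_E b c lam z \<longleftrightarrow>
     (\<forall>n. z n - z (n + 2) + b n * c n * z (n + 1) = lam * z (n + 1))"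

definition Jost_solution :: "(nat \<Rightarrow> complex) \<Rightarrow> (nat \<Rightarrow> complex) \<Rightarrow> complex \<Rightarrow> nat \<Rightarrow> complex" where
  "Jost_solution b c lam =
     (THE z. solves_E b c lam z \<and> (\<lambda>n. mu_plus lam powi (- int n) * z (n + 1)) \<longlonglongrightarrow> 1)"

definition regular_solution :: "(nat \<Rightarrow> complex) \<Rightarrow> (nat \<Rightarrow> complex) \<Rightarrow> complex \<Rightarrow> nat \<Rightarrow> complex" where
  "regular_solution b c lam = (THE z. solves_E b c lam z \<and> z 0 = 0 \<and> z 1 = 1)"

definition Wronskian :: "(nat \<Rightarrow> complex) \<Rightarrow> (nat \<Rightarrow> complex) \<Rightarrow> nat \<Rightarrow> complex" where
  "Wronskian u v n = (-1) ^ n * (u n * v (n + 1) - u (n + 1) * v n)"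

definition Jost_function :: "(nat \<Rightarrow> complex) \<Rightarrow> (nat \<Rightarrow> complex) \<Rightarrow> complex \<Rightarrow> complex" where
  "Jost_function b c lam =
     mu_plus lam * Wronskian (Jost_solution b c lam) (regular_solution b c lam) 0"

section \<open>The potentials and the continued fraction\<close>

definition b_seq :: "(nat \<Rightarrow> real) \<Rightarrow> complex \<Rightarrow> nat \<Rightarrow> complex" where
  "b_seq \<rho> lam n = - lam * of_real (sqrt (1 - \<rho> n)) / of_real (\<rho> n)"

definition c_seq :: "(nat \<Rightarrow> real) \<Rightarrow> nat \<Rightarrow> complex" where
  "c_seq \<rho> n = of_real (sqrt (1 - \<rho> n))"

text \<open>\<open>cfrac a k n\<close> is the finite continued fraction
  \<open>1 / (a k + 1 / (a (k+1) + \<dots> + 1 / a (k+n-1)))\<close>.\<close>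

fun cfrac :: "(nat \<Rightarrow> complex) \<Rightarrow> nat \<Rightarrow> nat \<Rightarrow> complex" where
  "cfrac a k 0 = 0"
| "cfrac a k (Suc n) = 1 / (a k + cfrac a (Suc k) n)"

definition g_plus :: "(nat \<Rightarrow> real) \<Rightarrow> complex \<Rightarrow> complex" where
  "g_plus \<rho> lam = lim (\<lambda>n. cfrac (\<lambda>k. lam / of_real (\<rho> k)) 1 n)"

definition G_plus :: "(nat \<Rightarrow> real) \<Rightarrow> complex \<Rightarrow> complex" where
  "G_plus \<rho> lam =
     mu_plus lam * Jost_solution (b_seq \<rho> lam) (c_seq \<rho>) lam 1 *
       (g_plus \<rho> lam + lam / of_real (\<rho> 0))"

end

theory Submission
  imports Defs
begin

text \<open>
  Let \<open>V\<^sub>n = b\<^sub>n c\<^sub>n = \<lambda> - \<lambda> / \<rho>\<^sub>n\<close> and \<open>\<mu> = \<mu>\<^sub>+(\<lambda>)\<close>, and let \<open>J\<close> be the solution of (E) with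
  \<open>J\<^sub>n \<sim> \<mu>\<^sup>n\<^sup>+\<^sup>1\<close>, that is, \<open>\<mu>\<close> times the Jost solution. Each of the five functions equals its
  entry \<open>J\<^sub>-\<^sub>1\<close>; for the Jost function this is immediate.

  The main work is the scalar determinant. The Green function of the free operator
  \<open>S - S\<^sup>* - \<lambda>\<close> is, up to a sign depending on the column, \<open>\<mu> ^ (max n m + 1)\<close> times the entry at
  \<open>min n m\<close> of the free regular solution. A principal minor of such a matrix is a product over
  consecutive indices (\<open>fdet_green_insert\<close>, \<open>weighted_minor_insert\<close>). This bounds the minor
  on \<open>F\<close> by the product of \<open>C \<bar>V\<^sub>i\<bar>\<close> over \<open>i \<in> F\<close>, so the series of all minors converges
  absolutely and may be summed over the sets \<open>F \<subseteq> {..<N}\<close> with \<open>N \<rightarrow> \<infinity>\<close>. The alternating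
  sum over the sets with a given maximum is the variation of constants formula for the regular
  solution \<open>\<phi>\<close> of (E), and the alternating sum over all \<open>F \<subseteq> {..<N}\<close> is the Wronskian at \<open>N\<close>
  of \<open>\<phi>\<close> with the free decaying solution (\<open>sum_weighted_minors\<close>). Since \<open>\<phi>\<^sub>n = O(\<mu>\<^sup>-\<^sup>n)\<close>,
  passing from the free decaying solution to \<open>J\<close> costs \<open>o(1)\<close>; the Wronskian of \<open>J\<close> and
  \<open>\<phi>\<close> is constant and equals \<open>J\<^sub>-\<^sub>1\<close>.

  This series is the Fredholm determinant because the operator is of trace class: \<open>b\<^sub>n\<close> and \<open>c\<^sub>n\<close>
  are \<open>O(1/n)\<close>, so setting both to zero below index \<open>n\<close> changes the operator by rank at most
  \<open>2 n\<close> and leaves one of norm \<open>O(1/n\<^sup>2)\<close>. The resolvent is bounded because \<open>S - S\<^sup>*\<close> is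
  skew-adjoint and \<open>Re \<lambda> > 0\<close>.

  The other functions reduce to \<open>J\<close> directly. The matrix-valued operator is the scalar one
  acting on first components. The matrix-valued Jost solution has the columns \<open>0\<close> and
  \<open>(J\<^sub>n, J\<^sub>n\<^sub>-\<^sub>1)\<close>. The continued fraction converges to \<open>J\<^sub>1 / J\<^sub>0\<close> (\<open>cfrac_limit\<close>), and then
  \<open>(g\<^sub>+ + \<lambda> / \<rho>\<^sub>0) J\<^sub>0 = J\<^sub>1 + (\<lambda> / \<rho>\<^sub>0) J\<^sub>0 = J\<^sub>-\<^sub>1\<close> is (E) at \<open>n = 0\<close>.
\<close>

section \<open>Square-summable families and trace class operators\<close>

lemma ell2_sum_le_norm:
  fixes f :: "'i \<Rightarrow> 'a::real_normed_vector"
  assumes "f \<in> ell2" "finite F"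
  shows "(\<Sum>i\<in>F. (norm (f i))\<^sup>2) \<le> (ell2_norm f)\<^sup>2"
proof -
  have "(\<Sum>i\<in>F. (norm (f i))\<^sup>2) \<le> (\<Sum>\<^sub>\<infinity>i. (norm (f i))\<^sup>2)"
    by (rule finite_sum_le_infsum) (use assms in \<open>auto simp: ell2_def\<close>)
  moreover have "0 \<le> (\<Sum>\<^sub>\<infinity>i. (norm (f i))\<^sup>2)" by (rule infsum_nonneg) simp
  ultimately show ?thesis by (simp add: ell2_norm_def)
qed

lemma ell2_norm_nonneg [simp]: "0 \<le> ell2_norm f"
  by (simp add: ell2_norm_def infsum_nonneg)

text \<open>
  Membership in \<open>ell2\<close> and norm bounds are both statements about finite partial sums; this
  is how every later estimate reaches the infinite sums in the definitions.
\<close>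

lemma ell2_boundedI:
  fixes f :: "'i \<Rightarrow> 'a::real_normed_vector"
  assumes C: "0 \<le> C" and le: "\<And>F. finite F \<Longrightarrow> (\<Sum>i\<in>F. (norm (f i))\<^sup>2) \<le> C\<^sup>2"
  shows "f \<in> ell2" and "ell2_norm f \<le> C"
proof -
  have s: "(\<lambda>i. (norm (f i))\<^sup>2) summable_on UNIV"
    by (rule nonneg_bdd_above_summable_on) (use le in \<open>auto intro!: bdd_aboveI2[where M="C\<^sup>2"]\<close>)
  then show "f \<in> ell2" by (simp add: ell2_def)
  have "(\<Sum>\<^sub>\<infinity>i. (norm (f i))\<^sup>2) \<le> C\<^sup>2"
    by (rule infsum_le_finite_sums[OF s]) (use le in auto)
  then show "ell2_norm f \<le> C"
    using C by (simp add: ell2_norm_def real_le_lsqrt)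
qed

lemma ell2_L2_set_le:
  assumes "f \<in> ell2" "finite F"
  shows "L2_set (\<lambda>i. norm (f i)) F \<le> ell2_norm f"
  unfolding L2_set_def by (intro real_le_lsqrt sum_nonneg ell2_sum_le_norm assms) auto

lemma ell2_leI:
  fixes f :: "'i \<Rightarrow> 'a::real_normed_vector" and g :: "'i \<Rightarrow> 'b::real_normed_vector"
  assumes g: "g \<in> ell2" and C: "0 \<le> C" and le: "\<And>i. norm (f i) \<le> C * norm (g i)"
  shows "f \<in> ell2" and "ell2_norm f \<le> C * ell2_norm g"
proof -
  have *: "(\<Sum>i\<in>F. (norm (f i))\<^sup>2) \<le> (C * ell2_norm g)\<^sup>2" if "finite F" for F
  proof -
    have "(\<Sum>i\<in>F. (norm (f i))\<^sup>2) \<le> (\<Sum>i\<in>F. (C * norm (g i))\<^sup>2)"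
      by (intro sum_mono power_mono le) auto
    also have "\<dots> = C\<^sup>2 * (\<Sum>i\<in>F. (norm (g i))\<^sup>2)"
      by (simp add: power_mult_distrib sum_distrib_left)
    also have "\<dots> \<le> C\<^sup>2 * (ell2_norm g)\<^sup>2"
      by (intro mult_left_mono ell2_sum_le_norm g that) auto
    finally show ?thesis by (simp add: power_mult_distrib)
  qed
  show "f \<in> ell2" "ell2_norm f \<le> C * ell2_norm g"
    using ell2_boundedI[where C="C * ell2_norm g", OF _ *] C by auto
qed

lemma ell2_add:
  fixes f g :: "'i \<Rightarrow> 'a::real_normed_vector"
  assumes "f \<in> ell2" "g \<in> ell2"
  shows "(\<lambda>i. f i + g i) \<in> ell2" and "ell2_norm (\<lambda>i. f i + g i) \<le> ell2_norm f + ell2_norm g"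
proof -
  have *: "(\<Sum>i\<in>F. (norm (f i + g i))\<^sup>2) \<le> (ell2_norm f + ell2_norm g)\<^sup>2" if F: "finite F" for F
  proof -
    have "L2_set (\<lambda>i. norm (f i + g i)) F \<le> L2_set (\<lambda>i. norm (f i) + norm (g i)) F"
      by (intro L2_set_mono norm_triangle_ineq) auto
    also have "\<dots> \<le> L2_set (\<lambda>i. norm (f i)) F + L2_set (\<lambda>i. norm (g i)) F"
      by (rule L2_set_triangle_ineq)
    also have "\<dots> \<le> ell2_norm f + ell2_norm g"
      by (intro add_mono ell2_L2_set_le assms F)
    finally have "(L2_set (\<lambda>i. norm (f i + g i)) F)\<^sup>2 \<le> (ell2_norm f + ell2_norm g)\<^sup>2"
      by (intro power_mono) auto
    then show ?thesis by (simp add: L2_set_def sum_nonneg)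
  qed
  show "(\<lambda>i. f i + g i) \<in> ell2" "ell2_norm (\<lambda>i. f i + g i) \<le> ell2_norm f + ell2_norm g"
    using ell2_boundedI[where C="ell2_norm f + ell2_norm g", OF _ *] by auto
qed

lemma ell2_scale:
  fixes f :: "'i \<Rightarrow> complex"
  assumes "f \<in> ell2"
  shows "(\<lambda>i. a * f i) \<in> ell2" and "ell2_norm (\<lambda>i. a * f i) \<le> cmod a * ell2_norm f"
  using ell2_leI[OF assms, of "cmod a" "\<lambda>i. a * f i"] by (auto simp: norm_mult)

lemma ell2_diff:
  fixes f g :: "'i \<Rightarrow> complex"
  assumes "f \<in> ell2" "g \<in> ell2"
  shows "(\<lambda>i. f i - g i) \<in> ell2" and "ell2_norm (\<lambda>i. f i - g i) \<le> ell2_norm f + ell2_norm g"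
  using ell2_add[OF assms(1) ell2_scale(1)[OF assms(2), of "-1"]]
    ell2_scale(2)[OF assms(2), of "-1"] by auto

lemma unit_vector_ell2: "(\<lambda>k. if k = j then (1::complex) else 0) \<in> ell2"
proof (rule ell2_boundedI(1)[where C=1])
  fix F :: "'a set" assume F: "finite F"
  have "(\<Sum>i\<in>F. (cmod (if i = j then 1 else 0))\<^sup>2) = (\<Sum>i\<in>F. if i = j then 1 else 0)"
    by (rule sum.cong) auto
  also have "\<dots> \<le> (1::real)" using F by simp
  finally show "(\<Sum>i\<in>F. (cmod (if i = j then 1 else 0))\<^sup>2) \<le> 1\<^sup>2" by simp
qed auto

lemma op_norm_le:
  assumes "0 \<le> C" "\<And>f. f \<in> ell2 \<Longrightarrow> ell2_norm (T f) \<le> C * ell2_norm f"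
  shows "op_norm T \<le> C"
  unfolding op_norm_def by (rule cInf_lower) (use assms in \<open>auto intro!: bdd_belowI[where m=0]\<close>)

lemma bounded_opE:
  assumes "bounded_op T"
  obtains C where "0 \<le> C" "\<And>f. f \<in> ell2 \<Longrightarrow> ell2_norm (T f) \<le> C * ell2_norm f"
proof -
  obtain C where C: "\<And>f. f \<in> ell2 \<Longrightarrow> ell2_norm (T f) \<le> C * ell2_norm f"
    using assms unfolding bounded_op_def by blast
  show thesis
  proof (rule that[of "max C 0"])
    fix f :: "'a \<Rightarrow> complex" assume "f \<in> ell2"
    then have "ell2_norm (T f) \<le> C * ell2_norm f" by (rule C)
    also have "\<dots> \<le> max C 0 * ell2_norm f" by (intro mult_right_mono) auto
    finally show "ell2_norm (T f) \<le> max C 0 * ell2_norm f" .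
  qed auto
qed

lemma op_norm_nonneg:
  assumes "bounded_op T"
  shows "0 \<le> op_norm T"
proof -
  obtain C where "0 \<le> C" "\<And>f. f \<in> ell2 \<Longrightarrow> ell2_norm (T f) \<le> C * ell2_norm f"
    using bounded_opE[OF assms] by metis
  then show ?thesis unfolding op_norm_def by (intro cInf_greatest) auto
qed

lemma bounded_op_diff:
  assumes T: "bounded_op T" and F: "bounded_op F"
  shows "bounded_op (\<lambda>f i. T f i - F f i)"
proof -
  obtain C where C: "\<And>f. f \<in> ell2 \<Longrightarrow> ell2_norm (T f) \<le> C * ell2_norm f"
    using bounded_opE[OF T] by metis
  obtain D where D: "\<And>f. f \<in> ell2 \<Longrightarrow> ell2_norm (F f) \<le> D * ell2_norm f"
    using bounded_opE[OF F] by metis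
  have mem: "T f \<in> ell2" "F f \<in> ell2" if "f \<in> ell2" for f
    using that T F by (auto simp: bounded_op_def)
  have "\<forall>f\<in>ell2. ell2_norm (\<lambda>i. T f i - F f i) \<le> (C + D) * ell2_norm f"
  proof
    fix f :: "'a \<Rightarrow> complex" assume f: "f \<in> ell2"
    show "ell2_norm (\<lambda>i. T f i - F f i) \<le> (C + D) * ell2_norm f"
      using ell2_diff(2)[OF mem[OF f]] C[OF f] D[OF f] by (simp add: algebra_simps)
  qed
  then show ?thesis
    unfolding bounded_op_def
  proof (intro conjI exI[of _ "C + D"])
    show "\<forall>f\<in>ell2. (\<lambda>i. T f i - F f i) \<in> ell2" using ell2_diff(1)[OF mem] by blast
    show "\<forall>f\<in>ell2. ell2_norm (\<lambda>i. T f i - F f i) \<le> (C + D) * ell2_norm f" by fact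
  qed (use T F in \<open>auto simp: bounded_op_def algebra_simps\<close>)
qed

lemma singular_number_set_bdd_below:
  assumes "bounded_op T"
  shows "bdd_below {op_norm (\<lambda>f i. T f i - F f i) | F. bounded_op F \<and> rank_le F n}"
  by (rule bdd_belowI[where m=0]) (auto intro!: op_norm_nonneg bounded_op_diff assms)

lemma bounded_op_zero: "bounded_op (\<lambda>f i. 0)"
  using ell2_scale(1)[OF unit_vector_ell2, of 0]
  by (auto simp: bounded_op_def ell2_norm_def intro!: exI[of _ 0])

lemma rank_le_zero: "rank_le (\<lambda>f i. 0) n"
  unfolding rank_le_def by (auto intro!: exI[of _ "\<lambda>_. 0"])

lemma singular_number_nonneg:
  assumes "bounded_op T"
  shows "0 \<le> singular_number T n"
  unfolding singular_number_def
proof (rule cInf_greatest)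
  show "{op_norm (\<lambda>f i. T f i - F f i) |F. bounded_op F \<and> rank_le F n} \<noteq> {}"
    using bounded_op_zero rank_le_zero by blast
qed (auto intro!: op_norm_nonneg bounded_op_diff assms)

lemma rank_le_mono:
  assumes "rank_le F m" "m \<le> n"
  shows "rank_le F n"
proof -
  obtain g where g: "\<And>f. f \<in> ell2 \<Longrightarrow> \<exists>a::nat \<Rightarrow> complex. F f = (\<lambda>i. \<Sum>k<m. a k * g k i)"
    using assms(1) by (auto simp: rank_le_def)
  have "\<exists>a::nat \<Rightarrow> complex. F f = (\<lambda>i. \<Sum>k<n. a k * g k i)" if f: "f \<in> ell2" for f
  proof -
    obtain a where a: "F f = (\<lambda>i. \<Sum>k<m. a k * g k i)" using g[OF f] by blast
    have "(\<Sum>k<m. a k * g k i) = (\<Sum>k<n. (if k < m then a k else 0) * g k i)" for i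
      by (rule sum.mono_neutral_cong_left) (use assms(2) in auto)
    with a show ?thesis by (auto intro!: exI[of _ "\<lambda>k. if k < m then a k else 0"])
  qed
  then show ?thesis by (auto simp: rank_le_def)
qed

lemma summable_inverse_square: "summable (\<lambda>n. inverse ((real n + 1)\<^sup>2))"
proof -
  have "summable (\<lambda>n. inverse (real n ^ 2))" by (rule inverse_power_summable) simp
  then have "summable (\<lambda>n. inverse (real (Suc n) ^ 2))" by (rule summable_Suc_iff[THEN iffD2])
  then show ?thesis by (simp add: add.commute)
qed

text \<open>
  Errors of order \<open>1/n\<^sup>2\<close> for approximants of rank \<open>2 n\<close> bound the singular numbers by a
  summable sequence.
\<close>

lemma trace_class_approxI:
  assumes T: "bounded_op T" and C: "0 \<le> C"
    and F: "\<And>n. bounded_op (F n)" "\<And>n. rank_le (F n) (2 * n)"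
    and le: "\<And>n f. f \<in> ell2 \<Longrightarrow>
       ell2_norm (\<lambda>i. T f i - F n f i) \<le> C / (real n + 1)\<^sup>2 * ell2_norm f"
  shows "trace_class T"
proof -
  have *: "singular_number T n \<le> 4 * C * inverse ((real n + 1)\<^sup>2)" for n
  proof -
    let ?m = "n div 2"
    have "singular_number T n \<le> op_norm (\<lambda>f i. T f i - F ?m f i)"
      unfolding singular_number_def
      by (rule cInf_lower[OF _ singular_number_set_bdd_below[OF T]])
         (use F(1) rank_le_mono[OF F(2), of ?m n] in auto)
    also have "\<dots> \<le> C / (real ?m + 1)\<^sup>2"
      by (rule op_norm_le) (use C le in auto)
    also have "\<dots> \<le> C / ((real n + 1) / 2)\<^sup>2"
    proof (intro divide_left_mono power_mono mult_pos_pos zero_less_power C)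
      have "n \<le> 2 * ?m + 1" by presburger
      then have "real n \<le> real (2 * ?m + 1)" by (rule of_nat_mono)
      then show "(real n + 1) / 2 \<le> real ?m + 1" by simp
    qed auto
    also have "\<dots> = 4 * C * inverse ((real n + 1)\<^sup>2)" by (simp add: field_simps)
    finally show ?thesis .
  qed
  have "summable (\<lambda>n. 4 * C * inverse ((real n + 1)\<^sup>2))"
    by (intro summable_mult summable_inverse_square)
  then have "summable (singular_number T)"
    by (rule summable_comparison_test'[where N=0]) (use singular_number_nonneg[OF T] * in simp)
  with T show ?thesis by (simp add: trace_class_def)
qed

text \<open>
  The determinant sees only the action on \<open>ell2\<close>. This disposes of the arbitrary values that
  an inverse taken on a carrier set has elsewhere.
\<close>

lemma bounded_op_cong:
  assumes eq: "\<And>f. f \<in> ell2 \<Longrightarrow> T f = T' f" and T': "bounded_op T'"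
  shows "bounded_op T"
  using T' unfolding bounded_op_def by (simp add: eq ell2_add(1) ell2_scale(1))

lemma det_I_minus_cong:
  assumes eq: "\<And>f. f \<in> ell2 \<Longrightarrow> T f = T' f"
  shows "det_I_minus T = det_I_minus T'"
proof -
  have "op_norm (\<lambda>f i. T f i - F f i) = op_norm (\<lambda>f i. T' f i - F f i)" for F
    unfolding op_norm_def using eq by simp
  then have "singular_number T = singular_number T'"
    by (simp add: singular_number_def fun_eq_iff)
  moreover have "bounded_op T \<longleftrightarrow> bounded_op T'"
    using bounded_op_cong[of T T'] bounded_op_cong[of T' T] eq by auto
  moreover have "op_entry T = op_entry T'"
    by (simp add: op_entry_def eq unit_vector_ell2 fun_eq_iff)
  ultimately show ?thesis
    by (simp add: det_I_minus_def trace_class_def trace_ext_power_def principal_minor_def)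
qed

text \<open>
  An operator on scalar sequences, made to act on the first components of
  \<open>\<complex>\<^sup>2\<close>-valued sequences.
\<close>

definition lift_op ::
  "((nat \<Rightarrow> complex) \<Rightarrow> (nat \<Rightarrow> complex)) \<Rightarrow> (nat \<times> 2 \<Rightarrow> complex) \<Rightarrow> (nat \<times> 2 \<Rightarrow> complex)" where
  "lift_op T x = (\<lambda>(n, j). if j = 1 then T (\<lambda>m. x (m, 1)) n else 0)"

lemma first_component_ell2:
  fixes x :: "nat \<times> 2 \<Rightarrow> complex"
  assumes "x \<in> ell2"
  shows "(\<lambda>m. x (m, 1)) \<in> ell2" and "ell2_norm (\<lambda>m. x (m, 1)) \<le> ell2_norm x"
proof -
  have *: "(\<Sum>m\<in>F. (norm (x (m, 1)))\<^sup>2) \<le> (ell2_norm x)\<^sup>2" if "finite F" for F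
  proof -
    have "(\<Sum>m\<in>F. (norm (x (m, 1)))\<^sup>2) = (\<Sum>i\<in>(\<lambda>m. (m, 1)) ` F. (norm (x i))\<^sup>2)"
      by (subst sum.reindex) (auto simp: inj_on_def)
    also have "\<dots> \<le> (ell2_norm x)\<^sup>2" by (rule ell2_sum_le_norm) (use assms that in auto)
    finally show ?thesis .
  qed
  show "(\<lambda>m. x (m, 1)) \<in> ell2" "ell2_norm (\<lambda>m. x (m, 1)) \<le> ell2_norm x"
    by (rule ell2_boundedI[OF _ *]; simp)+
qed

lemma extend_by_zero_ell2:
  fixes y :: "nat \<Rightarrow> complex"
  assumes "y \<in> ell2"
  shows "(\<lambda>(n, j::2). if j = 1 then y n else 0) \<in> ell2" (is "?x \<in> _")
    and "ell2_norm (\<lambda>(n, j::2). if j = 1 then y n else 0) \<le> ell2_norm y"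
proof -
  have *: "(\<Sum>i\<in>F. (norm (?x i))\<^sup>2) \<le> (ell2_norm y)\<^sup>2" if F: "finite F" for F
  proof -
    have "F \<subseteq> fst ` F \<times> UNIV" by force
    then have "(\<Sum>i\<in>F. (norm (?x i))\<^sup>2) \<le> (\<Sum>i\<in>fst ` F \<times> UNIV. (norm (?x i))\<^sup>2)"
      by (intro sum_mono2) (use F in auto)
    also have "\<dots> = (\<Sum>m\<in>fst ` F. \<Sum>j\<in>UNIV. (norm (?x (m, j)))\<^sup>2)"
      by (subst sum.cartesian_product) (auto intro!: sum.cong)
    also have "\<dots> = (\<Sum>m\<in>fst ` F. (norm (y m))\<^sup>2)" by (simp add: UNIV_2)
    also have "\<dots> \<le> (ell2_norm y)\<^sup>2" by (rule ell2_sum_le_norm) (use assms F in auto)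
    finally show ?thesis .
  qed
  show "?x \<in> ell2" "ell2_norm ?x \<le> ell2_norm y"
    by (rule ell2_boundedI[OF _ *]; simp)+
qed

lemma lift_op_norm_le:
  assumes T: "\<And>f. f \<in> ell2 \<Longrightarrow> T f \<in> ell2" and C: "0 \<le> C"
    and le: "\<And>f. f \<in> ell2 \<Longrightarrow> ell2_norm (T f) \<le> C * ell2_norm f" and x: "x \<in> ell2"
  shows "ell2_norm (lift_op T x) \<le> C * ell2_norm x"
proof -
  have "ell2_norm (lift_op T x) \<le> ell2_norm (T (\<lambda>m. x (m, 1)))"
    unfolding lift_op_def by (rule extend_by_zero_ell2(2)[OF T[OF first_component_ell2(1)[OF x]]])
  also have "\<dots> \<le> C * ell2_norm (\<lambda>m. x (m, 1))" by (rule le[OF first_component_ell2(1)[OF x]])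
  also have "\<dots> \<le> C * ell2_norm x" by (rule mult_left_mono[OF first_component_ell2(2)[OF x] C])
  finally show ?thesis .
qed

lemma bounded_op_lift:
  assumes T: "bounded_op T"
  shows "bounded_op (lift_op T)"
proof -
  obtain C where C: "0 \<le> C" "\<And>f. f \<in> ell2 \<Longrightarrow> ell2_norm (T f) \<le> C * ell2_norm f"
    using bounded_opE[OF T] by metis
  have mem: "T f \<in> ell2" if "f \<in> ell2" for f using T that by (auto simp: bounded_op_def)
  have "lift_op T f \<in> ell2" if "f \<in> ell2" for f
    unfolding lift_op_def by (rule extend_by_zero_ell2(1)[OF mem[OF first_component_ell2(1)[OF that]]])
  moreover have "lift_op T (\<lambda>i. f i + g i) = (\<lambda>i. lift_op T f i + lift_op T g i)"
    if "f \<in> ell2" "g \<in> ell2" for f g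
    using T first_component_ell2(1)[OF that(1)] first_component_ell2(1)[OF that(2)]
    by (auto simp: lift_op_def bounded_op_def fun_eq_iff)
  moreover have "lift_op T (\<lambda>i. a * f i) = (\<lambda>i. a * lift_op T f i)" if "f \<in> ell2" for a f
    using T first_component_ell2(1)[OF that] by (auto simp: lift_op_def bounded_op_def fun_eq_iff)
  moreover have "ell2_norm (lift_op T f) \<le> C * ell2_norm f" if "f \<in> ell2" for f
    by (rule lift_op_norm_le) (use mem C that in auto)
  ultimately show ?thesis unfolding bounded_op_def by blast
qed

lemma rank_le_lift:
  assumes "rank_le F n"
  shows "rank_le (lift_op F) n"
proof -
  obtain g where g: "\<And>f. f \<in> ell2 \<Longrightarrow> \<exists>a::nat \<Rightarrow> complex. F f = (\<lambda>i. \<Sum>k<n. a k * g k i)"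
    using assms by (auto simp: rank_le_def)
  have *: "\<exists>a::nat \<Rightarrow> complex. lift_op F x = (\<lambda>i. \<Sum>k<n. a k * (case i of (m, j) \<Rightarrow> if j = 1 then g k m else 0))"
    if x: "x \<in> ell2" for x
  proof -
    obtain a where "F (\<lambda>m. x (m, 1)) = (\<lambda>i. \<Sum>k<n. a k * g k i)"
      using g[OF first_component_ell2(1)[OF x]] by blast
    then show ?thesis by (auto simp: lift_op_def fun_eq_iff intro!: exI[of _ a])
  qed
  show ?thesis
    unfolding rank_le_def
    by (rule exI[of _ "\<lambda>k i. case i of (m, j) \<Rightarrow> if j = 1 then g k m else 0"]) (use * in blast)
qed

lemma trace_class_lift:
  assumes "trace_class T"
  shows "trace_class (lift_op T)"
proof -
  have T: "bounded_op T" and s: "summable (singular_number T)"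
    using assms by (auto simp: trace_class_def)
  have "singular_number (lift_op T) n \<le> singular_number T n" for n
    unfolding singular_number_def[of T]
  proof (rule cInf_greatest)
    show "{op_norm (\<lambda>f i. T f i - F f i) |F. bounded_op F \<and> rank_le F n} \<noteq> {}"
      using bounded_op_zero rank_le_zero by blast
  next
    fix t assume "t \<in> {op_norm (\<lambda>f i. T f i - F f i) |F. bounded_op F \<and> rank_le F n}"
    then obtain F where F: "bounded_op F" "rank_le F n" and t: "t = op_norm (\<lambda>f i. T f i - F f i)"
      by auto
    define D where "D = (\<lambda>f i. T f i - F f i)"
    have D: "bounded_op D" unfolding D_def by (rule bounded_op_diff[OF T F(1)])
    have "singular_number (lift_op T) n \<le> op_norm (\<lambda>f i. lift_op T f i - lift_op F f i)"
      unfolding singular_number_def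
      by (rule cInf_lower[OF _ singular_number_set_bdd_below[OF bounded_op_lift[OF T]]])
         (use bounded_op_lift[OF F(1)] rank_le_lift[OF F(2)] in auto)
    also have "(\<lambda>f i. lift_op T f i - lift_op F f i) = lift_op D"
      by (auto simp: lift_op_def D_def fun_eq_iff)
    also have "op_norm (lift_op D) \<le> op_norm D"
      unfolding op_norm_def[of D]
    proof (rule cInf_greatest)
      obtain C where "0 \<le> C" "\<And>f. f \<in> ell2 \<Longrightarrow> ell2_norm (D f) \<le> C * ell2_norm f"
        using bounded_opE[OF D] by metis
      then show "{C. 0 \<le> C \<and> (\<forall>f\<in>ell2. ell2_norm (D f) \<le> C * ell2_norm f)} \<noteq> {}"
        by blast
    next
      fix C assume "C \<in> {C. 0 \<le> C \<and> (\<forall>f\<in>ell2. ell2_norm (D f) \<le> C * ell2_norm f)}"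
      then show "op_norm (lift_op D) \<le> C"
        by (intro op_norm_le lift_op_norm_le) (use D in \<open>auto simp: bounded_op_def\<close>)
    qed
    finally show "singular_number (lift_op T) n \<le> t" by (simp add: t D_def)
  qed
  then have "summable (singular_number (lift_op T))"
    using summable_comparison_test'[OF s, of 0 "singular_number (lift_op T)"]
      singular_number_nonneg[OF bounded_op_lift[OF T]] by auto
  then show ?thesis by (simp add: trace_class_def bounded_op_lift[OF T])
qed

section \<open>Minors of a Green matrix\<close>

definition fdet :: "'i set \<Rightarrow> ('i \<Rightarrow> 'i \<Rightarrow> complex) \<Rightarrow> complex" where
  "fdet F M = (\<Sum>p | p permutes F. of_int (sign p) * (\<Prod>i\<in>F. M i (p i)))"

lemma principal_minor_fdet: "principal_minor T F = fdet F (op_entry T)"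
  by (simp add: principal_minor_def fdet_def)

lemma fdet_empty [simp]: "fdet {} M = 1"
  by (simp add: fdet_def)

lemma fdet_cong:
  assumes "\<And>i j. i \<in> F \<Longrightarrow> j \<in> F \<Longrightarrow> M i j = M' i j"
  shows "fdet F M = fdet F M'"
  unfolding fdet_def by (intro sum.cong arg_cong2[where f="(*)"] prod.cong refl)
    (use assms in \<open>auto simp: permutes_in_image\<close>)

lemma fdet_scale:
  "fdet F (\<lambda>i j. c i * M i j * d j) = (\<Prod>i\<in>F. c i * d i) * fdet F M"
proof -
  have "(\<Prod>i\<in>F. c i * M i (p i) * d (p i)) = (\<Prod>i\<in>F. c i * d i) * (\<Prod>i\<in>F. M i (p i))"
    if "p permutes F" for p
    using prod.permute[OF that, of d] by (simp add: prod.distrib)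
  then show ?thesis
    unfolding fdet_def sum_distrib_left by (intro sum.cong) (auto simp: mult.left_commute)
qed

text \<open>
  The subtracted part is the determinant with row \<open>a\<close> repeated at \<open>m\<close>; composing the
  permutations with the transposition of \<open>a\<close> and \<open>m\<close> shows that it equals its own negative.
\<close>

lemma fdet_row_operation:
  assumes F: "finite F" and am: "a \<in> F" "m \<in> F" "a \<noteq> m"
  shows "fdet F (\<lambda>i j. if i = m then M m j - s * M a j else M i j) = fdet F M"
proof -
  let ?t = "Transposition.transpose a m"
  let ?E = "\<lambda>p. of_int (sign p) * (M a (p m) * (\<Prod>i\<in>F - {m}. M i (p i)))"
  have split: "(\<Prod>i\<in>F. M i (p i)) = M m (p m) * (\<Prod>i\<in>F - {m}. M i (p i))" for p
    by (rule prod.remove[OF F am(2)])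
  \<comment> \<open>\<open>?E p\<close> is the term of \<open>p\<close> in the determinant with row \<open>a\<close> in place of row \<open>m\<close>.\<close>
  have swap: "?E (p \<circ> ?t) = - ?E p" if "p permutes F" for p
  proof -
    have p: "permutation p" using that F by (auto simp: permutation_permutes)
    have rest: "(\<Prod>i\<in>F - {m} - {a}. M i ((p \<circ> ?t) i)) = (\<Prod>i\<in>F - {m} - {a}. M i (p i))"
      by (rule prod.cong) (auto simp: transpose_def)
    have "(\<Prod>i\<in>F - {m}. M i (q i)) = M a (q a) * (\<Prod>i\<in>F - {m} - {a}. M i (q i))" for q
      by (rule prod.remove) (use F am in auto)
    then show ?thesis
      using rest p am(3) by (simp add: sign_compose permutation_swap_id sign_swap_id)
  qed
  have "sum ?E {p. p permutes F} = (\<Sum>p | p permutes F. ?E (p \<circ> ?t))"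
    by (rule sum_permutations_compose_right) (use am in \<open>auto intro: permutes_swap_id\<close>)
  also have "\<dots> = (\<Sum>p | p permutes F. - ?E p)" by (intro sum.cong swap) auto
  also have "\<dots> = - sum ?E {p. p permutes F}" by (rule sum_negf)
  finally have E0: "sum ?E {p. p permutes F} = 0" by simp
  have row: "(\<Prod>i\<in>F. if i = m then M m (p i) - s * M a (p i) else M i (p i))
      = (\<Prod>i\<in>F. M i (p i)) - s * (M a (p m) * (\<Prod>i\<in>F - {m}. M i (p i)))" for p
  proof -
    have "(\<Prod>i\<in>F. if i = m then M m (p i) - s * M a (p i) else M i (p i))
      = (M m (p m) - s * M a (p m)) * (\<Prod>i\<in>F - {m}. M i (p i))"
      by (subst prod.remove[OF F am(2)]) (auto intro!: arg_cong2[where f="(*)"] prod.cong)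
    then show ?thesis by (simp add: split algebra_simps)
  qed
  have "fdet F (\<lambda>i j. if i = m then M m j - s * M a j else M i j)
      = fdet F M - s * sum ?E {p. p permutes F}"
    unfolding fdet_def row
    by (simp add: sum_distrib_left sum_subtractf right_diff_distrib mult.left_commute)
  then show ?thesis by (simp add: E0)
qed

lemma fdet_insert_zero_row:
  assumes F: "finite F" "m \<notin> F" and zero: "\<And>j. j \<in> F \<Longrightarrow> M m j = 0"
  shows "fdet (insert m F) M = M m m * fdet F M"
proof -
  let ?f = "\<lambda>p. of_int (sign p) * (\<Prod>i\<in>insert m F. M i (p i))"
  have "sum ?f {p. p permutes insert m F} = sum ?f {p. p permutes F}"
  proof (rule sum.mono_neutral_right)
    show "finite {p. p permutes insert m F}" using F by (intro finite_permutations) auto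
    show "{p. p permutes F} \<subseteq> {p. p permutes insert m F}"
      by (auto intro: permutes_subset)
    show "\<forall>p\<in>{p. p permutes insert m F} - {p. p permutes F}. ?f p = 0"
    proof
      fix p assume "p \<in> {p. p permutes insert m F} - {p. p permutes F}"
      then have p: "p permutes insert m F" "\<not> p permutes F" by auto
      have "p m \<noteq> m"
      proof
        assume "p m = m"
        then have "p permutes F" using p(1) by (intro permutes_superset[OF p(1)]) auto
        with p(2) show False by simp
      qed
      moreover have "p m \<in> insert m F" using permutes_in_image[OF p(1), of m] by blast
      ultimately have "M m (p m) = 0" using zero by auto
      then show "?f p = 0" using F by simp
    qed
  qed
  also have "\<dots> = (\<Sum>p | p permutes F. M m m * (of_int (sign p) * (\<Prod>i\<in>F. M i (p i))))"
    using F by (intro sum.cong) (auto simp: permutes_not_in)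
  finally show ?thesis by (simp add: fdet_def sum_distrib_left)
qed

lemma fdet_zero_row:
  assumes "finite F" "m \<in> F" and "\<And>j. j \<in> F \<Longrightarrow> M m j = 0"
  shows "fdet F M = 0"
  unfolding fdet_def
proof (rule sum.neutral, rule ballI)
  fix p assume "p \<in> {p. p permutes F}"
  then have "M m (p m) = 0" using assms by (simp add: permutes_in_image)
  then show "of_int (sign p) * (\<Prod>i\<in>F. M i (p i)) = 0" using assms by (auto intro: prod_zero)
qed

text \<open>
  A matrix with entries \<open>\<phi> (max i j) * \<psi> (min i j)\<close> has proportional rows to the left of the
  diagonal. One row operation clears the last row up to its diagonal entry, so the minors are
  products over consecutive indices.
\<close>

lemma fdet_green_insert:
  fixes \<phi> \<psi> :: "nat \<Rightarrow> complex"
  assumes F: "finite F" and a: "a \<in> F" "\<And>i. i \<in> F \<Longrightarrow> i \<le> a" and m: "a < m" and nz: "\<phi> a \<noteq> 0"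
  shows "fdet (insert m F) (\<lambda>i j. \<phi> (max i j) * \<psi> (min i j))
       = \<phi> m / \<phi> a * (\<phi> a * \<psi> m - \<phi> m * \<psi> a) * fdet F (\<lambda>i j. \<phi> (max i j) * \<psi> (min i j))"
proof -
  let ?G = "\<lambda>i j. \<phi> (max i j) * \<psi> (min i j)"
  let ?M = "\<lambda>i j. if i = m then ?G m j - \<phi> m / \<phi> a * ?G a j else ?G i j"
  have mF: "m \<notin> F" using a(2) m by fastforce
  have "fdet (insert m F) ?G = fdet (insert m F) ?M"
    using fdet_row_operation[of "insert m F" a m ?G "\<phi> m / \<phi> a"] F a(1) m by simp
  also have "\<dots> = ?M m m * fdet F ?M"
  proof (rule fdet_insert_zero_row[OF F mF])
    fix j assume "j \<in> F"
    then have "j \<le> a" by (rule a(2))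
    then have "max m j = m" "min m j = j" "max a j = a" "min a j = j" using m by auto
    then show "?M m j = 0" using nz by simp
  qed
  also have "fdet F ?M = fdet F ?G" by (rule fdet_cong) (use mF in auto)
  also have "?M m m = \<phi> m / \<phi> a * (\<phi> a * \<psi> m - \<phi> m * \<psi> a)"
    using m nz by (simp add: max_def min_def field_simps)
  finally show ?thesis .
qed

section \<open>Sums over the finite sets of natural numbers\<close>

text \<open>
  The sum over the subsets of \<open>{..<N}\<close> is the product of the factors \<open>1 + a i\<close>.
\<close>

lemma summable_on_finite_set_products:
  fixes a :: "nat \<Rightarrow> real"
  assumes nn: "\<And>i. 0 \<le> a i" and s: "summable a"
  shows "(\<lambda>F. \<Prod>i\<in>F. a i) summable_on {F. finite F}"
proof (rule nonneg_bdd_above_summable_on)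
  show "bdd_above (sum (\<lambda>F. \<Prod>i\<in>F. a i) ` {X. X \<subseteq> {F. finite F} \<and> finite X})"
  proof (rule bdd_aboveI2[where M="exp (suminf a)"])
    fix X :: "nat set set" assume X: "X \<in> {X. X \<subseteq> {F. finite F} \<and> finite X}"
    then have "finite (\<Union>X)" by auto
    then obtain N where N: "\<Union>X \<subseteq> {..<N}" by (metis finite_nat_iff_bounded)
    have "X \<subseteq> Pow {..<N}" by (rule order_trans[OF subset_Pow_Union Pow_mono[OF N]])
    then have "(\<Sum>F\<in>X. \<Prod>i\<in>F. a i) \<le> (\<Sum>F\<in>Pow {..<N}. \<Prod>i\<in>F. a i)"
      by (intro sum_mono2 prod_nonneg nn) auto
    also have "\<dots> = (\<Prod>i<N. a i + 1)"
      by (subst prod_add) auto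
    also have "\<dots> \<le> (\<Prod>i<N. exp (a i))"
      by (rule prod_mono) (use nn in \<open>auto simp: add.commute add_nonneg_nonneg\<close>)
    also have "\<dots> = exp (\<Sum>i<N. a i)" by (simp add: exp_sum)
    also have "\<dots> \<le> exp (suminf a)" using s nn by (simp add: sum_le_suminf)
    finally show "(\<Sum>F\<in>X. \<Prod>i\<in>F. a i) \<le> exp (suminf a)" .
  qed
qed (use nn in \<open>auto intro!: prod_nonneg\<close>)

lemma filterlim_Pow_lessThan:
  "filterlim (\<lambda>N. Pow {..<N}) (finite_subsets_at_top {F :: nat set. finite F}) sequentially"
  unfolding filterlim_iff eventually_finite_subsets_at_top
proof (intro allI impI)
  fix P :: "nat set set \<Rightarrow> bool"
  assume "\<exists>X. finite X \<and> X \<subseteq> {F. finite F} \<and> (\<forall>Y. finite Y \<and> X \<subseteq> Y \<and> Y \<subseteq> {F. finite F} \<longrightarrow> P Y)"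
  then obtain X where "finite X \<and> X \<subseteq> {F. finite F} \<and>
      (\<forall>Y. finite Y \<and> X \<subseteq> Y \<and> Y \<subseteq> {F. finite F} \<longrightarrow> P Y)" ..
  then have X: "finite X" "X \<subseteq> {F. finite F}"
    and P: "finite Y \<Longrightarrow> X \<subseteq> Y \<Longrightarrow> Y \<subseteq> {F. finite F} \<Longrightarrow> P Y" for Y by simp_all
  have "finite (\<Union>X)" using X by auto
  then obtain N where N: "\<Union>X \<subseteq> {..<N}" by (metis finite_nat_iff_bounded)
  show "\<forall>\<^sub>F n in sequentially. P (Pow {..<n})"
  proof (rule eventually_sequentiallyI[of N])
    fix n assume "N \<le> n"
    then have "{..<N} \<subseteq> {..<n}" by auto
    with N have "Pow (\<Union>X) \<subseteq> Pow {..<n}" by (intro Pow_mono) (rule order_trans)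
    then have "X \<subseteq> Pow {..<n}" by (rule order_trans[OF subset_Pow_Union])
    moreover have "Pow {..<n} \<subseteq> {F. finite F}" by (auto simp: finite_subset[OF _ finite_lessThan])
    ultimately show "P (Pow {..<n})" by (intro P) simp_all
  qed
qed

text \<open>
  Absolute summability over all finite sets at once allows the sets to be grouped by cardinality,
  as in the definition of the determinant, or by a bound on their elements.
\<close>

lemma tendsto_sum_finite_sets:
  fixes f :: "nat set \<Rightarrow> complex"
  assumes f: "(\<lambda>F. norm (f F)) summable_on {F. finite F}"
  shows "(\<lambda>N. \<Sum>F\<in>Pow {..<N}. (-1) ^ card F * f F) \<longlonglongrightarrow>
           (\<Sum>k. (-1) ^ k * (\<Sum>\<^sub>\<infinity>F\<in>{F. finite F \<and> card F = k}. f F))"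
proof -
  define g where "g F = (-1) ^ card F * f F" for F
  have gn: "(\<lambda>F. norm (g F)) summable_on {F. finite F}"
    using f by (simp add: g_def norm_mult norm_power)
  then have gs: "g summable_on {F. finite F}" by (rule abs_summable_summable)
  define S where "S = infsum g {F. finite F}"
  have S: "(g has_sum S) {F. finite F}" unfolding S_def using gs by (rule has_sum_infsum)
  define B where "B k = {F :: nat set. finite F \<and> card F = k}" for k
  have im: "Sigma UNIV B = (\<lambda>F. (card F, F)) ` {F. finite F}" by (auto simp: B_def)
  have "((\<lambda>(k, F). g F) has_sum S) (Sigma UNIV B)"
    unfolding im by (subst has_sum_reindex) (use S in \<open>auto simp: inj_on_def o_def\<close>)
  moreover have "((\<lambda>F. (\<lambda>(k, F). g F) (k, F)) has_sum infsum g (B k)) (B k)" for k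
  proof -
    have "g summable_on B k" by (rule summable_on_subset_banach[OF gs]) (auto simp: B_def)
    then show ?thesis by (simp add: has_sum_infsum)
  qed
  ultimately have "((\<lambda>k. infsum g (B k)) has_sum S) UNIV" by (rule has_sum_Sigma')
  then have "(\<lambda>k. infsum g (B k)) sums S" by (rule has_sum_imp_sums)
  moreover have "infsum g (B k) = (-1) ^ k * infsum f (B k)" for k
  proof -
    have "infsum g (B k) = infsum (\<lambda>F. (-1) ^ k * f F) (B k)"
      by (rule infsum_cong) (auto simp: B_def g_def)
    then show ?thesis by (simp add: infsum_cmult_right')
  qed
  ultimately have "S = (\<Sum>k. (-1) ^ k * infsum f (B k))" by (simp add: sums_unique)
  moreover have "(\<lambda>N. sum g (Pow {..<N})) \<longlonglongrightarrow> S"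
    using filterlim_compose[OF S[unfolded has_sum_def] filterlim_Pow_lessThan] .
  ultimately show ?thesis by (simp add: g_def B_def)
qed

section \<open>The perturbed difference equation\<close>

fun recurrence :: "complex \<Rightarrow> (nat \<Rightarrow> complex) \<Rightarrow> complex \<Rightarrow> complex \<Rightarrow> nat \<Rightarrow> complex" where
  "recurrence lam V x y 0 = x"
| "recurrence lam V x y (Suc 0) = y"
| "recurrence lam V x y (Suc (Suc n)) =
     recurrence lam V x y n + (V n - lam) * recurrence lam V x y (Suc n)"

text \<open>
  The sequences carry the index shift of the encoding of \<open>(z\<^sub>n)\<close>, \<open>n \<ge> -1\<close>: the entry at
  \<open>k\<close> is \<open>z\<close> with index \<open>k - 1\<close>, so the potential is one step behind.
\<close>

locale difference_equation =
  fixes lam mu :: complex and V :: "nat \<Rightarrow> complex"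
  assumes root: "mu\<^sup>2 + lam * mu - 1 = 0" and small: "cmod mu < 1"
    and V_summable: "summable (\<lambda>n. cmod (V n))"
begin

definition sol :: "(nat \<Rightarrow> complex) \<Rightarrow> bool" where
  "sol z \<longleftrightarrow> (\<forall>n. z n - z (n + 2) + V n * z (n + 1) = lam * z (n + 1))"

lemma mu_nonzero: "mu \<noteq> 0"
  using root by auto

lemma mu_square: "mu * mu = 1 - lam * mu"
  using root by (simp add: power2_eq_square algebra_simps)

lemma sol_step: "sol z \<Longrightarrow> z (Suc (Suc n)) = z n + (V n - lam) * z (Suc n)"
  by (simp add: sol_def algebra_simps add_eq_0_iff2 eq_neg_iff_add_eq_0 diff_eq_eq)

lemma sol_recurrence: "sol (recurrence lam V x y)"
  by (simp add: sol_def algebra_simps)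

lemma sol_eqI:
  assumes "sol z" "sol w" "z 0 = w 0" "z 1 = w 1"
  shows "z = w"
proof
  fix n
  have "z n = w n \<and> z (Suc n) = w (Suc n)"
    by (induction n) (use assms in \<open>auto simp: sol_step\<close>)
  then show "z n = w n" ..
qed

lemma sol_add:
  assumes "sol z" "sol w" shows "sol (\<lambda>n. z n + w n)"
  unfolding sol_def
proof
  fix n
  have "(z n - z (n + 2) + V n * z (n + 1)) + (w n - w (n + 2) + V n * w (n + 1))
      = lam * z (n + 1) + lam * w (n + 1)"
    using assms unfolding sol_def by metis
  then show "z n + w n - (z (n + 2) + w (n + 2)) + V n * (z (n + 1) + w (n + 1))
      = lam * (z (n + 1) + w (n + 1))"
    by (simp add: algebra_simps)
qed

lemma sol_scale:
  assumes "sol z" shows "sol (\<lambda>n. a * z n)"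
  unfolding sol_def
proof
  fix n
  have "a * (z n - z (n + 2) + V n * z (n + 1)) = a * (lam * z (n + 1))"
    using assms unfolding sol_def by metis
  then show "a * z n - a * z (n + 2) + V n * (a * z (n + 1)) = lam * (a * z (n + 1))"
    by (simp add: algebra_simps)
qed

text \<open>
  The recurrence can be run backwards as well, so Cauchy data may be prescribed anywhere.
\<close>

lemma sol_exists_at: "\<exists>z. sol z \<and> z N = x \<and> z (Suc N) = y"
proof (induction N arbitrary: x y)
  case 0
  show ?case by (rule exI[of _ "recurrence lam V x y"]) (simp add: sol_recurrence)
next
  case (Suc N)
  obtain z where z: "sol z" "z N = y - (V N - lam) * x" "z (Suc N) = x" using Suc by blast
  then have "z (Suc (Suc N)) = y" by (simp add: sol_step)
  with z show ?case by blast
qed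

text \<open>
  The equation has modes behaving like \<open>\<mu>\<^sup>k\<close> and \<open>(- 1 / \<mu>)\<^sup>k\<close>, whose ratio is \<open>- \<mu>\<^sup>2\<close> per
  step. A perturbation fed into the inferior mode is therefore damped by \<open>\<bar>\<mu>\<bar>\<^sup>2\<close>, and this
  constant is the sum of the resulting geometric series.
\<close>

definition gronwall_const :: real where
  "gronwall_const = 1 / (1 - (cmod mu)\<^sup>2)"

definition gronwall_bound :: real where
  "gronwall_bound = exp (gronwall_const * (\<Sum>n. cmod (V n)))"

lemma mod_square_less_1: "(cmod mu)\<^sup>2 < 1"
  using small by (simp add: power_less_one_iff abs_square_less_1)

lemma gronwall_const_pos: "0 < gronwall_const"
  using mod_square_less_1 by (simp add: gronwall_const_def)

lemma gronwall_const_eq: "1 + gronwall_const * (cmod mu)\<^sup>2 = gronwall_const"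
  using mod_square_less_1 by (simp add: gronwall_const_def field_simps)

lemma gronwall_prod_le:
  assumes "finite A"
  shows "(\<Prod>j\<in>A. 1 + gronwall_const * cmod (V j)) \<le> gronwall_bound"
proof -
  have "(\<Prod>j\<in>A. 1 + gronwall_const * cmod (V j)) \<le> (\<Prod>j\<in>A. exp (gronwall_const * cmod (V j)))"
    by (rule prod_mono) (use gronwall_const_pos in auto)
  also have "\<dots> = exp (gronwall_const * (\<Sum>j\<in>A. cmod (V j)))"
    using assms by (simp add: exp_sum sum_distrib_left)
  also have "\<dots> \<le> gronwall_bound"
    unfolding gronwall_bound_def using gronwall_const_pos assms V_summable
    by (auto intro!: sum_le_suminf)
  finally show ?thesis .
qed

text \<open>
  The combination \<open>v\<^sub>k\<^sub>+\<^sub>1 + v\<^sub>k / \<mu>\<close> annihilates the growing free mode. With the weight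
  \<open>gronwall_const\<close> on it, the quantity \<open>L\<close> below gains at most a factor \<open>1 + C \<bar>V\<^sub>k\<bar>\<close> in
  each step, and the product of these factors converges.
\<close>

lemma sol_growth:
  assumes v: "sol v"
  obtains C where "0 < C" "\<And>k. cmod (mu ^ k * v k) \<le> C"
proof -
  define p where "p k = mu ^ k * v k" for k
  define Y where "Y k = p (Suc k) + p k" for k
  let ?c = gronwall_const
  define L where "L k = cmod (p k) + ?c * cmod (Y k)" for k
  have Y: "Y (Suc k) = mu * mu * Y k + mu * V k * p (Suc k)" for k
  proof -
    have "Y (Suc k) = mu ^ k * (mu * mu * v (Suc (Suc k)) + mu * v (Suc k))"
      by (simp add: Y_def p_def algebra_simps)
    also have "mu * mu * v (Suc (Suc k)) + mu * v (Suc k) =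
        mu * mu * v k + mu * mu * V k * v (Suc k) + mu * (1 - lam * mu) * v (Suc k)"
      by (simp add: sol_step[OF v] algebra_simps)
    also have "mu * (1 - lam * mu) = mu * (mu * mu)" by (simp add: mu_square)
    finally show ?thesis by (simp add: Y_def p_def algebra_simps)
  qed
  have step: "L (Suc k) \<le> (1 + ?c * cmod (V k)) * L k" for k
  proof -
    have a: "cmod (p (Suc k)) \<le> cmod (p k) + cmod (Y k)"
      using norm_triangle_ineq4[of "Y k" "p k"] by (simp add: Y_def)
    have "cmod (Y (Suc k)) \<le> (cmod mu)\<^sup>2 * cmod (Y k) + cmod mu * cmod (V k) * cmod (p (Suc k))"
      unfolding Y by (rule order_trans[OF norm_triangle_ineq])
        (simp add: norm_mult power2_eq_square)
    also have "cmod mu * cmod (V k) * cmod (p (Suc k)) \<le> 1 * cmod (V k) * cmod (p (Suc k))"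
      using small by (intro mult_right_mono) auto
    finally have "?c * cmod (Y (Suc k)) \<le> ?c * ((cmod mu)\<^sup>2 * cmod (Y k) + cmod (V k) * cmod (p (Suc k)))"
      using gronwall_const_pos by (intro mult_left_mono) auto
    then have "L (Suc k) \<le> (1 + ?c * cmod (V k)) * cmod (p (Suc k)) + (?c * (cmod mu)\<^sup>2) * cmod (Y k)"
      by (simp add: L_def algebra_simps)
    also have "\<dots> \<le> (1 + ?c * cmod (V k)) * (cmod (p k) + cmod (Y k))
        + (1 + ?c * cmod (V k)) * ((?c * (cmod mu)\<^sup>2) * cmod (Y k))"
    proof (intro add_mono mult_left_mono a)
      have "1 * ((?c * (cmod mu)\<^sup>2) * cmod (Y k)) \<le> (1 + ?c * cmod (V k)) * ((?c * (cmod mu)\<^sup>2) * cmod (Y k))"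
        using gronwall_const_pos by (intro mult_right_mono) auto
      then show "(?c * (cmod mu)\<^sup>2) * cmod (Y k) \<le> (1 + ?c * cmod (V k)) * ((?c * (cmod mu)\<^sup>2) * cmod (Y k))"
        by simp
    qed (use gronwall_const_pos in auto)
    also have "\<dots> = (1 + ?c * cmod (V k)) * (cmod (p k) + (1 + ?c * (cmod mu)\<^sup>2) * cmod (Y k))"
      by (simp add: algebra_simps)
    also have "\<dots> = (1 + ?c * cmod (V k)) * L k" by (simp add: gronwall_const_eq L_def)
    finally show ?thesis .
  qed
  have Lnn: "0 \<le> L k" for k using gronwall_const_pos by (simp add: L_def)
  have L: "L k \<le> (\<Prod>j<k. 1 + ?c * cmod (V j)) * L 0" for k
  proof (induction k)
    case (Suc k)
    have "L (Suc k) \<le> (1 + ?c * cmod (V k)) * L k" by (rule step)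
    also have "\<dots> \<le> (1 + ?c * cmod (V k)) * ((\<Prod>j<k. 1 + ?c * cmod (V j)) * L 0)"
      using gronwall_const_pos by (intro mult_left_mono Suc.IH) auto
    finally show ?case by (simp add: algebra_simps)
  qed simp
  show thesis
  proof (rule that[of "gronwall_bound * L 0 + 1"])
    show "0 < gronwall_bound * L 0 + 1"
      using Lnn[of 0] by (simp add: gronwall_bound_def add_nonneg_pos)
    fix k
    have "cmod (mu ^ k * v k) \<le> L k" using gronwall_const_pos by (simp add: L_def p_def)
    also have "\<dots> \<le> (\<Prod>j<k. 1 + ?c * cmod (V j)) * L 0" by (rule L)
    also have "\<dots> \<le> gronwall_bound * L 0" by (intro mult_right_mono gronwall_prod_le Lnn) auto
    finally show "cmod (mu ^ k * v k) \<le> gronwall_bound * L 0 + 1" by simp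
  qed
qed

definition wronskian :: "(nat \<Rightarrow> complex) \<Rightarrow> (nat \<Rightarrow> complex) \<Rightarrow> nat \<Rightarrow> complex" where
  "wronskian z w n = (-1) ^ n * (z n * w (Suc n) - z (Suc n) * w n)"

lemma wronskian_const:
  assumes "sol z" "sol w"
  shows "wronskian z w n = wronskian z w 0"
proof (induction n)
  case (Suc n)
  have "wronskian z w (Suc n) = wronskian z w n"
    by (simp add: wronskian_def sol_step[OF assms(1)] sol_step[OF assms(2)] algebra_simps)
  with Suc show ?case by simp
qed simp

lemma wronskian_tendsto_0:
  assumes d: "(\<lambda>k. d k / mu ^ k) \<longlonglongrightarrow> 0" and v: "sol v"
  shows "wronskian d v \<longlonglongrightarrow> 0"
proof -
  obtain C where C: "0 < C" "\<And>k. cmod (mu ^ k * v k) \<le> C" using sol_growth[OF v] by blast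
  define e where "e k = d k / mu ^ k" for k
  have e: "e \<longlonglongrightarrow> 0" using d by (simp add: e_def[abs_def])
  have "(\<lambda>n. cmod (e n) * (C / cmod mu) + cmod (e (Suc n)) * (cmod mu * C))
      \<longlonglongrightarrow> 0 * (C / cmod mu) + 0 * (cmod mu * C)"
    by (intro tendsto_intros tendsto_norm_zero e LIMSEQ_Suc[OF e])
  then have "(\<lambda>n. cmod (e n) * (C / cmod mu) + cmod (e (Suc n)) * (cmod mu * C)) \<longlonglongrightarrow> 0"
    by simp
  then show ?thesis
  proof (rule Lim_null_comparison[rotated], intro always_eventually allI)
    fix n
    have "cmod (d n * v (Suc n)) = cmod (e n) * (cmod (mu ^ Suc n * v (Suc n)) / cmod mu)"
      using mu_nonzero by (simp add: e_def norm_mult norm_divide norm_power)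
    also have "\<dots> \<le> cmod (e n) * (C / cmod mu)"
      by (intro mult_left_mono divide_right_mono C(2)) auto
    finally have 1: "cmod (d n * v (Suc n)) \<le> cmod (e n) * (C / cmod mu)" .
    have "cmod (d (Suc n) * v n) = cmod (e (Suc n)) * (cmod mu * cmod (mu ^ n * v n))"
      using mu_nonzero by (simp add: e_def norm_mult norm_divide norm_power)
    also have "\<dots> \<le> cmod (e (Suc n)) * (cmod mu * C)"
      by (intro mult_left_mono C(2)) auto
    finally have 2: "cmod (d (Suc n) * v n) \<le> cmod (e (Suc n)) * (cmod mu * C)" .
    have "cmod (wronskian d v n) \<le> cmod (d n * v (Suc n)) + cmod (d (Suc n) * v n)"
      unfolding wronskian_def norm_mult norm_power
      using norm_triangle_ineq4[of "d n * v (Suc n)" "d (Suc n) * v n"] by (simp add: norm_mult)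
    with 1 2 show "cmod (wronskian d v n) \<le> cmod (e n) * (C / cmod mu) + cmod (e (Suc n)) * (cmod mu * C)"
      by simp
  qed
qed

text \<open>
  The Wronskian of two solutions is constant, and against a solution that is \<open>o(\<mu>\<^sup>k)\<close> it
  tends to zero; hence such a solution has vanishing Cauchy data.
\<close>

lemma sol_decaying_zero:
  assumes d: "sol d" "(\<lambda>k. d k / mu ^ k) \<longlonglongrightarrow> 0"
  shows "d = (\<lambda>_. 0)"
proof -
  have W: "wronskian d v 0 = 0" if v: "sol v" for v
  proof -
    have "wronskian d v = (\<lambda>n. wronskian d v 0)" using wronskian_const[OF d(1) v] by auto
    with wronskian_tendsto_0[OF d(2) v] show ?thesis by (metis LIMSEQ_const_iff)
  qed
  have "d 0 = 0" using W[OF sol_recurrence[of 0 1]] by (simp add: wronskian_def)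
  moreover have "d 1 = 0" using W[OF sol_recurrence[of 1 0]] by (simp add: wronskian_def)
  moreover have "sol (\<lambda>_. 0)" by (simp add: sol_def)
  ultimately show ?thesis using sol_eqI[OF d(1)] by blast
qed

lemma sol_unique_normalized:
  assumes "sol z" "sol w" and "(\<lambda>k. z k / mu ^ k) \<longlonglongrightarrow> l" "(\<lambda>k. w k / mu ^ k) \<longlonglongrightarrow> l"
  shows "z = w"
proof -
  have "sol (\<lambda>k. z k + (-1) * w k)" by (intro sol_add sol_scale assms)
  moreover have "(\<lambda>k. (z k + (-1) * w k) / mu ^ k) \<longlonglongrightarrow> 0"
    using tendsto_diff[OF assms(3,4)] by (simp add: diff_divide_distrib)
  ultimately have "(\<lambda>k. z k + (-1) * w k) = (\<lambda>_. 0)" by (rule sol_decaying_zero)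
  then show ?thesis by (simp add: fun_eq_iff)
qed

text \<open>
  The same argument, run downwards from a solution that agrees with \<open>\<mu>\<^sup>k\<close> at \<open>N\<close> and
  \<open>N + 1\<close>, controls the deviation from \<open>\<mu>\<^sup>k\<close> by the tail of the potential, uniformly
  in \<open>N\<close>.
\<close>

lemma sol_backward_bounds:
  assumes z: "sol z" "z N = mu ^ N" "z (Suc N) = mu ^ Suc N" and n: "n \<le> N"
  shows "cmod (z n / mu ^ n) \<le> gronwall_bound"
    and "cmod (z n / mu ^ n - 1) \<le> gronwall_const * gronwall_bound * (\<Sum>j. cmod (V (j + n)))"
proof -
  let ?c = gronwall_const
  define u where "u k = z k / mu ^ k" for k
  define X where "X k = u (Suc k) - u k" for k
  have X: "X k = - (mu * mu * X (Suc k)) + mu * V k * u (Suc k)" for k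
  proof -
    have "mu ^ Suc k * (X k + mu * mu * X (Suc k) - mu * V k * u (Suc k))
        = z (Suc k) - mu * z k + mu * z (Suc (Suc k)) - mu * mu * z (Suc k) - mu * V k * z (Suc k)"
      using mu_nonzero by (simp add: X_def u_def field_simps)
    also have "\<dots> = 0" by (simp add: sol_step[OF z(1)] mu_square algebra_simps)
    finally have "X k + mu * mu * X (Suc k) - mu * V k * u (Suc k) = 0"
      using mu_nonzero by simp
    then show ?thesis by (simp add: algebra_simps eq_neg_iff_add_eq_0)
  qed
  \<comment> \<open>\<open>X\<close> annihilates the decaying free mode; going downwards it is damped by \<open>\<bar>\<mu>\<bar>\<^sup>2\<close> per step.\<close>
  have XN: "X N = 0" using z mu_nonzero by (simp add: X_def u_def)
  have Xle: "?c * cmod (X k) \<le> (?c - 1) * cmod (X (Suc k)) + ?c * cmod (V k) * cmod (u (Suc k))" for k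
  proof -
    have "cmod (X k) \<le> (cmod mu)\<^sup>2 * cmod (X (Suc k)) + cmod mu * cmod (V k) * cmod (u (Suc k))"
      unfolding X[of k] by (rule order_trans[OF norm_triangle_ineq])
        (simp add: norm_mult power2_eq_square)
    also have "cmod mu * cmod (V k) * cmod (u (Suc k)) \<le> 1 * cmod (V k) * cmod (u (Suc k))"
      using small by (intro mult_right_mono) auto
    finally have "?c * cmod (X k) \<le> ?c * ((cmod mu)\<^sup>2 * cmod (X (Suc k)) + cmod (V k) * cmod (u (Suc k)))"
      using gronwall_const_pos by (intro mult_left_mono) auto
    also have "\<dots> = (?c * (cmod mu)\<^sup>2) * cmod (X (Suc k)) + ?c * cmod (V k) * cmod (u (Suc k))"
      by (simp add: algebra_simps)
    also have "?c * (cmod mu)\<^sup>2 = ?c - 1" using gronwall_const_eq by simp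
    finally show ?thesis by simp
  qed
  have c1: "0 \<le> ?c - 1"
    using gronwall_const_eq gronwall_const_pos by (smt (verit) mult_nonneg_nonneg zero_le_power2)
  have u_le: "cmod (u k - a) \<le> cmod (u (Suc k) - a) + cmod (X k)" for k a
    using norm_triangle_ineq4[of "u (Suc k) - a" "X k"] by (simp add: X_def)
  define L where "L k = cmod (u k) + (?c - 1) * cmod (X k)" for k
  have Lstep: "L k \<le> (1 + ?c * cmod (V k)) * L (Suc k)" for k
  proof -
    have "L k \<le> cmod (u (Suc k)) + ?c * cmod (X k)"
      using u_le[of k 0] by (simp add: L_def algebra_simps)
    also have "\<dots> \<le> (1 + ?c * cmod (V k)) * cmod (u (Suc k)) + 1 * ((?c - 1) * cmod (X (Suc k)))"
      using Xle[of k] by (simp add: algebra_simps)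
    also have "\<dots> \<le> (1 + ?c * cmod (V k)) * cmod (u (Suc k)) + (1 + ?c * cmod (V k)) * ((?c - 1) * cmod (X (Suc k)))"
      using c1 gronwall_const_pos by (intro add_left_mono mult_right_mono) auto
    finally show ?thesis by (simp add: L_def algebra_simps)
  qed
  have LN: "L N = 1" using z mu_nonzero by (simp add: L_def XN u_def)
  have L: "L k \<le> (\<Prod>j\<in>{k..<N}. 1 + ?c * cmod (V j))" if "k \<le> N" for k
    using that
  proof (induction rule: inc_induct)
    case base
    show ?case by (simp add: LN)
  next
    case (step k)
    have "L k \<le> (1 + ?c * cmod (V k)) * L (Suc k)" by (rule Lstep)
    also have "\<dots> \<le> (1 + ?c * cmod (V k)) * (\<Prod>j\<in>{Suc k..<N}. 1 + ?c * cmod (V j))"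
      using gronwall_const_pos by (intro mult_left_mono step.IH) auto
    also have "\<dots> = (\<Prod>j\<in>{k..<N}. 1 + ?c * cmod (V j))"
      using step.hyps by (simp add: prod.atLeast_Suc_lessThan)
    finally show ?case .
  qed
  have u: "cmod (u k) \<le> gronwall_bound" if "k \<le> N" for k
  proof -
    have "cmod (u k) \<le> L k" using c1 by (simp add: L_def)
    also have "\<dots> \<le> gronwall_bound" using L[OF that] gronwall_prod_le[of "{k..<N}"] by simp
    finally show ?thesis .
  qed
  show "cmod (z n / mu ^ n) \<le> gronwall_bound" using u[OF n] by (simp add: u_def)
  define D where "D k = cmod (u k - 1) + (?c - 1) * cmod (X k)" for k
  have D: "D k \<le> ?c * gronwall_bound * (\<Sum>j\<in>{k..<N}. cmod (V j))" if "k \<le> N" for k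
    using that
  proof (induction rule: inc_induct)
    case base
    show ?case using z mu_nonzero by (simp add: D_def XN u_def)
  next
    case (step k)
    have "D k \<le> cmod (u (Suc k) - 1) + ?c * cmod (X k)"
      using u_le[of k 1] by (simp add: D_def algebra_simps)
    also have "\<dots> \<le> D (Suc k) + ?c * cmod (V k) * cmod (u (Suc k))"
      using Xle[of k] by (simp add: D_def algebra_simps)
    also have "\<dots> \<le> ?c * gronwall_bound * (\<Sum>j\<in>{Suc k..<N}. cmod (V j)) + ?c * cmod (V k) * gronwall_bound"
      using gronwall_const_pos step.hyps by (intro add_mono step.IH mult_left_mono u) auto
    also have "\<dots> = ?c * gronwall_bound * (\<Sum>j\<in>{k..<N}. cmod (V j))"
      using step.hyps by (simp add: sum.atLeast_Suc_lessThan algebra_simps)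
    finally show ?case .
  qed
  have "cmod (u n - 1) \<le> D n" using c1 by (simp add: D_def)
  also have "\<dots> \<le> ?c * gronwall_bound * (\<Sum>j\<in>{n..<N}. cmod (V j))" by (rule D[OF n])
  also have "(\<Sum>j\<in>{n..<N}. cmod (V j)) = (\<Sum>j<N - n. cmod (V (j + n)))"
    by (rule sum.reindex_bij_witness[of _ "\<lambda>j. j + n" "\<lambda>j. j - n"]) auto
  also have "?c * gronwall_bound * \<dots> \<le> ?c * gronwall_bound * (\<Sum>j. cmod (V (j + n)))"
    using gronwall_const_pos V_summable
    by (intro mult_left_mono sum_le_suminf) (auto simp: gronwall_bound_def intro: summable_ignore_initial_segment)
  finally show "cmod (z n / mu ^ n - 1) \<le> ?c * gronwall_bound * (\<Sum>j. cmod (V (j + n)))"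
    by (simp add: u_def)
qed

text \<open>
  These solutions have bounded Cauchy data at the origin, so a subsequence converges; the uniform
  bound passes to the limit.
\<close>

lemma decaying_sol_exists: "\<exists>z. sol z \<and> (\<lambda>k. z k / mu ^ k) \<longlonglongrightarrow> 1"
proof -
  have "\<forall>N. \<exists>z. sol z \<and> z N = mu ^ N \<and> z (Suc N) = mu ^ Suc N" by (intro allI sol_exists_at)
  then obtain Z where Z: "\<And>N. sol (Z N)" "\<And>N. Z N N = mu ^ N" "\<And>N. Z N (Suc N) = mu ^ Suc N"
    by metis
  define f where "f N = (Z (Suc N) 0, Z (Suc N) 1)" for N
  have "cmod (Z (Suc N) 0) \<le> gronwall_bound" for N
    using sol_backward_bounds(1)[OF Z, of 0 "Suc N"] by simp
  moreover have "cmod (Z (Suc N) 1) \<le> gronwall_bound" for N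
  proof -
    have "cmod (Z (Suc N) 1) = cmod mu * cmod (Z (Suc N) 1 / mu ^ 1)"
      using mu_nonzero by (simp add: norm_divide)
    also have "\<dots> \<le> 1 * gronwall_bound"
      using sol_backward_bounds(1)[OF Z, of 1 "Suc N"] small by (intro mult_mono) auto
    finally show ?thesis by simp
  qed
  ultimately have "norm (f N) \<le> gronwall_bound + gronwall_bound" for N
    unfolding f_def by (intro order_trans[OF norm_Pair_le] add_mono)
  then have "bounded (range f)" by (auto intro!: boundedI)
  then obtain l r where r: "strict_mono r" and lim: "(f \<circ> r) \<longlonglongrightarrow> l"
    using bounded_imp_convergent_subsequence by metis
  define z where "z = recurrence lam V (fst l) (snd l)"
  have z: "sol z" unfolding z_def by (rule sol_recurrence)
  have conv: "(\<lambda>k. Z (Suc (r k)) n) \<longlonglongrightarrow> z n \<and> (\<lambda>k. Z (Suc (r k)) (Suc n)) \<longlonglongrightarrow> z (Suc n)" for n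
  proof (induction n)
    case 0
    show ?case using tendsto_fst[OF lim] tendsto_snd[OF lim] by (simp add: f_def z_def o_def)
  next
    case (Suc n)
    then show ?case by (auto simp: sol_step[OF Z(1)] sol_step[OF z] intro!: tendsto_intros)
  qed
  define e where "e n = gronwall_const * gronwall_bound * (\<Sum>j. cmod (V (j + n)))" for n
  have bound: "cmod (z n / mu ^ n - 1) \<le> e n" for n
  proof (rule Lim_bounded)
    show "(\<lambda>k. cmod (Z (Suc (r k)) n / mu ^ n - 1)) \<longlonglongrightarrow> cmod (z n / mu ^ n - 1)"
      using conv[of n] mu_nonzero by (auto intro!: tendsto_intros)
    show "\<forall>k\<ge>n. cmod (Z (Suc (r k)) n / mu ^ n - 1) \<le> e n"
    proof (intro allI impI)
      fix k assume "n \<le> k"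
      then have "n \<le> Suc (r k)" using seq_suble[OF r, of k] by simp
      then show "cmod (Z (Suc (r k)) n / mu ^ n - 1) \<le> e n"
        unfolding e_def by (rule sol_backward_bounds(2)[OF Z])
    qed
  qed
  have "(\<lambda>n. \<Sum>j. cmod (V (j + n))) \<longlonglongrightarrow> 0" by (rule suminf_exist_split2[OF V_summable])
  then have "e \<longlonglongrightarrow> 0" unfolding e_def by (auto intro!: tendsto_eq_intros)
  then have "(\<lambda>n. z n / mu ^ n - 1) \<longlonglongrightarrow> 0"
    by (rule Lim_null_comparison[rotated]) (simp add: bound)
  with z show ?thesis by (auto simp: LIM_zero_iff)
qed

end

section \<open>The determinant expansion\<close>

context difference_equation
begin

definition free_regular :: "nat \<Rightarrow> complex" where
  "free_regular = recurrence lam (\<lambda>_. 0) 0 1"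

definition regular :: "nat \<Rightarrow> complex" where
  "regular = recurrence lam V 0 1"

lemma free_regular_simps [simp]:
  "free_regular 0 = 0" "free_regular (Suc 0) = 1"
  "free_regular (Suc (Suc n)) = free_regular n - lam * free_regular (Suc n)"
  by (simp_all add: free_regular_def)

lemma regular_simps [simp]:
  "regular 0 = 0" "regular (Suc 0) = 1"
  "regular (Suc (Suc n)) = regular n + (V n - lam) * regular (Suc n)"
  by (simp_all add: regular_def)

lemma free_regular_growth:
  obtains C where "0 < C" "\<And>k. cmod (mu ^ k * free_regular k) \<le> C"
proof -
  interpret free: difference_equation lam mu "\<lambda>_. 0"
    by unfold_locales (use root small in auto)
  show thesis using free.sol_growth[OF free.sol_recurrence[of 0 1]] that
    by (auto simp: free_regular_def)
qed

text \<open>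
  As functions of \<open>d\<close> both sides solve the free equation, with the same values at \<open>0\<close> and
  \<open>1\<close>; the value at \<open>1\<close> is the constant Wronskian of the two free solutions.
\<close>

lemma free_regular_shift:
  "mu * (mu ^ p * free_regular (Suc (p + d)) - mu ^ (p + d) * free_regular (Suc p))
     = (-1) ^ Suc p * free_regular d"
proof (induction d rule: induct_nat_012)
  case 1
  show ?case
  proof (induction p)
    case 0
    show ?case using mu_square by (simp add: algebra_simps)
  next
    case (Suc p)
    have "mu * (mu ^ Suc p * free_regular (Suc (Suc p + Suc 0)) - mu ^ (Suc p + Suc 0) * free_regular (Suc (Suc p)))
        = mu * (mu ^ Suc p * (free_regular (Suc p) - lam * free_regular (Suc (Suc p)))
          - mu ^ p * (mu * mu) * free_regular (Suc (Suc p)))"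
      by simp
    also have "\<dots> = - (mu * (mu ^ p * free_regular (Suc (p + Suc 0)) - mu ^ (p + Suc 0) * free_regular (Suc p)))"
      by (simp add: mu_square del: free_regular_simps(3)) (simp add: algebra_simps)
    finally show ?case using Suc by simp
  qed
next
  case (ge2 d)
  have "mu * (mu ^ p * free_regular (Suc (p + Suc (Suc d))) - mu ^ (p + Suc (Suc d)) * free_regular (Suc p))
      = mu * (mu ^ p * (free_regular (Suc (p + d)) - lam * free_regular (Suc (p + Suc d)))
        - mu ^ (p + d) * (mu * mu) * free_regular (Suc p))"
    by simp
  also have "\<dots> = mu * (mu ^ p * free_regular (Suc (p + d)) - mu ^ (p + d) * free_regular (Suc p))
      - lam * (mu * (mu ^ p * free_regular (Suc (p + Suc d)) - mu ^ (p + Suc d) * free_regular (Suc p)))"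
    by (simp add: mu_square del: free_regular_simps(3)) (simp add: algebra_simps)
  also have "\<dots> = (-1) ^ Suc p * free_regular d - lam * ((-1) ^ Suc p * free_regular (Suc d))"
    by (simp only: ge2)
  finally show ?case by (simp add: algebra_simps)
qed simp

text \<open>
  Variation of constants, with \<open>V\<^sub>p \<phi>\<^sub>p\<close> as inhomogeneity of the free equation.
\<close>

lemma regular_eq_sum:
  "regular k = free_regular k + (\<Sum>p<k. free_regular (k - Suc p) * (V p * regular (Suc p)))"
proof (induction k rule: induct_nat_012)
  case (ge2 k)
  let ?s = "\<lambda>p. V p * regular (Suc p)"
  have "(\<Sum>p<Suc (Suc k). free_regular (Suc (Suc k) - Suc p) * ?s p)
      = (\<Sum>p<k. free_regular (Suc (Suc (k - Suc p))) * ?s p) + ?s k"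
  proof -
    have "(\<Sum>p<k. free_regular (Suc (Suc k) - Suc p) * ?s p) = (\<Sum>p<k. free_regular (Suc (Suc (k - Suc p))) * ?s p)"
    proof (intro sum.cong refl)
      fix p assume "p \<in> {..<k}"
      then have "Suc (Suc k) - Suc p = Suc (Suc (k - Suc p))" by auto
      then show "free_regular (Suc (Suc k) - Suc p) * ?s p = free_regular (Suc (Suc (k - Suc p))) * ?s p"
        by (simp only:)
    qed
    then show ?thesis by simp
  qed
  also have "(\<Sum>p<k. free_regular (Suc (Suc (k - Suc p))) * ?s p)
      = (\<Sum>p<k. free_regular (k - Suc p) * ?s p) - lam * (\<Sum>p<k. free_regular (Suc k - Suc p) * ?s p)"
    unfolding sum_distrib_left sum_subtractf[symmetric]
  proof (intro sum.cong refl)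
    fix p assume "p \<in> {..<k}"
    then have "Suc k - Suc p = Suc (k - Suc p)" by auto
    then show "free_regular (Suc (Suc (k - Suc p))) * ?s p
        = free_regular (k - Suc p) * ?s p - lam * (free_regular (Suc k - Suc p) * ?s p)"
      by (simp add: algebra_simps)
  qed
  also have "(\<Sum>p<k. free_regular (k - Suc p) * ?s p) = regular k - free_regular k"
    using ge2(1) by (simp add: algebra_simps)
  also have "(\<Sum>p<k. free_regular (Suc k - Suc p) * ?s p) = regular (Suc k) - free_regular (Suc k)"
    using ge2(2) by (simp add: algebra_simps)
  finally show ?case by (simp add: algebra_simps)
qed simp_all

text \<open>
  These are the principal minors of the scalar Birman-Schwinger operator, after the factors
  \<open>c\<^sub>i\<close> of the rows and \<open>(- 1)\<^sup>j \<mu> b\<^sub>j\<close> of the columns have been taken out.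
\<close>

definition weighted_minor :: "nat set \<Rightarrow> complex" where
  "weighted_minor F = (\<Prod>i\<in>F. (-1) ^ i * mu * V i) *
     fdet F (\<lambda>i j. mu ^ max i j * free_regular (Suc (min i j)))"

lemma weighted_minor_empty [simp]: "weighted_minor {} = 1"
  by (simp add: weighted_minor_def)

lemma weighted_minor_singleton:
  "weighted_minor {m} = (-1) ^ m * mu ^ Suc m * V m * free_regular (Suc m)"
  using fdet_insert_zero_row[of "{}" m "\<lambda>i j. mu ^ max i j * free_regular (Suc (min i j))"]
  by (simp add: weighted_minor_def)

lemma weighted_minor_insert:
  assumes F: "finite F" "a \<in> F" "\<And>i. i \<in> F \<Longrightarrow> i \<le> a" and m: "a < m"
  shows "weighted_minor (insert m F) =
    - ((-1) ^ (m + a) * V m * (mu ^ (m - a) * free_regular (m - a))) * weighted_minor F"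
proof -
  have mF: "m \<notin> F" using F(3) m by fastforce
  obtain d where d: "m = a + d" using m less_imp_add_positive by blast
  have "(-1) ^ m * mu * V m * (mu ^ m / mu ^ a * (mu ^ a * free_regular (Suc m) - mu ^ m * free_regular (Suc a)))
      = (-1) ^ m * V m * mu ^ d * (mu * (mu ^ a * free_regular (Suc (a + d)) - mu ^ (a + d) * free_regular (Suc a)))"
    using mu_nonzero by (simp add: d power_add)
  also have "\<dots> = - ((-1) ^ (m + a) * V m * (mu ^ (m - a) * free_regular (m - a)))"
    unfolding free_regular_shift by (simp add: d power_add)
  finally have eq: "(-1) ^ m * mu * V m * (mu ^ m / mu ^ a * (mu ^ a * free_regular (Suc m) - mu ^ m * free_regular (Suc a)))
      = - ((-1) ^ (m + a) * V m * (mu ^ (m - a) * free_regular (m - a)))" .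
  have det: "fdet (insert m F) (\<lambda>i j. mu ^ max i j * free_regular (Suc (min i j)))
      = mu ^ m / mu ^ a * (mu ^ a * free_regular (Suc m) - mu ^ m * free_regular (Suc a))
        * fdet F (\<lambda>i j. mu ^ max i j * free_regular (Suc (min i j)))"
    by (rule fdet_green_insert[where \<phi>="\<lambda>k. mu ^ k" and \<psi>="\<lambda>k. free_regular (Suc k)"])
      (use F m mu_nonzero in auto)
  have "weighted_minor (insert m F) = ((-1) ^ m * mu * V m *
      (mu ^ m / mu ^ a * (mu ^ a * free_regular (Suc m) - mu ^ m * free_regular (Suc a)))) * weighted_minor F"
    unfolding weighted_minor_def det using F(1) mF by (simp add: mult_ac)
  then show ?thesis by (simp only: eq)
qed

text \<open>
  In each factor of the product along the increasing enumeration of \<open>F\<close>, a power of \<open>\<mu>\<close>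
  compensates the growth of the free regular solution over the gap.
\<close>

lemma weighted_minors_summable: "(\<lambda>F. cmod (weighted_minor F)) summable_on {F. finite F}"
proof -
  obtain C where C: "0 < C" "\<And>k. cmod (mu ^ k * free_regular k) \<le> C"
    using free_regular_growth by blast
  have le: "cmod (weighted_minor F) \<le> (\<Prod>i\<in>F. C * cmod (V i))" if "finite F" for F
    using that
  proof (induction F rule: finite_linorder_max_induct)
    case (insert m F)
    have mF: "m \<notin> F" using insert by auto
    have prod: "(\<Prod>i\<in>insert m F. C * cmod (V i)) = C * cmod (V m) * (\<Prod>i\<in>F. C * cmod (V i))"
      using insert.hyps(1) mF by simp
    show ?case
    proof (cases "F = {}")
      case True
      have "cmod (weighted_minor {m}) = cmod (mu ^ Suc m * free_regular (Suc m)) * cmod (V m)"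
        unfolding weighted_minor_singleton norm_mult norm_power by (simp add: norm_power)
      also have "\<dots> \<le> C * cmod (V m)" by (intro mult_right_mono C(2)) auto
      finally show ?thesis using True by simp
    next
      case False
      let ?a = "Max F"
      have "cmod (weighted_minor (insert m F))
          = cmod (mu ^ (m - ?a) * free_regular (m - ?a)) * cmod (V m) * cmod (weighted_minor F)"
        using weighted_minor_insert[of F ?a m] insert.hyps False
        by (simp add: norm_mult norm_power)
      also have "\<dots> \<le> C * cmod (V m) * (\<Prod>i\<in>F. C * cmod (V i))"
        using C by (intro mult_mono insert.IH mult_right_mono C(2)) auto
      finally show ?thesis using prod by simp
    qed
  qed simp
  have "(\<lambda>F. \<Prod>i\<in>F. C * cmod (V i)) summable_on {F. finite F}"
    using C(1) by (intro summable_on_finite_set_products summable_mult V_summable) auto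
  then show ?thesis
    by (rule Infinite_Sum.abs_summable_on_comparison_test') (simp add: le)
qed

text \<open>
  The finite sets are classified by their largest element.
\<close>

lemma sum_Pow_lessThan:
  fixes h :: "nat set \<Rightarrow> complex"
  shows "(\<Sum>F\<in>Pow {..<m}. h F) = h {} + (\<Sum>p<m. \<Sum>F\<in>Pow {..<p}. h (insert p F))"
proof (induction m)
  case (Suc m)
  have "(\<Sum>F\<in>Pow {..<Suc m}. h F) = (\<Sum>F\<in>Pow {..<m}. h F) + (\<Sum>F\<in>insert m ` Pow {..<m}. h F)"
    unfolding lessThan_Suc Pow_insert by (rule sum.union_disjoint) auto
  also have "(\<Sum>F\<in>insert m ` Pow {..<m}. h F) = (\<Sum>F\<in>Pow {..<m}. h (insert m F))"
  proof (rule sum.reindex[unfolded o_def])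
    show "inj_on (insert m) (Pow {..<m})"
      by (rule inj_onI) (metis Diff_insert_absorb PowD lessThan_iff less_irrefl subsetD)
  qed
  finally show ?case using Suc by simp
qed simp

text \<open>
  Splitting off the largest element of \<open>F\<close> turns the sum over all \<open>F\<close> with maximum \<open>m\<close>
  into the variation of constants formula for the regular solution.
\<close>

lemma sum_weighted_minors_max:
  "(\<Sum>F\<in>Pow {..<m}. (-1) ^ card (insert m F) * weighted_minor (insert m F))
     = - ((-1) ^ m * mu ^ Suc m * V m * regular (Suc m))"
proof (induction m rule: less_induct)
  case (less m)
  let ?k = "\<lambda>p. - ((-1) ^ (m + p) * V m * (mu ^ (m - p) * free_regular (m - p)))"
  have ins: "(-1) ^ card (insert m (insert p F)) * weighted_minor (insert m (insert p F))
      = - ?k p * ((-1) ^ card (insert p F) * weighted_minor (insert p F))"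
    if p: "p < m" and F: "F \<in> Pow {..<p}" for p F
  proof -
    have fin: "finite F" using F by (auto intro: finite_subset)
    have "m \<notin> insert p F" using F p by auto
    then have "card (insert m (insert p F)) = Suc (card (insert p F))" using fin by simp
    moreover have "weighted_minor (insert m (insert p F)) = ?k p * weighted_minor (insert p F)"
      by (rule weighted_minor_insert) (use F fin p in \<open>auto dest: subsetD\<close>)
    ultimately show ?thesis by simp
  qed
  have "(\<Sum>F\<in>Pow {..<m}. (-1) ^ card (insert m F) * weighted_minor (insert m F))
      = - weighted_minor {m} + (\<Sum>p<m. \<Sum>F\<in>Pow {..<p}.
          (-1) ^ card (insert m (insert p F)) * weighted_minor (insert m (insert p F)))"
    by (subst sum_Pow_lessThan) simp
  also have "(\<Sum>p<m. \<Sum>F\<in>Pow {..<p}.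
          (-1) ^ card (insert m (insert p F)) * weighted_minor (insert m (insert p F)))
      = (\<Sum>p<m. - ?k p * (\<Sum>F\<in>Pow {..<p}. (-1) ^ card (insert p F) * weighted_minor (insert p F)))"
    unfolding sum_distrib_left by (intro sum.cong refl ins) auto
  also have "\<dots> = (\<Sum>p<m. - ((-1) ^ m * mu ^ Suc m * V m) * (free_regular (m - p) * (V p * regular (Suc p))))"
  proof (intro sum.cong refl)
    fix p assume "p \<in> {..<m}"
    then have p: "p < m" by simp
    have sgn: "(-1) ^ (m + p) * (-1) ^ p = ((-1) ^ m :: complex)"
      by (simp add: power_add)
    have pw: "mu ^ (m - p) * mu ^ Suc p = mu ^ Suc m"
      using p by (simp flip: power_add)
    have "- ?k p * (- ((-1) ^ p * mu ^ Suc p * V p * regular (Suc p)))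
        = - ((((-1) ^ (m + p) * (-1) ^ p) * (mu ^ (m - p) * mu ^ Suc p) * V m) * (free_regular (m - p) * (V p * regular (Suc p))))"
      by (simp add: mult_ac)
    then show "- ?k p * (\<Sum>F\<in>Pow {..<p}. (-1) ^ card (insert p F) * weighted_minor (insert p F))
        = - ((-1) ^ m * mu ^ Suc m * V m) * (free_regular (m - p) * (V p * regular (Suc p)))"
      unfolding less.IH[OF p] sgn pw by simp
  qed
  also have "\<dots> = - ((-1) ^ m * mu ^ Suc m * V m) * (\<Sum>p<m. free_regular (m - p) * (V p * regular (Suc p)))"
    by (rule sum_distrib_left[symmetric])
  also have "- weighted_minor {m} + \<dots> =
      - ((-1) ^ m * mu ^ Suc m * V m * (free_regular (Suc m) + (\<Sum>p<Suc m. free_regular (Suc m - Suc p) * (V p * regular (Suc p)))))"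
    by (simp add: weighted_minor_singleton algebra_simps)
  also have "\<dots> = - ((-1) ^ m * mu ^ Suc m * V m * regular (Suc m))"
    by (simp only: regular_eq_sum[of "Suc m", symmetric])
  finally show ?case .
qed

lemma sum_weighted_minors:
  "(\<Sum>F\<in>Pow {..<N}. (-1) ^ card F * weighted_minor F) = wronskian (\<lambda>k. mu ^ k) regular N"
proof -
  have "(\<Sum>F\<in>Pow {..<N}. (-1) ^ card F * weighted_minor F)
      = 1 - (\<Sum>p<N. (-1) ^ p * mu ^ Suc p * V p * regular (Suc p))"
    by (subst sum_Pow_lessThan) (simp add: sum_weighted_minors_max sum_negf)
  also have "\<dots> = wronskian (\<lambda>k. mu ^ k) regular N"
  proof (induction N)
    case (Suc N)
    have "wronskian (\<lambda>k. mu ^ k) regular (Suc N)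
        = (-1) ^ Suc N * (mu ^ Suc N * (regular N + (V N - lam) * regular (Suc N)) - mu ^ N * (mu * mu) * regular (Suc N))"
      by (simp add: wronskian_def)
    also have "\<dots> = wronskian (\<lambda>k. mu ^ k) regular N - (-1) ^ N * mu ^ Suc N * V N * regular (Suc N)"
      by (simp add: mu_square wronskian_def algebra_simps)
    finally show ?case using Suc by simp
  qed (simp add: wronskian_def)
  finally show ?thesis .
qed

text \<open>
  Truncated determinants are Wronskians of \<open>\<mu>\<^sup>k\<close> with the regular solution. Replacing
  \<open>\<mu>\<^sup>k\<close> by the true decaying solution changes them by \<open>o(1)\<close> and makes them constant.
\<close>

lemma weighted_minor_series:
  assumes J: "sol J" "(\<lambda>k. J k / mu ^ k) \<longlonglongrightarrow> 1"
  shows "(\<Sum>k. (-1) ^ k * (\<Sum>\<^sub>\<infinity>F\<in>{F. finite F \<and> card F = k}. weighted_minor F)) = J 0"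
proof -
  have reg: "sol regular" unfolding regular_def by (rule sol_recurrence)
  have "(\<lambda>k. J k / mu ^ k - 1) \<longlonglongrightarrow> 0" using J(2) by (simp add: LIM_zero_iff)
  moreover have "J k / mu ^ k - 1 = (J k - mu ^ k) / mu ^ k" for k
    using mu_nonzero by (simp add: field_simps)
  ultimately have "wronskian (\<lambda>k. J k - mu ^ k) regular \<longlonglongrightarrow> 0"
    by (intro wronskian_tendsto_0 reg) simp
  moreover have "wronskian (\<lambda>k. J k - mu ^ k) regular = (\<lambda>n. J 0 - wronskian (\<lambda>k. mu ^ k) regular n)"
  proof
    fix n
    have "wronskian (\<lambda>k. J k - mu ^ k) regular n = wronskian J regular n - wronskian (\<lambda>k. mu ^ k) regular n"
      by (simp add: wronskian_def algebra_simps)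
    also have "wronskian J regular n = J 0"
      using wronskian_const[OF J(1) reg] by (simp add: wronskian_def)
    finally show "wronskian (\<lambda>k. J k - mu ^ k) regular n = J 0 - wronskian (\<lambda>k. mu ^ k) regular n" .
  qed
  ultimately have "(\<lambda>n. J 0 - wronskian (\<lambda>k. mu ^ k) regular n) \<longlonglongrightarrow> 0" by simp
  from tendsto_diff[OF tendsto_const[of "J 0"] this]
  have "(\<lambda>N. \<Sum>F\<in>Pow {..<N}. (-1) ^ card F * weighted_minor F) \<longlonglongrightarrow> J 0"
    by (simp add: sum_weighted_minors)
  with tendsto_sum_finite_sets[OF weighted_minors_summable] show ?thesis
    by (rule LIMSEQ_unique)
qed

end

section \<open>The resolvent of the free operator\<close>

lemma ell2_nat_iff: "(f :: nat \<Rightarrow> complex) \<in> ell2 \<longleftrightarrow> summable (\<lambda>n. (cmod (f n))\<^sup>2)"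
  unfolding ell2_def by (simp add: summable_on_UNIV_nonneg_real_iff)

lemma ell2_tendsto_zero:
  fixes f :: "nat \<Rightarrow> complex"
  assumes "f \<in> ell2"
  shows "f \<longlonglongrightarrow> 0"
proof -
  have "(\<lambda>n. (cmod (f n))\<^sup>2) \<longlonglongrightarrow> 0"
    using assms unfolding ell2_nat_iff by (rule summable_LIMSEQ_zero)
  from tendsto_real_sqrt[OF this] show ?thesis by (simp add: tendsto_norm_zero_iff)
qed

lemma ell2_coord_le:
  assumes "f \<in> ell2"
  shows "norm (f i) \<le> ell2_norm f"
proof -
  have "(norm (f i))\<^sup>2 \<le> (ell2_norm f)\<^sup>2" using ell2_sum_le_norm[OF assms, of "{i}"] by simp
  then show ?thesis by (rule power2_le_imp_le) simp
qed

lemma ell2_zero: "(\<lambda>_. 0 :: 'a :: real_normed_vector) \<in> ell2"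
  by (simp add: ell2_def)

lemma ell2_sum:
  fixes f :: "'k \<Rightarrow> 'i \<Rightarrow> complex"
  assumes "\<And>k. k \<in> A \<Longrightarrow> f k \<in> ell2"
  shows "(\<lambda>i. \<Sum>k\<in>A. f k i) \<in> ell2"
  using assms
  by (induction A rule: infinite_finite_induct) (auto intro!: ell2_add(1) simp: ell2_zero)

definition free_op :: "complex \<Rightarrow> (nat \<Rightarrow> complex) \<Rightarrow> nat \<Rightarrow> complex" where
  "free_op lam z = (\<lambda>m. right_shift z m - left_shift z m - lam * z m)"

lemma free_op_0: "free_op lam z 0 = - z 1 - lam * z 0"
  and free_op_Suc: "free_op lam z (Suc n) = z n - z (Suc (Suc n)) - lam * z (Suc n)"
  by (simp_all add: free_op_def right_shift_def left_shift_def)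

lemma free_op_add: "free_op lam (\<lambda>i. z i + w i) = (\<lambda>i. free_op lam z i + free_op lam w i)"
proof
  fix n show "free_op lam (\<lambda>i. z i + w i) n = free_op lam z n + free_op lam w n"
    by (cases n) (simp_all add: free_op_0 free_op_Suc algebra_simps)
qed

lemma free_op_scale: "free_op lam (\<lambda>i. a * z i) = (\<lambda>i. a * free_op lam z i)"
proof
  fix n show "free_op lam (\<lambda>i. a * z i) n = a * free_op lam z n"
    by (cases n) (simp_all add: free_op_0 free_op_Suc algebra_simps)
qed

lemma free_op_zero: "free_op lam (\<lambda>i. 0) = (\<lambda>i. 0)"
  using free_op_scale[of lam 0 "\<lambda>i. 0"] by simp

lemma free_op_sum: "free_op lam (\<lambda>i. \<Sum>k\<in>A. z k i) = (\<lambda>i. \<Sum>k\<in>A. free_op lam (z k) i)"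
  by (induction A rule: infinite_finite_induct) (simp_all add: free_op_add free_op_zero)

text \<open>
  In the \<open>n\<close>-th summand, \<open>Re (cnj z\<^sub>n z\<^sub>n\<^sub>-\<^sub>1)\<close> cancels against the summand before it.
\<close>

lemma shift_telescope:
  "(\<Sum>n<Suc N. Re (cnj (z n) * (right_shift z n - left_shift z n))) = - Re (cnj (z N) * z (Suc N))"
proof (induction N)
  case (Suc N)
  have "Re (cnj (z (Suc N)) * z N) = Re (cnj (z N) * z (Suc N))" by (simp add: mult.commute)
  with Suc show ?case by (simp add: right_shift_def left_shift_def right_diff_distrib)
qed (simp add: right_shift_def left_shift_def)

text \<open>
  \<open>S - S\<^sup>*\<close> is skew-adjoint, so only \<open>\<lambda>\<close> contributes to the real part of the quadratic form.
\<close>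

lemma free_op_bounded_below:
  assumes re: "Re lam > 0" and z: "z \<in> ell2" and f: "free_op lam z \<in> ell2"
  shows "ell2_norm z \<le> ell2_norm (free_op lam z) / Re lam"
proof -
  let ?f = "free_op lam z" and ?r = "Re lam"
  \<comment> \<open>Truncation leaves the boundary term \<open>z\<^sub>N z\<^sub>N\<^sub>+\<^sub>1\<close>, which tends to zero.\<close>
  have partial: "(\<Sum>n<Suc N. (cmod (z n))\<^sup>2) \<le> 2 / ?r * cmod (z N * z (Suc N)) + (ell2_norm ?f / ?r)\<^sup>2" for N
  proof -
    have pt: "?r * (cmod (z n))\<^sup>2 \<le> Re (cnj (z n) * (right_shift z n - left_shift z n))
        + (?r / 2 * (cmod (z n))\<^sup>2 + (cmod (?f n))\<^sup>2 / (2 * ?r))" for n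
    proof -
      have "Re (cnj (z n) * ?f n) = Re (cnj (z n) * (right_shift z n - left_shift z n)) - Re (lam * (z n * cnj (z n)))"
        by (simp add: free_op_def algebra_simps)
      also have "Re (lam * (z n * cnj (z n))) = ?r * (cmod (z n))\<^sup>2"
        by (simp add: complex_mult_cnj cmod_power2)
      finally have "?r * (cmod (z n))\<^sup>2 = Re (cnj (z n) * (right_shift z n - left_shift z n)) - Re (cnj (z n) * ?f n)"
        by simp
      moreover have "- Re (cnj (z n) * ?f n) \<le> cmod (z n) * cmod (?f n)"
        using complex_Re_le_cmod[of "- (cnj (z n) * ?f n)"] by (simp add: norm_mult)
      moreover have "cmod (z n) * cmod (?f n) \<le> ?r / 2 * (cmod (z n))\<^sup>2 + (cmod (?f n))\<^sup>2 / (2 * ?r)"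
      proof -
        have "0 \<le> (?r * cmod (z n) - cmod (?f n))\<^sup>2 / (2 * ?r)" using re by simp
        then show ?thesis using re by (simp add: power2_diff field_simps power2_eq_square)
      qed
      ultimately show ?thesis by linarith
    qed
    have "(\<Sum>n<Suc N. ?r * (cmod (z n))\<^sup>2) \<le> (\<Sum>n<Suc N. Re (cnj (z n) * (right_shift z n - left_shift z n))
        + (?r / 2 * (cmod (z n))\<^sup>2 + (cmod (?f n))\<^sup>2 / (2 * ?r)))"
      by (intro sum_mono pt)
    also have "\<dots> = - Re (cnj (z N) * z (Suc N)) + (?r / 2 * (\<Sum>n<Suc N. (cmod (z n))\<^sup>2)
        + (\<Sum>n<Suc N. (cmod (?f n))\<^sup>2) / (2 * ?r))"
      unfolding sum.distrib shift_telescope sum_distrib_left sum_divide_distrib ..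
    also have "\<dots> \<le> cmod (z N * z (Suc N)) + (?r / 2 * (\<Sum>n<Suc N. (cmod (z n))\<^sup>2)
        + (ell2_norm ?f)\<^sup>2 / (2 * ?r))"
    proof (intro add_mono order_refl divide_right_mono ell2_sum_le_norm f)
      show "- Re (cnj (z N) * z (Suc N)) \<le> cmod (z N * z (Suc N))"
        using complex_Re_le_cmod[of "- (cnj (z N) * z (Suc N))"] by (simp add: norm_mult)
    qed (use re in auto)
    finally have "?r / 2 * (\<Sum>n<Suc N. (cmod (z n))\<^sup>2) \<le> cmod (z N * z (Suc N)) + (ell2_norm ?f)\<^sup>2 / (2 * ?r)"
      by (simp add: sum_distrib_left[symmetric])
    then show ?thesis using re by (simp add: field_simps power2_eq_square)
  qed
  have lim: "(\<lambda>N. 2 / ?r * cmod (z N * z (Suc N)) + (ell2_norm ?f / ?r)\<^sup>2) \<longlonglongrightarrow> (ell2_norm ?f / ?r)\<^sup>2"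
  proof -
    have "(\<lambda>N. 2 / ?r * cmod (z N * z (Suc N)) + (ell2_norm ?f / ?r)\<^sup>2) \<longlonglongrightarrow> 2 / ?r * cmod (0 * 0) + (ell2_norm ?f / ?r)\<^sup>2"
      by (intro tendsto_intros ell2_tendsto_zero[OF z] LIMSEQ_Suc[OF ell2_tendsto_zero[OF z]])
    then show ?thesis by simp
  qed
  show ?thesis
  proof (rule ell2_boundedI(2))
    fix F :: "nat set" assume F: "finite F"
    then obtain K where K: "F \<subseteq> {..<K}" by (metis finite_nat_iff_bounded)
    show "(\<Sum>i\<in>F. (cmod (z i))\<^sup>2) \<le> (ell2_norm ?f / ?r)\<^sup>2"
    proof (rule LIMSEQ_le_const[OF lim], intro exI allI impI)
      fix N assume "K \<le> N"
      then have "(\<Sum>i\<in>F. (cmod (z i))\<^sup>2) \<le> (\<Sum>n<Suc N. (cmod (z n))\<^sup>2)"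
        using K by (intro sum_mono2) auto
      also note partial[of N]
      finally show "(\<Sum>i\<in>F. (cmod (z i))\<^sup>2) \<le> 2 / ?r * cmod (z N * z (Suc N)) + (ell2_norm ?f / ?r)\<^sup>2" .
    qed
  qed (use re in simp)
qed

locale half_plane = difference_equation +
  assumes re_pos: "Re lam > 0"
begin

text \<open>
  The free solutions \<open>\<mu>\<^sup>n\<close>, decaying at infinity, and \<open>free_regular\<close>, satisfying the boundary
  condition, are glued at the diagonal; the sign is the alternating one of their Wronskian.
\<close>

definition green :: "nat \<Rightarrow> nat \<Rightarrow> complex" where
  "green n m = (-1) ^ Suc m * mu ^ Suc (max n m) * free_regular (Suc (min n m))"

lemma free_op_green: "free_op lam (\<lambda>n. green n m) = (\<lambda>n. if n = m then 1 else 0)"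
proof
  fix n
  consider "n < m" | "n = m" | "m < n" by linarith
  then show "free_op lam (\<lambda>n. green n m) n = (if n = m then 1 else 0)"
  proof cases
    case 1
    show ?thesis
    proof (cases n)
      case 0
      with 1 show ?thesis by (simp add: free_op_0 green_def max_def min_def)
    next
      case (Suc k)
      with 1 have "max k m = m" "max (Suc (Suc k)) m = m" "max (Suc k) m = m"
        "min k m = k" "min (Suc (Suc k)) m = Suc (Suc k)" "min (Suc k) m = Suc k" by auto
      with 1 Suc show ?thesis by (simp add: free_op_Suc green_def algebra_simps)
    qed
  next
    case 2
    show ?thesis
    proof (cases m)
      case 0
      with 2 show ?thesis
        using mu_square by (simp add: free_op_0 green_def algebra_simps)
    next
      case (Suc k)
      have "free_op lam (\<lambda>n. green n m) n
        = (-1) ^ Suc m * (mu ^ Suc m * free_regular m - mu ^ m * (mu * mu) * free_regular (Suc m) - lam * mu ^ Suc m * free_regular (Suc m))"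
        using 2 Suc by (simp add: free_op_Suc green_def algebra_simps)
      also have "\<dots> = (-1) ^ m * (mu ^ m * free_regular (Suc m) - mu ^ Suc m * free_regular m)"
        by (simp add: mu_square algebra_simps del: free_regular_simps(3))
      also have "\<dots> = (-1) ^ m * (-1) ^ m"
      proof -
        have "mu ^ m * free_regular (Suc m) - mu ^ Suc m * free_regular m
            = mu * (mu ^ k * free_regular (Suc (k + 1)) - mu ^ (k + 1) * free_regular (Suc k))"
          by (simp add: Suc algebra_simps del: free_regular_simps(3))
        also have "\<dots> = (-1) ^ m" by (subst free_regular_shift) (simp add: Suc)
        finally show ?thesis by simp
      qed
      finally show ?thesis using 2 by (simp flip: power_mult_distrib)
    qed
  next
    case 3
    then obtain k where k: "n = Suc k" "m \<le> k" by (metis Suc_le_D Suc_leI Suc_le_mono)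
    then have "max k m = k" "max (Suc (Suc k)) m = Suc (Suc k)" "max (Suc k) m = Suc k"
      "min k m = m" "min (Suc (Suc k)) m = m" "min (Suc k) m = m" by auto
    then have "free_op lam (\<lambda>n. green n m) n
      = (-1) ^ Suc m * mu ^ Suc k * free_regular (Suc m) * (1 - mu * mu - lam * mu)"
      using k by (simp add: free_op_Suc green_def algebra_simps)
    with 3 mu_square show ?thesis by simp
  qed
qed

lemma green_sym_le:
  shows "cmod (green n m) \<le> (\<Sum>k\<le>m. cmod (free_regular (Suc k))) * cmod (mu ^ n)"
    and "cmod (green n m) \<le> (\<Sum>k\<le>n. cmod (free_regular (Suc k))) * cmod (mu ^ m)"
proof -
  have *: "cmod (green n m) \<le> (\<Sum>k\<le>j. cmod (free_regular (Suc k))) * cmod (mu ^ i)"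
    if "min n m \<le> j" "i \<le> max n m" for i j
  proof -
    have "cmod (green n m) = cmod (free_regular (Suc (min n m))) * cmod mu ^ Suc (max n m)"
      by (simp add: green_def norm_mult norm_power)
    also have "\<dots> \<le> (\<Sum>k\<le>j. cmod (free_regular (Suc k))) * cmod mu ^ i"
    proof (intro mult_mono)
      show "cmod (free_regular (Suc (min n m))) \<le> (\<Sum>k\<le>j. cmod (free_regular (Suc k)))"
        by (rule member_le_sum) (use that in auto)
      show "cmod mu ^ Suc (max n m) \<le> cmod mu ^ i"
        by (rule power_decreasing) (use that small in auto)
    qed (auto intro: sum_nonneg)
    finally show ?thesis by (simp add: norm_power)
  qed
  show "cmod (green n m) \<le> (\<Sum>k\<le>m. cmod (free_regular (Suc k))) * cmod (mu ^ n)"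
    and "cmod (green n m) \<le> (\<Sum>k\<le>n. cmod (free_regular (Suc k))) * cmod (mu ^ m)"
    by (rule *; simp)+
qed

lemma green_ell2: "(\<lambda>n. green n m) \<in> ell2"
proof (rule ell2_leI(1))
  have "(cmod mu)\<^sup>2 ^ n = (cmod (mu ^ n))\<^sup>2" for n
    by (simp add: norm_power flip: power_mult) (simp add: mult.commute)
  then show "(\<lambda>n. mu ^ n) \<in> ell2"
    using summable_geometric[of "(cmod mu)\<^sup>2"] mod_square_less_1 by (simp add: ell2_nat_iff)
  show "cmod (green n m) \<le> (\<Sum>k\<le>m. cmod (free_regular (Suc k))) * cmod (mu ^ n)" for n
    by (rule green_sym_le)
qed (auto intro: sum_nonneg)

lemma green_comb:
  shows "(\<lambda>n. \<Sum>k<N. h k * green n k) \<in> ell2"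
    and "free_op lam (\<lambda>n. \<Sum>k<N. h k * green n k) = (\<lambda>n. if n < N then h n else 0)"
proof -
  show "(\<lambda>n. \<Sum>k<N. h k * green n k) \<in> ell2"
    by (intro ell2_sum ell2_scale(1) green_ell2)
  show "free_op lam (\<lambda>n. \<Sum>k<N. h k * green n k) = (\<lambda>n. if n < N then h n else 0)"
    unfolding free_op_sum free_op_scale free_op_green
    by (simp add: fun_eq_iff if_distrib sum.delta' cong: if_cong)
qed

text \<open>
  Truncations of \<open>f\<close> have explicit preimages by the Green function. They converge pointwise, and
  the lower bound for the free operator keeps their norms bounded, so the limit is in \<open>ell2\<close>.
\<close>

lemma free_op_surj:
  assumes f: "f \<in> ell2"
  shows "\<exists>z\<in>ell2. free_op lam z = f"
proof -
  define Z where "Z N n = (\<Sum>k<N. f k * green n k)" for N n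
  define z where "z n = (\<Sum>k. f k * green n k)" for n
  have conv: "(\<lambda>N. Z N n) \<longlonglongrightarrow> z n" for n
  proof -
    have "summable (\<lambda>k. f k * green n k)"
    proof (rule summable_comparison_test'[where N=0])
      show "summable (\<lambda>k. ell2_norm f * (\<Sum>k\<le>n. cmod (free_regular (Suc k))) * cmod mu ^ k)"
        using small by (intro summable_mult summable_geometric) simp
      fix k
      have "cmod (f k * green n k) \<le> ell2_norm f * ((\<Sum>k\<le>n. cmod (free_regular (Suc k))) * cmod (mu ^ k))"
        unfolding norm_mult by (intro mult_mono ell2_coord_le f green_sym_le) auto
      then show "norm (f k * green n k) \<le> ell2_norm f * (\<Sum>k\<le>n. cmod (free_regular (Suc k))) * cmod mu ^ k"
        by (simp add: norm_power mult.assoc)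
    qed
    then show ?thesis unfolding Z_def z_def by (rule summable_LIMSEQ)
  qed
  have Zop: "free_op lam (Z N) = (\<lambda>n. if n < N then f n else 0)" for N
    unfolding Z_def by (rule green_comb)
  have cut: "(\<lambda>n. if n < N then f n else 0) \<in> ell2" "ell2_norm (\<lambda>n. if n < N then f n else 0) \<le> ell2_norm f" for N
    using ell2_leI[OF f, of 1 "\<lambda>n. if n < N then f n else 0"] by auto
  have Zmem: "Z N \<in> ell2" for N unfolding Z_def by (rule green_comb)
  have Znorm: "ell2_norm (Z N) \<le> ell2_norm f / Re lam" for N
  proof -
    have "ell2_norm (Z N) \<le> ell2_norm (free_op lam (Z N)) / Re lam"
      by (rule free_op_bounded_below[OF re_pos Zmem]) (simp add: Zop cut)
    also have "\<dots> \<le> ell2_norm f / Re lam"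
      using re_pos cut(2) by (simp add: Zop divide_right_mono)
    finally show ?thesis .
  qed
  have "z \<in> ell2"
  proof (rule ell2_boundedI(1))
    fix F :: "nat set" assume F: "finite F"
    have "(\<lambda>N. \<Sum>i\<in>F. (cmod (Z N i))\<^sup>2) \<longlonglongrightarrow> (\<Sum>i\<in>F. (cmod (z i))\<^sup>2)"
      by (intro tendsto_intros conv)
    then show "(\<Sum>i\<in>F. (cmod (z i))\<^sup>2) \<le> (ell2_norm f / Re lam)\<^sup>2"
    proof (rule LIMSEQ_le_const2, intro exI allI impI)
      fix N :: nat
      have "(\<Sum>i\<in>F. (cmod (Z N i))\<^sup>2) \<le> (ell2_norm (Z N))\<^sup>2" by (rule ell2_sum_le_norm[OF Zmem F])
      also have "\<dots> \<le> (ell2_norm f / Re lam)\<^sup>2" by (intro power_mono Znorm) simp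
      finally show "(\<Sum>i\<in>F. (cmod (Z N i))\<^sup>2) \<le> (ell2_norm f / Re lam)\<^sup>2" .
    qed
  qed (use re_pos in simp)
  moreover have "free_op lam z n = f n" for n
  proof -
    have "(\<lambda>N. free_op lam (Z N) n) \<longlonglongrightarrow> free_op lam z n"
      by (cases n) (auto simp: free_op_0 free_op_Suc intro!: tendsto_intros conv)
    moreover have "(\<lambda>N. free_op lam (Z N) n) \<longlonglongrightarrow> f n"
      by (rule tendsto_eventually, rule eventually_mono[OF eventually_gt_at_top[of n]]) (simp add: Zop)
    ultimately show ?thesis by (rule LIMSEQ_unique)
  qed
  ultimately show ?thesis by (auto simp: fun_eq_iff)
qed

lemma free_op_inj: "inj_on (free_op lam) ell2"
proof (rule inj_onI)
  fix z w assume z: "z \<in> ell2" and w: "w \<in> ell2" and eq: "free_op lam z = free_op lam w"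
  define d where "d i = z i + (-1) * w i" for i
  have d: "d \<in> ell2" unfolding d_def by (intro ell2_add(1) ell2_scale(1) z w)
  have "free_op lam d = (\<lambda>i. 0)"
    unfolding d_def free_op_add free_op_scale eq by simp
  with free_op_bounded_below[OF re_pos d] have "ell2_norm d \<le> ell2_norm (\<lambda>i::nat. 0::complex) / Re lam"
    by (simp add: ell2_zero)
  also have "\<dots> = 0" by (simp add: ell2_norm_def)
  finally have d0: "ell2_norm d \<le> 0" .
  have "d i = 0" for i using order_trans[OF ell2_coord_le[OF d] d0, of i] by simp
  then show "z = w" by (simp add: d_def fun_eq_iff)
qed

definition resolvent :: "(nat \<Rightarrow> complex) \<Rightarrow> nat \<Rightarrow> complex" where
  "resolvent f = inv_into ell2 (free_op lam) f"

lemma resolvent: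
  assumes "f \<in> ell2"
  shows "resolvent f \<in> ell2" and "free_op lam (resolvent f) = f"
    and "ell2_norm (resolvent f) \<le> ell2_norm f / Re lam"
proof -
  have f: "f \<in> free_op lam ` ell2" using free_op_surj[OF assms] by auto
  show 1: "resolvent f \<in> ell2" unfolding resolvent_def by (rule inv_into_into[OF f])
  show 2: "free_op lam (resolvent f) = f" unfolding resolvent_def by (rule f_inv_into_f[OF f])
  show "ell2_norm (resolvent f) \<le> ell2_norm f / Re lam"
    using free_op_bounded_below[OF re_pos 1] assms by (simp add: 2)
qed

lemma resolvent_eqI: "z \<in> ell2 \<Longrightarrow> free_op lam z = f \<Longrightarrow> resolvent f = z"
  unfolding resolvent_def using inv_into_f_f[OF free_op_inj] by metis

lemma resolvent_add:
  "f \<in> ell2 \<Longrightarrow> g \<in> ell2 \<Longrightarrow> resolvent (\<lambda>i. f i + g i) = (\<lambda>i. resolvent f i + resolvent g i)"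
  by (rule resolvent_eqI) (simp_all add: ell2_add(1) resolvent free_op_add)

lemma resolvent_scale: "f \<in> ell2 \<Longrightarrow> resolvent (\<lambda>i. a * f i) = (\<lambda>i. a * resolvent f i)"
  by (rule resolvent_eqI) (simp_all add: ell2_scale(1) resolvent free_op_scale)

section \<open>The scalar Birman-Schwinger operator\<close>

lemma K_plus_eq: "K_plus b c lam v = (\<lambda>n. - (c n * resolvent (\<lambda>m. b m * v m) n))"
  by (simp add: K_plus_def resolvent_def free_op_def[abs_def])

lemma mult_bounded_ell2:
  assumes "\<And>n. cmod (b n) \<le> \<beta>" "v \<in> ell2"
  shows "(\<lambda>m. b m * v m) \<in> ell2" "ell2_norm (\<lambda>m. b m * v m) \<le> \<beta> * ell2_norm v"
  using ell2_leI[OF assms(2), of \<beta> "\<lambda>m. b m * v m"] assms(1) order_trans[OF norm_ge_zero assms(1)]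
  by (auto simp: norm_mult mult_right_mono)

lemma K_plus_bounded:
  assumes b: "\<And>n. cmod (b n) \<le> \<beta>" and c: "\<And>n. cmod (c n) \<le> \<gamma>"
  shows "bounded_op (K_plus b c lam)"
    and "v \<in> ell2 \<Longrightarrow> ell2_norm (K_plus b c lam v) \<le> \<gamma> * \<beta> / Re lam * ell2_norm v"
proof -
  have \<gamma>: "0 \<le> \<gamma>" using order_trans[OF norm_ge_zero c] .
  have K: "K_plus b c lam v \<in> ell2 \<and> ell2_norm (K_plus b c lam v) \<le> \<gamma> * \<beta> / Re lam * ell2_norm v"
    if v: "v \<in> ell2" for v
  proof -
    note bv = mult_bounded_ell2[of b, OF b v]
    have mc: "cmod (- c n) \<le> \<gamma>" for n using c by simp
    note cr = mult_bounded_ell2[of "\<lambda>n. - c n", OF mc resolvent(1)[OF bv(1)]]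
    have eq: "K_plus b c lam v = (\<lambda>n. - c n * resolvent (\<lambda>m. b m * v m) n)"
      by (simp add: K_plus_eq)
    have "ell2_norm (K_plus b c lam v) \<le> \<gamma> * ell2_norm (resolvent (\<lambda>m. b m * v m))"
      unfolding eq by (rule cr)
    also have "\<dots> \<le> \<gamma> * ((\<beta> * ell2_norm v) / Re lam)"
    proof (intro mult_left_mono \<gamma>)
      have "ell2_norm (resolvent (\<lambda>m. b m * v m)) \<le> ell2_norm (\<lambda>m. b m * v m) / Re lam"
        by (rule resolvent(3)[OF bv(1)])
      also have "\<dots> \<le> (\<beta> * ell2_norm v) / Re lam"
        using re_pos bv(2) by (simp add: divide_right_mono)
      finally show "ell2_norm (resolvent (\<lambda>m. b m * v m)) \<le> (\<beta> * ell2_norm v) / Re lam" .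
    qed
    finally show ?thesis using cr(1) unfolding eq by simp
  qed
  show "v \<in> ell2 \<Longrightarrow> ell2_norm (K_plus b c lam v) \<le> \<gamma> * \<beta> / Re lam * ell2_norm v" using K by blast
  show "bounded_op (K_plus b c lam)"
    unfolding bounded_op_def
  proof (intro conjI ballI allI exI[of _ "\<gamma> * \<beta> / Re lam"])
    fix f g :: "nat \<Rightarrow> complex" assume fg: "f \<in> ell2" "g \<in> ell2"
    show "K_plus b c lam (\<lambda>i. f i + g i) = (\<lambda>i. K_plus b c lam f i + K_plus b c lam g i)"
      using resolvent_add[OF mult_bounded_ell2(1)[of b, OF b fg(1)] mult_bounded_ell2(1)[of b, OF b fg(2)]]
      by (simp add: K_plus_eq algebra_simps)
  next
    fix a :: complex and f :: "nat \<Rightarrow> complex" assume f: "f \<in> ell2"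
    show "K_plus b c lam (\<lambda>i. a * f i) = (\<lambda>i. a * K_plus b c lam f i)"
      using resolvent_scale[OF mult_bounded_ell2(1)[of b, OF b f], of a]
      by (simp add: K_plus_eq mult.left_commute)
  qed (use K in auto)
qed

lemma K_plus_entry:
  "op_entry (K_plus b c lam) i j =
     c i * (mu ^ max i j * free_regular (Suc (min i j))) * (b j * (-1) ^ j * mu)"
proof -
  have "(\<lambda>m. b m * (if m = j then 1 else 0)) = (\<lambda>i. b j * (if i = j then 1 else 0))" by auto
  moreover have "resolvent (\<lambda>i. b j * (if i = j then 1 else 0)) = (\<lambda>n. b j * green n j)"
    by (rule resolvent_eqI) (simp_all add: ell2_scale(1) green_ell2 free_op_scale free_op_green)
  ultimately show ?thesis by (simp add: op_entry_def K_plus_eq green_def)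
qed

definition tail :: "nat \<Rightarrow> (nat \<Rightarrow> complex) \<Rightarrow> nat \<Rightarrow> complex" where
  "tail n b = (\<lambda>m. if m < n then 0 else b m)"

lemma sum_lessThan_double:
  fixes h :: "nat \<Rightarrow> complex"
  shows "(\<Sum>k<2 * n. h k) = (\<Sum>k<n. h k) + (\<Sum>k<n. h (n + k))"
proof -
  have "(\<Sum>k<n + m. h k) = (\<Sum>k<n. h k) + (\<Sum>k<m. h (n + k))" for m
    by (induction m) (simp_all add: add.assoc)
  from this[of n] show ?thesis by (simp add: mult_2)
qed

text \<open>
  Cutting both \<open>b\<close> and \<open>c\<close> off below \<open>n\<close> changes the operator by rank at most
  \<open>2 n\<close>: the first \<open>n\<close> rows, and the first \<open>n\<close> columns.
\<close>

lemma rank_le_K_plus_diff_tail: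
  assumes b: "\<And>n. cmod (b n) \<le> \<beta>"
  shows "rank_le (\<lambda>v i. K_plus b c lam v i - K_plus (tail n b) (tail n c) lam v i) (2 * n)"
proof -
  define g where "g k i = (if k < n then (if i = k then 1 else 0) else - (tail n c i * green i (k - n)))" for k i
  have "\<exists>a :: nat \<Rightarrow> complex. (\<lambda>i. K_plus b c lam v i - K_plus (tail n b) (tail n c) lam v i)
      = (\<lambda>i. \<Sum>k<2 * n. a k * g k i)" if v: "v \<in> ell2" for v
  proof -
    let ?R = "resolvent (\<lambda>m. b m * v m)" and ?R' = "resolvent (\<lambda>m. tail n b m * v m)"
    have tb: "cmod (tail n b m) \<le> \<beta>" for m
      using b[of m] order_trans[OF norm_ge_zero b[of m]] by (auto simp: tail_def)
    have bv': "(\<lambda>m. tail n b m * v m) \<in> ell2" by (rule mult_bounded_ell2(1)[of "tail n b", OF tb v])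
    have R: "?R = (\<lambda>i. ?R' i + (\<Sum>k<n. (b k * v k) * green i k))"
    proof (rule resolvent_eqI)
      show "(\<lambda>i. ?R' i + (\<Sum>k<n. (b k * v k) * green i k)) \<in> ell2"
        by (intro ell2_add(1) resolvent(1) bv' green_comb(1))
      show "free_op lam (\<lambda>i. ?R' i + (\<Sum>k<n. (b k * v k) * green i k)) = (\<lambda>m. b m * v m)"
        unfolding free_op_add green_comb(2)[where N=n and h="\<lambda>k. b k * v k"] resolvent(2)[OF bv']
        by (auto simp: tail_def)
    qed
    \<comment> \<open>Indices below \<open>n\<close> account for the removed rows, those from \<open>n\<close> on for the removed columns.\<close>
    define a where "a k = (if k < n then - (c k * ?R k) else b (k - n) * v (k - n))" for k
    have "K_plus b c lam v i - K_plus (tail n b) (tail n c) lam v i = (\<Sum>k<2 * n. a k * g k i)" for i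
    proof -
      have "(\<Sum>k<2 * n. a k * g k i) = (\<Sum>k<n. - (c k * ?R k) * (if i = k then 1 else 0))
          + (\<Sum>k<n. (b k * v k) * - (tail n c i * green i k))"
        unfolding sum_lessThan_double by (simp add: a_def g_def)
      also have "(\<Sum>k<n. - (c k * ?R k) * (if i = k then 1 else 0)) = (if i < n then - (c i * ?R i) else 0)"
        by (simp add: if_distrib cong: if_cong)
      also have "(\<Sum>k<n. (b k * v k) * - (tail n c i * green i k)) = - tail n c i * (\<Sum>k<n. (b k * v k) * green i k)"
        by (simp add: sum_distrib_left sum_negf mult_ac)
      also have "(\<Sum>k<n. (b k * v k) * green i k) = ?R i - ?R' i"
        using fun_cong[OF R, of i] by simp
      finally show ?thesis by (auto simp: K_plus_eq tail_def algebra_simps)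
    qed
    then show ?thesis by blast
  qed
  then show ?thesis unfolding rank_le_def by blast
qed

lemma trace_class_K_plus:
  assumes b: "\<And>n. cmod (b n) \<le> \<beta> / (real n + 1)" and c: "\<And>n. cmod (c n) \<le> \<gamma> / (real n + 1)"
  shows "trace_class (K_plus b c lam)"
proof -
  have \<beta>: "0 \<le> \<beta>" using order_trans[OF norm_ge_zero b[of 0]] by simp
  have \<gamma>: "0 \<le> \<gamma>" using order_trans[OF norm_ge_zero c[of 0]] by simp
  have le: "cmod (tail n s m) \<le> \<sigma> / (real n + 1)"
    if "\<And>n. cmod (s n) \<le> \<sigma> / (real n + 1)" "0 \<le> \<sigma>" for s \<sigma> n m
  proof (cases "m < n")
    case False
    have "cmod (s m) \<le> \<sigma> / (real m + 1)" by (rule that)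
    also have "\<dots> \<le> \<sigma> / (real n + 1)" using False that(2) by (intro divide_left_mono) auto
    finally show ?thesis using False by (simp add: tail_def)
  qed (use that in \<open>simp add: tail_def\<close>)
  note tb = le[of b \<beta>, OF b \<beta>] and tc = le[of c \<gamma>, OF c \<gamma>]
  have b0: "cmod (b n) \<le> \<beta>" for n using tb[of 0 n] by (simp add: tail_def)
  have c0: "cmod (c n) \<le> \<gamma>" for n using tc[of 0 n] by (simp add: tail_def)
  let ?F = "\<lambda>n v i. K_plus b c lam v i - K_plus (tail n b) (tail n c) lam v i"
  show ?thesis
  proof (rule trace_class_approxI[where F="?F" and C="\<gamma> * \<beta> / Re lam"])
    show "bounded_op (K_plus b c lam)" by (rule K_plus_bounded(1)[of b \<beta> c \<gamma>, OF b0 c0])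
    then show "bounded_op (?F n)" for n by (rule bounded_op_diff[OF _ K_plus_bounded(1)[of "tail n b" _ "tail n c", OF tb tc]])
    show "rank_le (?F n) (2 * n)" for n by (rule rank_le_K_plus_diff_tail[of b, OF b0])
    show "0 \<le> \<gamma> * \<beta> / Re lam" using re_pos \<beta> \<gamma> by simp
    fix n and f :: "nat \<Rightarrow> complex" assume "f \<in> ell2"
    from K_plus_bounded(2)[of "tail n b" _ "tail n c", OF tb tc this]
    show "ell2_norm (\<lambda>i. K_plus b c lam f i - ?F n f i) \<le> \<gamma> * \<beta> / Re lam / (real n + 1)\<^sup>2 * ell2_norm f"
      by (simp add: power2_eq_square mult_ac)
  qed
qed

lemma det_I_minus_K_eq:
  assumes V: "V = (\<lambda>n. b n * c n)"
    and b: "\<And>n. cmod (b n) \<le> \<beta> / (real n + 1)" and c: "\<And>n. cmod (c n) \<le> \<gamma> / (real n + 1)"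
    and J: "sol J" "(\<lambda>k. J k / mu ^ k) \<longlonglongrightarrow> 1"
  shows "det_I_minus (K_plus b c lam) = J 0"
proof -
  have "principal_minor (K_plus b c lam) F = weighted_minor F" for F
  proof -
    have "principal_minor (K_plus b c lam) F = fdet F (op_entry (K_plus b c lam))"
      by (rule principal_minor_fdet)
    also have "\<dots> = (\<Prod>i\<in>F. c i * (b i * (-1) ^ i * mu)) * fdet F (\<lambda>i j. mu ^ max i j * free_regular (Suc (min i j)))"
      unfolding K_plus_entry[abs_def] by (rule fdet_scale)
    also have "(\<Prod>i\<in>F. c i * (b i * (-1) ^ i * mu)) = (\<Prod>i\<in>F. (-1) ^ i * mu * V i)"
      by (simp add: fun_cong[OF V] mult_ac)
    finally have "principal_minor (K_plus b c lam) F = weighted_minor F" unfolding weighted_minor_def .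
    then show ?thesis .
  qed
  then show ?thesis
    using trace_class_K_plus[of b _ c, OF b c] weighted_minor_series[OF J]
    by (simp add: det_I_minus_def trace_ext_power_def)
qed

end

section \<open>The matrix-valued Birman-Schwinger operator\<close>

lemma fdet_image:
  assumes f: "inj_on f F" and F: "finite F"
  shows "fdet (f ` F) M = fdet F (\<lambda>i j. M (f i) (f j))"
proof -
  let ?h = "\<lambda>q. of_int (sign q) * (\<Prod>i\<in>f ` F. M i (q i))"
  have bij: "bij_betw f F (f ` F)" using f by (rule inj_on_imp_bij_betw)
  have "(\<Sum>p | p permutes F. of_int (sign p) * (\<Prod>i\<in>F. M (f i) (f (p i)))) = sum ?h {q. q permutes f ` F}"
  proof (rule sum.reindex_bij_witness[where j="map_permutation F f" and i="map_permutation (f ` F) (inv_into F f)"])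
    fix p assume "p \<in> {p. p permutes F}"
    then have p: "p permutes F" by simp
    show "map_permutation (f ` F) (inv_into F f) (map_permutation F f p) = p"
      by (rule map_permutation_compose_inv[OF bij p]) (simp add: f)
    show "map_permutation F f p \<in> {q. q permutes f ` F}"
      using map_permutation_permutes[OF bij p] by simp
    have "(\<Prod>i\<in>f ` F. M i (map_permutation F f p i)) = (\<Prod>i\<in>F. M (f i) (f (p i)))"
      by (simp add: prod.reindex[OF f] map_permutation_apply[OF f])
    then show "?h (map_permutation F f p) = of_int (sign p) * (\<Prod>i\<in>F. M (f i) (f (p i)))"
      by (simp add: sign_map_permutation[OF f p F])
  next
    fix q assume "q \<in> {q. q permutes f ` F}"
    then have q: "q permutes f ` F" by simp
    have bij': "bij_betw (inv_into F f) (f ` F) F" by (rule bij_betw_inv_into[OF bij])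
    show "map_permutation F f (map_permutation (f ` F) (inv_into F f) q) = q"
      by (rule map_permutation_compose_inv[OF bij' q]) (simp add: f_inv_into_f)
    show "map_permutation (f ` F) (inv_into F f) q \<in> {p. p permutes F}"
      using map_permutation_permutes[OF bij' q] by simp
  qed
  then show ?thesis by (simp add: fdet_def)
qed

text \<open>
  Rows belonging to second components vanish, so only index sets made of first components
  contribute to the traces.
\<close>

lemma det_I_minus_lift:
  assumes T: "trace_class T"
  shows "det_I_minus (lift_op T) = det_I_minus T"
proof -
  define h where "h = (\<lambda>n::nat. (n, 1::2))"
  have inj: "inj h" by (simp add: h_def inj_def)
  have entry: "op_entry (lift_op T) (h i) (h j) = op_entry T i j" for i j
    by (simp add: op_entry_def lift_op_def h_def)
  have entry2: "op_entry (lift_op T) (n, 2) j = 0" for n j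
    by (simp add: op_entry_def lift_op_def)
  have minor: "principal_minor (lift_op T) (h ` F) = principal_minor T F" if "finite F" for F
    unfolding principal_minor_fdet
    by (subst fdet_image[OF inj_on_subset[OF inj subset_UNIV] that]) (simp add: entry)
  have minor2: "principal_minor (lift_op T) F = 0" if F: "finite F" and nF: "\<not> F \<subseteq> range h" for F
  proof -
    obtain n j where nj: "(n, j) \<in> F" "(n, j) \<notin> range h" using nF by fastforce
    then have "j = 2" using exhaust_2[of j] by (auto simp: h_def)
    with nj(1) show ?thesis unfolding principal_minor_fdet
      by (intro fdet_zero_row[OF F, of "(n, 2)"]) (simp_all add: entry2)
  qed
  have "trace_ext_power k (lift_op T) = trace_ext_power k T" for k
  proof -
    let ?S = "{F :: nat set. finite F \<and> card F = k}"
    have card_h: "card (h ` F) = card F" for F by (rule card_image[OF inj_on_subset[OF inj subset_UNIV]])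
    have "trace_ext_power k (lift_op T) = infsum (principal_minor (lift_op T)) ((`) h ` ?S)"
      unfolding trace_ext_power_def
    proof (rule infsum_cong_neutral)
      fix F assume F: "F \<in> {F. finite F \<and> card F = k} - (`) h ` ?S"
      have "\<not> F \<subseteq> range h"
      proof
        assume "F \<subseteq> range h"
        then obtain G where G: "F = h ` G" by (auto simp: subset_image_iff)
        then have "finite G" using F finite_imageD[of h G] inj by (auto intro: inj_on_subset)
        with G F show False by (auto simp: card_h)
      qed
      with F show "principal_minor (lift_op T) F = 0" by (intro minor2) auto
    qed (auto simp: card_h)
    also have "\<dots> = infsum (principal_minor (lift_op T) \<circ> (`) h) ?S"
      by (rule infsum_reindex) (use inj in \<open>simp add: inj_on_def inj_image_eq_iff\<close>)
    also have "\<dots> = trace_ext_power k T"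
      unfolding trace_ext_power_def by (rule infsum_cong) (simp add: minor)
    finally show ?thesis .
  qed
  then show ?thesis using T trace_class_lift[OF T] by (simp add: det_I_minus_def)
qed

lemma vec2_eq_iff: "(x :: 'a^2) = y \<longleftrightarrow> x $ 1 = y $ 1 \<and> x $ 2 = y $ 2"
  by (simp add: vec_eq_iff forall_2)

lemmas mat2_simps = vec2_eq_iff matrix_vector_mult_def matrix_matrix_mult_def mat_def sum_2

lemma vec2_ell2:
  fixes y :: "nat \<Rightarrow> complex^2"
  assumes "(\<lambda>n. y n $ 1) \<in> ell2" "(\<lambda>n. y n $ 2) \<in> ell2"
  shows "y \<in> ell2"
proof -
  have a: "(\<lambda>n. cmod (y n $ i)) \<in> ell2" if "(\<lambda>n. y n $ i) \<in> ell2" for i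
    by (rule ell2_leI(1)[OF that, of 1]) auto
  have sum: "(\<lambda>n. cmod (y n $ 1) + cmod (y n $ 2)) \<in> ell2" by (intro ell2_add(1) a assms)
  have le: "norm (y n) \<le> 1 * norm (cmod (y n $ 1) + cmod (y n $ 2))" for n
    using L2_set_le_sum[of UNIV "\<lambda>i. norm (y n $ i)"] by (simp add: norm_vec_def sum_2)
  show ?thesis by (rule ell2_leI(1)[OF sum _ le]) simp
qed

lemma vec2_component_ell2:
  fixes y :: "nat \<Rightarrow> complex^2"
  assumes "y \<in> ell2"
  shows "(\<lambda>n. y n $ i) \<in> ell2"
  by (rule ell2_leI(1)[OF assms, of 1]) (simp_all add: Finite_Cartesian_Product.norm_nth_le)

lemma right_shift_simps [simp]: "right_shift p 0 = 0" "right_shift p (Suc n) = p n"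
  by (simp_all add: right_shift_def)

lemma right_shift_ell2:
  fixes p :: "nat \<Rightarrow> complex"
  assumes "p \<in> ell2"
  shows "right_shift p \<in> ell2"
proof -
  have "summable (\<lambda>n. (cmod (right_shift p (Suc n)))\<^sup>2)"
    using assms by (simp add: ell2_nat_iff)
  then show ?thesis
    unfolding ell2_nat_iff by (subst (asm) summable_Suc_iff)
qed

lemma Q_plus_range: "mat_ran Q_plus = {v. v $ 2 = 0}"
proof -
  have "v = Q_plus *v v" if "v $ 2 = 0" for v
    using that by (simp add: Q_plus_def mat2_simps)
  moreover have "(Q_plus *v v) $ 2 = 0" for v by (simp add: Q_plus_def mat2_simps)
  ultimately show ?thesis unfolding mat_ran_def by blast
qed

context half_plane
begin

text \<open>
  With \<open>y = (p, q)\<close> the first-order system forces \<open>q = S p\<close>, where the condition on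
  \<open>y\<^sub>0\<close> supplies \<open>q\<^sub>0 = 0\<close>; what is left is the scalar equation for \<open>- p\<close>.
\<close>

lemma T_plus_eq_lift:
  assumes b: "\<And>n. cmod (b n) \<le> \<beta>" and x: "x \<in> ell2"
  shows "flatten (T_plus b c lam (unflatten x)) = lift_op (K_plus b c lam) x"
proof -
  define v where "v = unflatten x"
  define h where "h = (\<lambda>m. b m * x (m, 1))"
  define L where "L = (\<lambda>(y :: nat \<Rightarrow> complex^2) m. left_shift y m - A_mat lam *v y m)"
  define g where "g = (\<lambda>m. B_mat b m *v v m)"
  have h: "h \<in> ell2"
    unfolding h_def by (rule mult_bounded_ell2(1)[of b, OF b first_component_ell2(1)[OF x]])
  have g: "g m = vector [h m, 0]" for m
    by (simp add: g_def h_def v_def unflatten_def B_mat_def Q_plus_def mat2_simps)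
  define p where "p = resolvent h"
  have p: "p \<in> ell2" "free_op lam p = h" unfolding p_def by (rule resolvent[OF h])+
  define y :: "nat \<Rightarrow> complex^2" where "y = (\<lambda>m. vector [- p m, - right_shift p m])"
  have neg: "(\<lambda>m. - f m) \<in> ell2" if "f \<in> ell2" for f :: "nat \<Rightarrow> complex"
    using ell2_scale(1)[OF that, of "-1"] by simp
  have "y \<in> ell2_ran_Q"
    unfolding ell2_ran_Q_def Q_plus_range
    by (auto simp: y_def intro!: vec2_ell2 neg p(1) right_shift_ell2)
  moreover have "L y = g"
  proof
    fix m
    have "right_shift p m - p (Suc m) - lam * p m = h m"
      using fun_cong[OF p(2), of m] by (simp add: free_op_def left_shift_def)
    then show "L y m = g m"
      unfolding g by (simp add: L_def y_def A_mat_def left_shift_def mat2_simps algebra_simps)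
  qed
  ultimately have mem: "g \<in> L ` ell2_ran_Q" by blast
  define u where "u = inv_into ell2_ran_Q L g"
  have u: "u \<in> ell2_ran_Q" unfolding u_def by (rule inv_into_into[OF mem])
  have Lu: "L u = g" unfolding u_def by (rule f_inv_into_f[OF mem])
  have u02: "u 0 $ 2 = 0" using u by (simp add: ell2_ran_Q_def Q_plus_range)
  have u2: "u (Suc m) $ 2 = u m $ 1" for m
    using fun_cong[OF Lu, of m] unfolding g
    by (simp add: L_def A_mat_def left_shift_def mat2_simps)
  have u1: "u (Suc m) $ 1 + lam * u m $ 1 - u m $ 2 = h m" for m
    using fun_cong[OF Lu, of m] unfolding g
    by (simp add: L_def A_mat_def left_shift_def mat2_simps algebra_simps)
  have "resolvent h = (\<lambda>m. - u m $ 1)"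
  proof (rule resolvent_eqI)
    show "(\<lambda>m. - u m $ 1) \<in> ell2"
      by (intro neg vec2_component_ell2) (use u in \<open>simp add: ell2_ran_Q_def\<close>)
    show "free_op lam (\<lambda>m. - u m $ 1) = h"
    proof
      fix m show "free_op lam (\<lambda>m. - u m $ 1) m = h m"
        using u1[of m] by (cases m) (simp_all add: free_op_0 free_op_Suc u02 u2 algebra_simps)
    qed
  qed
  then have uK: "c n * u n $ 1 = K_plus b c lam (\<lambda>m. x (m, 1)) n" for n
    by (simp add: K_plus_eq h_def)
  have "T_plus b c lam v = (\<lambda>n. C_mat c n *v u n)"
    unfolding T_plus_def u_def L_def g_def ..
  moreover have "C_mat c n *v u n = vector [K_plus b c lam (\<lambda>m. x (m, 1)) n, 0]" for n
    unfolding uK[symmetric] by (simp add: C_mat_def Q_plus_def mat2_simps)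
  ultimately have T: "T_plus b c lam v = (\<lambda>n. vector [K_plus b c lam (\<lambda>m. x (m, 1)) n, 0])" by simp
  show ?thesis
  proof
    fix i :: "nat \<times> 2"
    obtain n j where i: "i = (n, j)" by (cases i)
    show "flatten (T_plus b c lam (unflatten x)) i = lift_op (K_plus b c lam) x i"
      using exhaust_2[of j] T by (auto simp: i flatten_def lift_op_def v_def)
  qed
qed

lemma det_I_minus_T_eq_K:
  assumes b: "\<And>n. cmod (b n) \<le> \<beta> / (real n + 1)" and c: "\<And>n. cmod (c n) \<le> \<gamma> / (real n + 1)"
  shows "det_I_minus_T b c lam = det_I_minus_K b c lam"
proof -
  have \<beta>: "0 \<le> \<beta>" using order_trans[OF norm_ge_zero b[of 0]] by simp
  have "cmod (b n) \<le> \<beta>" for n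
  proof -
    have "\<beta> / (real n + 1) \<le> \<beta>" using \<beta> by (simp add: field_simps)
    with b[of n] show ?thesis by linarith
  qed
  from T_plus_eq_lift[of b, OF this]
  have "det_I_minus_T b c lam = det_I_minus (lift_op (K_plus b c lam))"
    unfolding det_I_minus_T_def by (rule det_I_minus_cong)
  also have "\<dots> = det_I_minus_K b c lam"
    unfolding det_I_minus_K_def by (rule det_I_minus_lift[OF trace_class_K_plus[of b _ c, OF b c]])
  finally show ?thesis .
qed

section \<open>The Jost function and the Evans function\<close>

lemma mu_plus_eq: "mu_plus lam = mu"
  unfolding mu_plus_def
proof (rule the_equality)
  fix m assume m: "m\<^sup>2 + lam * m - 1 = 0 \<and> cmod m < 1"
  show "m = mu"
  proof (rule ccontr)
    assume "m \<noteq> mu"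
    moreover have "(m - mu) * (m + mu + lam) = 0"
      using m root by (simp add: algebra_simps power2_eq_square)
    ultimately have "m + mu + lam = 0" by simp
    then have "m = - (mu + lam)" by (simp only: eq_neg_iff_add_eq_0 add.assoc)
    then have "m * mu = - (mu + lam) * mu" by (rule arg_cong)
    also have "\<dots> = - (mu * mu) - lam * mu" by (simp add: algebra_simps)
    also have "\<dots> = -1" by (simp add: mu_square)
    finally have "m * mu = -1" .
    then have "cmod m * cmod mu = 1" by (metis norm_minus_cancel norm_mult norm_one)
    moreover have "cmod m * cmod mu < 1 * 1"
      using m small mu_nonzero by (intro mult_strict_mono) auto
    ultimately show False by simp
  qed
qed (use root small in auto)

lemma solves_E_iff:
  assumes "V = (\<lambda>n. b n * c n)"
  shows "solves_E b c lam z \<longleftrightarrow> sol z"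
  by (simp add: solves_E_def sol_def fun_cong[OF assms])

text \<open>
  The normalization of the Jost solution refers to the entry \<open>z\<^sub>n\<close>, stored at \<open>n + 1\<close>; without
  the index shift the limit becomes \<open>1 / \<mu>\<close>.
\<close>

lemma normalization_iff:
  "(\<lambda>n. mu powi (- int n) * z (n + 1)) \<longlonglongrightarrow> 1 \<longleftrightarrow> (\<lambda>k. z k / mu ^ k) \<longlonglongrightarrow> 1 / mu"
proof -
  have "(\<lambda>k. z k / mu ^ k) \<longlonglongrightarrow> 1 / mu \<longleftrightarrow> (\<lambda>k. z (Suc k) / mu ^ Suc k) \<longlonglongrightarrow> 1 / mu"
    by (rule filterlim_sequentially_Suc[symmetric])
  also have "\<dots> \<longleftrightarrow> (\<lambda>k. (1 / mu) * (mu powi (- int k) * z (k + 1))) \<longlonglongrightarrow> (1 / mu) * 1"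
    by (simp add: power_int_minus divide_inverse mult_ac)
  also have "\<dots> \<longleftrightarrow> (\<lambda>n. mu powi (- int n) * z (n + 1)) \<longlonglongrightarrow> 1"
    using mu_nonzero by (intro tendsto_mult_left_iff) simp
  finally show ?thesis by simp
qed

lemma Jost_solution_eq:
  assumes V: "V = (\<lambda>n. b n * c n)" and J: "sol J" "(\<lambda>k. J k / mu ^ k) \<longlonglongrightarrow> 1"
  shows "Jost_solution b c lam = (\<lambda>k. J k / mu)"
  unfolding Jost_solution_def mu_plus_eq solves_E_iff[OF V] normalization_iff
proof (rule the_equality, rule conjI)
  show s: "sol (\<lambda>k. J k / mu)" using sol_scale[OF J(1), of "1 / mu"] by simp
  show l: "(\<lambda>k. (J k / mu) / mu ^ k) \<longlonglongrightarrow> 1 / mu"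
    using tendsto_divide[OF J(2) tendsto_const[of mu]] mu_nonzero by (simp add: mult.commute)
  fix z assume "sol z \<and> (\<lambda>k. z k / mu ^ k) \<longlonglongrightarrow> 1 / mu"
  then show "z = (\<lambda>k. J k / mu)" by (intro sol_unique_normalized[OF _ s _ l]) simp_all
qed

lemma regular_solution_eq:
  assumes V: "V = (\<lambda>n. b n * c n)"
  shows "regular_solution b c lam = regular"
  unfolding regular_solution_def solves_E_iff[OF V]
proof (rule the_equality)
  show r: "sol regular \<and> regular 0 = 0 \<and> regular 1 = 1"
    using sol_recurrence[of 0 1] by (simp add: regular_def)
  fix z assume "sol z \<and> z 0 = 0 \<and> z 1 = 1"
  then show "z = regular" using r by (intro sol_eqI) auto
qed

lemma Jost_function_eq:
  assumes V: "V = (\<lambda>n. b n * c n)" and J: "sol J" "(\<lambda>k. J k / mu ^ k) \<longlonglongrightarrow> 1"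
  shows "Jost_function b c lam = J 0"
  using mu_nonzero
  by (simp add: Jost_function_def Jost_solution_eq[OF V J] regular_solution_eq[OF V] mu_plus_eq Wronskian_def)

end

lemma mat_ran_idempotent:
  assumes "P ** P = (P :: complex^'n^'n)"
  shows "mat_ran P = {v. P *v v = v}"
proof -
  have "P *v (P *v v) = P *v v" for v by (simp add: matrix_vector_mul_assoc assms)
  then show ?thesis unfolding mat_ran_def by (auto simp: image_iff) metis
qed

lemma projection_along_eqI:
  fixes P :: "complex^'n^'n"
  assumes P: "P ** P = P" "mat_ran P = U" "mat_ker P = V"
  shows "projection_along U V = P"
  unfolding projection_along_def
proof (rule the_equality)
  show "P ** P = P \<and> mat_ran P = U \<and> mat_ker P = V" using P by simp
  fix P' :: "complex^'n^'n" assume P': "P' ** P' = P' \<and> mat_ran P' = U \<and> mat_ker P' = V"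
  have "P' *v v = P *v v" for v
  proof -
    have "P' *v v \<in> mat_ran P" using P P' by (auto simp: mat_ran_def)
    then have 1: "P *v (P' *v v) = P' *v v" by (simp add: mat_ran_idempotent[OF P(1)])
    have "P' *v (v - P' *v v) = 0"
      using P' by (simp add: matrix_vector_mult_diff_distrib matrix_vector_mul_assoc)
    then have "v - P' *v v \<in> mat_ker P" using P P' by (auto simp: mat_ker_def)
    then have "P *v v = P *v (P' *v v)" by (simp add: mat_ker_def matrix_vector_mult_diff_distrib)
    with 1 show ?thesis by simp
  qed
  then show "P' = P" by (simp add: matrix_eq)
qed

context half_plane
begin

lemma one_plus_mu_square: "1 + mu\<^sup>2 \<noteq> 0"
proof
  assume "1 + mu\<^sup>2 = 0"
  then have "mu\<^sup>2 = -1" by (simp add: add_eq_0_iff)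
  then have "(cmod mu)\<^sup>2 = 1" by (metis norm_minus_cancel norm_one norm_power)
  with mod_square_less_1 show False by simp
qed

lemma P_plus_range: "mat_ran (P_plus lam) = {v. v $ 1 = mu * v $ 2}"
proof -
  define s where "s = 1 + mu\<^sup>2"
  have s: "s \<noteq> 0" unfolding s_def by (rule one_plus_mu_square)
  have lam: "lam = 1 / mu - mu" using mu_square mu_nonzero by (simp add: field_simps)
  \<comment> \<open>The projection onto the eigenvector \<open>(\<mu>, 1)\<close> along the other eigenvector \<open>(1, - \<mu>)\<close>.\<close>
  define P :: "complex^2^2" where "P = vector [vector [mu\<^sup>2 / s, mu / s], vector [mu / s, 1 / s]]"
  define N where "N = mat_power (A_mat lam - mat mu) CARD(2)"
  have N: "N *v v = vector [s / mu\<^sup>2 * (v $ 1 - mu * v $ 2), - mu * (s / mu\<^sup>2 * (v $ 1 - mu * v $ 2))]" for v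
    using mu_nonzero
    by (simp add: N_def mat_power_def numeral_2_eq_2 A_mat_def mat2_simps lam s_def field_simps power2_eq_square)
  have Pv: "P *v v = vector [mu * ((mu * v $ 1 + v $ 2) / s), (mu * v $ 1 + v $ 2) / s]" for v
    by (simp add: P_def mat2_simps add_divide_distrib power2_eq_square algebra_simps)
  have "mu * (mu * t) + t = s * t" for t by (simp add: s_def power2_eq_square algebra_simps)
  then have idem: "(mu * (mu * t) + t) / s = t" for t using s by simp
  have PP: "P ** P = P"
  proof -
    have "P *v (P *v v) = P *v v" for v
      by (simp only: Pv vec2_eq_iff vector_2 idem)
    then show ?thesis by (simp add: matrix_eq flip: matrix_vector_mul_assoc)
  qed
  have ranP: "mat_ran P = {v. v $ 1 = mu * v $ 2}"
    unfolding mat_ran_idempotent[OF PP] using s by (auto simp: Pv vec2_eq_iff s_def field_simps power2_eq_square)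
  have kerN: "mat_ker N = {v. v $ 1 = mu * v $ 2}"
    using s mu_nonzero by (auto simp: mat_ker_def N vec2_eq_iff)
  have kerP: "mat_ker P = {v. v $ 2 = - mu * v $ 1}"
    using s mu_nonzero by (auto simp: mat_ker_def Pv vec2_eq_iff add_eq_0_iff)
  have ranN: "mat_ran N = {v. v $ 2 = - mu * v $ 1}"
  proof -
    have "v = N *v vector [mu\<^sup>2 / s * v $ 1, 0]" if "v $ 2 = - mu * v $ 1" for v
      using that s mu_nonzero by (simp add: N vec2_eq_iff)
    moreover have "(N *v v) $ 2 = - mu * (N *v v) $ 1" for v by (simp add: N)
    ultimately show ?thesis unfolding mat_ran_def by blast
  qed
  have "P_plus lam = P"
    unfolding P_plus_def spectral_projection_def mu_plus_eq N_def[symmetric]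
    by (rule projection_along_eqI) (simp_all add: PP ranP kerN kerP ranN)
  with ranP show ?thesis by simp
qed

lemma R_plus_eq: "R_plus lam = vector [vector [0, mu], vector [0, 1]]" (is "_ = ?R")
proof -
  have RR: "?R ** ?R = ?R" by (simp add: mat2_simps)
  show ?thesis
    unfolding R_plus_def P_plus_range Q_plus_range
  proof (rule projection_along_eqI[OF RR])
    show "mat_ran ?R = {v. v $ 1 = mu * v $ 2}"
      unfolding mat_ran_idempotent[OF RR] by (auto simp: mat2_simps)
    show "mat_ker ?R = {v. v $ 2 = 0}"
      by (auto simp: mat_ker_def mat2_simps)
  qed
qed

lemma A_cross_eq:
  assumes V: "V = (\<lambda>n. b n * c n)"
  shows "A_cross b c lam n = vector [vector [V n - lam, 1], vector [1, 0]]"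
  by (simp add: A_cross_def A_mat_def B_mat_def C_mat_def Q_plus_def mat2_simps V)

lemma A_power_R_plus:
  "mat_power (A_mat lam) n ** R_plus lam = vector [vector [0, mu ^ Suc n], vector [0, mu ^ n]]"
proof (induction n)
  case (Suc n)
  have "mat_power (A_mat lam) (Suc n) ** R_plus lam = A_mat lam ** (mat_power (A_mat lam) n ** R_plus lam)"
    by (simp add: mat_power_def matrix_mul_assoc)
  also have "\<dots> = vector [vector [0, - lam * mu ^ Suc n + mu ^ n], vector [0, mu ^ Suc n]]"
    unfolding Suc by (simp add: A_mat_def mat2_simps)
  also have "- lam * mu ^ Suc n + mu ^ n = mu ^ n * (1 - lam * mu)" by (simp add: algebra_simps)
  also have "\<dots> = mu ^ Suc (Suc n)" by (simp add: mu_square[symmetric])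
  finally show ?case .
qed (simp add: mat_power_def R_plus_eq)

text \<open>
  The condition at \<open>n = 0\<close> makes the first column vanish, and the second column is the
  normalized decaying solution written as a first-order system.
\<close>

lemma matrix_Jost_eq:
  assumes V: "V = (\<lambda>n. b n * c n)" and J: "sol J" "(\<lambda>k. J k / mu ^ k) \<longlonglongrightarrow> 1"
  shows "matrix_Jost b c lam = (\<lambda>n. vector [vector [0, J (Suc n)], vector [0, J n]])"
  unfolding matrix_Jost_def mu_plus_eq A_power_R_plus A_cross_eq[OF V]
proof (rule the_equality)
  let ?Y = "\<lambda>n. vector [vector [0, J (Suc n)], vector [0, J n]] :: complex^2^2"
  let ?D = "\<lambda>Y n. mat (mu powi - int n) ** (Y n - vector [vector [0, mu ^ Suc n], vector [0, mu ^ n]]) :: complex^2^2"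
  have D: "(mat (mu powi - int n) ** (M - vector [vector [0, mu ^ Suc n], vector [0, mu ^ n]])) $ i $ j
      = (M $ i $ j - (vector [vector [0, mu ^ Suc n], vector [0, mu ^ n]] :: complex^2^2) $ i $ j) / mu ^ n"
    for M :: "complex^2^2" and n i j
    using exhaust_2[of i] by (auto simp: mat2_simps power_int_minus divide_inverse mult.commute)
  have J0: "(\<lambda>n. (J n - mu ^ n) / mu ^ n) \<longlonglongrightarrow> 0"
    using J(2) mu_nonzero by (simp add: diff_divide_distrib LIM_zero_iff)
  have J1: "(\<lambda>n. (J (Suc n) - mu ^ Suc n) / mu ^ n) \<longlonglongrightarrow> 0"
  proof -
    have "(J (Suc n) - mu ^ Suc n) / mu ^ n = mu * ((J (Suc n) - mu ^ Suc n) / mu ^ Suc n)" for n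
      using mu_nonzero by simp
    then show ?thesis
      using tendsto_mult_right_zero[OF LIMSEQ_Suc[OF J0], of mu] by (simp only:)
  qed
  have "?D ?Y \<longlonglongrightarrow> 0"
  proof (intro vec_tendstoI)
    fix i j :: 2
    show "(\<lambda>n. ?D ?Y n $ i $ j) \<longlonglongrightarrow> 0 $ i $ j"
      unfolding D using exhaust_2[of i] exhaust_2[of j] J0 J1 by auto
  qed
  then have "(\<lambda>n. norm (?D ?Y n)) \<longlonglongrightarrow> 0" by (rule tendsto_norm_zero)
  moreover have "?Y (Suc n) = vector [vector [V n - lam, 1], vector [1, 0]] ** ?Y n" for n
    by (simp add: mat2_simps sol_step[OF J(1)])
  moreover have "?Y 0 = ?Y 0 ** R_plus lam" by (simp add: R_plus_eq mat2_simps)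
  ultimately show "(\<forall>n. ?Y (Suc n) = vector [vector [V n - lam, 1], vector [1, 0]] ** ?Y n) \<and>
      (\<lambda>n. norm (?D ?Y n)) \<longlonglongrightarrow> 0 \<and> ?Y 0 = ?Y 0 ** R_plus lam" by blast
  fix Y :: "nat \<Rightarrow> complex^2^2"
  assume Y: "(\<forall>n. Y (Suc n) = vector [vector [V n - lam, 1], vector [1, 0]] ** Y n) \<and>
      (\<lambda>n. norm (?D Y n)) \<longlonglongrightarrow> 0 \<and> Y 0 = Y 0 ** R_plus lam"
  have rec: "Y (Suc n) $ 1 $ j = (V n - lam) * Y n $ 1 $ j + Y n $ 2 $ j" "Y (Suc n) $ 2 $ j = Y n $ 1 $ j" for n j
    using conjunct1[OF Y] exhaust_2[of j] by (auto simp add: mat2_simps)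
  have "Y 0 = Y 0 ** R_plus lam" using Y by blast
  then have "Y 0 $ i $ 1 = (Y 0 ** R_plus lam) $ i $ 1" for i by simp
  then have "Y 0 $ i $ 1 = 0" for i by (simp add: R_plus_eq matrix_matrix_mult_def sum_2)
  then have col1: "Y n $ 1 $ 1 = 0 \<and> Y n $ 2 $ 1 = 0" for n by (induction n) (simp_all add: rec)
  define w where "w n = Y n $ 2 $ 2" for n
  have w1: "Y n $ 1 $ 2 = w (Suc n)" for n by (simp add: w_def rec)
  have "w (Suc (Suc n)) = (V n - lam) * w (Suc n) + w n" for n
    using rec(1)[of n 2] by (simp only: w1) (simp add: w_def)
  then have "sol w" by (simp add: sol_def algebra_simps)
  moreover have "(\<lambda>k. w k / mu ^ k) \<longlonglongrightarrow> 1"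
  proof -
    have "?D Y \<longlonglongrightarrow> 0" using Y by (simp add: tendsto_norm_zero_iff)
    then have "(\<lambda>n. ?D Y n $ 2 $ 2) \<longlonglongrightarrow> (0 :: complex^2^2) $ 2 $ 2"
      by (intro tendsto_vec_nth)
    then have "(\<lambda>n. w n / mu ^ n - 1) \<longlonglongrightarrow> 0"
      unfolding D using mu_nonzero by (simp add: w_def diff_divide_distrib)
    then show ?thesis by (simp add: LIM_zero_iff)
  qed
  ultimately have "w = J" by (rule sol_unique_normalized[OF _ J(1) _ J(2)])
  then show "Y = ?Y" using col1 w1 by (auto simp: fun_eq_iff vec2_eq_iff w_def)
qed

lemma Evans_eq:
  assumes V: "V = (\<lambda>n. b n * c n)" and J: "sol J" "(\<lambda>k. J k / mu ^ k) \<longlonglongrightarrow> 1"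
  shows "Evans b c lam = J 0"
  unfolding Evans_def matrix_Jost_eq[OF V J] R_minus_def R_plus_eq det_2
  by (simp add: mat_def)

section \<open>The continued fraction\<close>

text \<open>
  Multiplying the equation by the conjugate of the solution and summing, the shift terms telescope
  to the boundary, and the real parts of the coefficients are bounded below.
\<close>

lemma energy_bound:
  assumes z: "sol z" and a: "\<And>n. n \<ge> 1 \<Longrightarrow> Re lam \<le> Re (lam - V n)"
  shows "Re lam * (\<Sum>n<N. (cmod (z (Suc (Suc n))))\<^sup>2) \<le>
    Re (z 1 * cnj (z 2)) - Re (z (Suc N) * cnj (z (Suc (Suc N))))"
proof (induction N)
  case (Suc N)
  let ?x = "z (Suc (Suc N))"
  have "z (Suc N) = (lam - V (Suc N)) * ?x + z (Suc (Suc (Suc N)))"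
    by (simp add: sol_step[OF z, of "Suc N"] algebra_simps)
  then have "Re (z (Suc N) * cnj ?x) = Re ((lam - V (Suc N)) * (?x * cnj ?x)) + Re (z (Suc (Suc (Suc N))) * cnj ?x)"
    by (metis distrib_right mult.assoc plus_complex.simps(1))
  also have "Re ((lam - V (Suc N)) * (?x * cnj ?x)) = Re (lam - V (Suc N)) * (cmod ?x)\<^sup>2"
    by (simp add: complex_mult_cnj cmod_power2)
  also have "Re (z (Suc (Suc (Suc N))) * cnj ?x) = Re (?x * cnj (z (Suc (Suc (Suc N)))))"
    by (simp add: mult.commute)
  finally have "Re (z (Suc N) * cnj ?x) - Re (?x * cnj (z (Suc (Suc (Suc N))))) = Re (lam - V (Suc N)) * (cmod ?x)\<^sup>2"
    by simp
  moreover have "Re lam * (cmod ?x)\<^sup>2 \<le> Re (lam - V (Suc N)) * (cmod ?x)\<^sup>2"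
    by (intro mult_right_mono a) auto
  ultimately show ?case using Suc by (simp add: distrib_left)
qed (simp add: numeral_2_eq_2)

lemma cfrac_Re_nonneg:
  assumes "\<And>n. n \<ge> k \<Longrightarrow> 0 < Re (a n)"
  shows "0 \<le> Re (cfrac a k N)"
  using assms
proof (induction N arbitrary: k)
  case (Suc N)
  have "0 < Re (a k)" by (rule Suc.prems) simp
  moreover have "0 \<le> Re (cfrac a (Suc k) N)" by (rule Suc.IH) (use Suc.prems in simp)
  ultimately have "0 \<le> Re (a k + cfrac a (Suc k) N)" by simp
  then show ?case by (simp add: Re_divide)
qed simp

text \<open>
  The \<open>N\<close>-th approximant is the ratio of consecutive entries of any solution that vanishes
  \<open>N\<close> steps further on; positivity of the real parts excludes zero denominators.
\<close>

lemma cfrac_ratio: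
  assumes z: "sol z" and a: "\<And>n. n \<ge> k \<Longrightarrow> 0 < Re (lam - V n)" and 0: "z (Suc (k + N)) = 0"
  shows "z (Suc k) = cfrac (\<lambda>n. lam - V n) k N * z k"
  using a 0
proof (induction N arbitrary: k)
  case (Suc N)
  let ?c = "cfrac (\<lambda>n. lam - V n) (Suc k) N"
  have IH: "z (Suc (Suc k)) = ?c * z (Suc k)" using Suc by simp
  have "z k = (lam - V k) * z (Suc k) + z (Suc (Suc k))"
    by (simp add: sol_step[OF z] algebra_simps)
  also have "\<dots> = (lam - V k + ?c) * z (Suc k)" by (simp add: IH algebra_simps)
  finally have zk: "z k = (lam - V k + ?c) * z (Suc k)" .
  have "0 \<le> Re ?c" by (rule cfrac_Re_nonneg) (use Suc.prems in simp)
  then have "0 < Re (lam - V k + ?c)" using Suc.prems(1)[of k] by simp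
  then have "lam - V k + ?c \<noteq> 0" by (metis less_irrefl zero_complex.simps(1))
  then show ?case by (simp add: zk)
qed simp

text \<open>
  Let \<open>y\<close> be a solution whose ratio is an approximant, normalized to \<open>1\<close> just before its zero.
  Evaluating the Wronskian of \<open>J\<close> and \<open>y\<close> at that zero gives a single entry of \<open>J\<close>,
  which tends to zero, while the energy inequality keeps the denominator of the ratio away from
  zero. The same inequality shows that \<open>J 1\<close> does not vanish.
\<close>

lemma cfrac_limit:
  assumes J: "sol J" "(\<lambda>k. J k / mu ^ k) \<longlonglongrightarrow> 1"
    and a: "\<And>n. n \<ge> 1 \<Longrightarrow> Re lam \<le> Re (lam - V n)"
  shows "lim (cfrac (\<lambda>n. lam - V n) 1) * J 1 = J 2"
proof -
  have Jlim: "J \<longlonglongrightarrow> 0"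
  proof -
    have "(\<lambda>k. (J k / mu ^ k) * mu ^ k) \<longlonglongrightarrow> 1 * 0"
      using small by (intro tendsto_mult J(2) LIMSEQ_power_zero)
    then show ?thesis using mu_nonzero by simp
  qed
  have J1: "J 1 \<noteq> 0"
  proof
    assume J1: "J 1 = 0"
    have "J (Suc (Suc k)) = 0" for k
    proof -
      have "(\<lambda>N. cmod (J (Suc N) * cnj (J (Suc (Suc N))))) \<longlonglongrightarrow> cmod (0 * cnj 0)"
        using LIMSEQ_Suc[OF Jlim] LIMSEQ_Suc[OF LIMSEQ_Suc[OF Jlim]]
        by (intro tendsto_norm tendsto_mult tendsto_cnj)
      then have "Re lam * (cmod (J (Suc (Suc k))))\<^sup>2 \<le> cmod (0 * cnj 0)"
      proof (rule LIMSEQ_le_const, intro exI allI impI)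
        fix N assume "Suc k \<le> N"
        then have "(cmod (J (Suc (Suc k))))\<^sup>2 \<le> (\<Sum>n<N. (cmod (J (Suc (Suc n))))\<^sup>2)"
          by (intro member_le_sum) auto
        then have "Re lam * (cmod (J (Suc (Suc k))))\<^sup>2 \<le> Re lam * (\<Sum>n<N. (cmod (J (Suc (Suc n))))\<^sup>2)"
          using re_pos by simp
        also have "\<dots> \<le> - Re (J (Suc N) * cnj (J (Suc (Suc N))))"
          using energy_bound[OF J(1) a, of N] J1 by simp
        also have "\<dots> \<le> cmod (J (Suc N) * cnj (J (Suc (Suc N))))"
          using complex_Re_le_cmod[of "- (J (Suc N) * cnj (J (Suc (Suc N))))"] by simp
        finally show "Re lam * (cmod (J (Suc (Suc k))))\<^sup>2 \<le> cmod (J (Suc N) * cnj (J (Suc (Suc N))))" .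
      qed
      then show ?thesis using re_pos by (simp add: mult_le_0_iff)
    qed
    then have "(\<lambda>k. J (Suc (Suc k)) / mu ^ Suc (Suc k)) \<longlonglongrightarrow> 0" by simp
    with LIMSEQ_Suc[OF LIMSEQ_Suc[OF J(2)]] have "(1::complex) = 0" by (rule LIMSEQ_unique)
    then show False by simp
  qed
  let ?c = "cfrac (\<lambda>n. lam - V n) 1"
  have close: "cmod (?c (Suc N) * J 1 - J 2) \<le> cmod (J (N + 3)) / Re lam" for N
  proof -
    obtain y where y: "sol y" "y (N + 2) = 1" "y (Suc (N + 2)) = 0" using sol_exists_at by blast
    have ratio: "y 2 = ?c (Suc N) * y 1"
      using cfrac_ratio[OF y(1), of 1 "Suc N"] y(3) a re_pos
      by (force simp: numeral_2_eq_2)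
    have "wronskian J y 1 = wronskian J y (N + 2)"
      using wronskian_const[OF J(1) y(1)] by metis
    then have "cmod (J 1 * y 2 - J 2 * y 1) = cmod (J (N + 3))"
      using y by (simp add: wronskian_def numeral_2_eq_2 numeral_3_eq_3 norm_minus_commute[of "J 2 * y 1"])
        (metis (no_types) mult_minus1 norm_minus_cancel norm_mult norm_one norm_power mult_1 power_one minus_diff_eq)
    then have eq: "cmod (?c (Suc N) * J 1 - J 2) * cmod (y 1) = cmod (J (N + 3))"
      unfolding ratio norm_mult[symmetric] by (simp add: algebra_simps)
    have en: "Re lam * (\<Sum>n<Suc N. (cmod (y (Suc (Suc n))))\<^sup>2) \<le> cmod (y 1) * cmod (y 2)"
    proof -
      have "Re lam * (\<Sum>n<Suc N. (cmod (y (Suc (Suc n))))\<^sup>2) \<le> Re (y 1 * cnj (y 2))"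
        using energy_bound[OF y(1) a, of "Suc N"] y(3) by simp
      also have "\<dots> \<le> cmod (y 1) * cmod (y 2)"
        using complex_Re_le_cmod[of "y 1 * cnj (y 2)"] by (simp add: norm_mult)
      finally show ?thesis .
    qed
    have mem: "Re lam * (cmod (y (Suc (Suc n))))\<^sup>2 \<le> cmod (y 1) * cmod (y 2)" if "n \<le> N" for n
    proof -
      have "(cmod (y (Suc (Suc n))))\<^sup>2 \<le> (\<Sum>n<Suc N. (cmod (y (Suc (Suc n))))\<^sup>2)"
        by (rule member_le_sum) (use that in auto)
      then have "Re lam * (cmod (y (Suc (Suc n))))\<^sup>2 \<le> Re lam * (\<Sum>n<Suc N. (cmod (y (Suc (Suc n))))\<^sup>2)"
        using re_pos by simp
      with en show ?thesis by linarith
    qed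
    have m1: "Re lam \<le> cmod (y 1) * cmod (y 2)" using mem[of N] y(2) by simp
    have m2: "Re lam * cmod (y 2) * cmod (y 2) \<le> cmod (y 1) * cmod (y 2)"
      using mem[of 0] by (simp add: numeral_2_eq_2 power2_eq_square)
    \<comment> \<open>Either the bound by the last entry or the one by \<open>y 2\<close> itself suffices.\<close>
    have "Re lam \<le> cmod (y 1)"
    proof (cases "cmod (y 2) \<le> 1")
      case True
      then have "cmod (y 1) * cmod (y 2) \<le> cmod (y 1) * 1" by (intro mult_left_mono) auto
      with m1 show ?thesis by simp
    next
      case False
      then have "0 < cmod (y 2)" by linarith
      with m2 have "Re lam * cmod (y 2) \<le> cmod (y 1)" by (rule mult_right_le_imp_le)
      moreover have "Re lam * 1 \<le> Re lam * cmod (y 2)" using False re_pos by (intro mult_left_mono) auto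
      ultimately show ?thesis by simp
    qed
    then have "cmod (?c (Suc N) * J 1 - J 2) * Re lam \<le> cmod (J (N + 3))"
      unfolding eq[symmetric] by (intro mult_left_mono) auto
    then show ?thesis using re_pos by (simp add: pos_le_divide_eq)
  qed
  have "(\<lambda>N. ?c (Suc N) * J 1 - J 2) \<longlonglongrightarrow> 0"
  proof (rule Lim_null_comparison)
    show "\<forall>\<^sub>F N in sequentially. norm (?c (Suc N) * J 1 - J 2) \<le> cmod (J (N + 3)) / Re lam"
      by (intro always_eventually allI close)
    have "(\<lambda>N. J (N + 3)) \<longlonglongrightarrow> 0" using Jlim by (rule LIMSEQ_ignore_initial_segment)
    from tendsto_divide[OF tendsto_norm[OF this] tendsto_const[of "Re lam"]] re_pos
    show "(\<lambda>N. cmod (J (N + 3)) / Re lam) \<longlonglongrightarrow> 0" by simp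
  qed
  then have "(\<lambda>N. ?c (Suc N) * J 1) \<longlonglongrightarrow> J 2" by (simp add: LIM_zero_iff)
  from tendsto_divide[OF this tendsto_const[of "J 1"] J1]
  have "(\<lambda>N. ?c (Suc N)) \<longlonglongrightarrow> J 2 / J 1" using J1 by simp
  then have "?c \<longlonglongrightarrow> J 2 / J 1" by (rule LIMSEQ_imp_Suc)
  then have "lim ?c = J 2 / J 1" by (rule limI)
  then show ?thesis using J1 by simp
qed

end

section \<open>The potentials\<close>

text \<open>
  The two roots have product \<open>- 1\<close>, and a root on the unit circle would make
  \<open>\<lambda> = 1 / \<mu> - \<mu>\<close> purely imaginary.
\<close>

lemma decaying_root_exists:
  assumes "Re lam > 0"
  obtains mu where "mu\<^sup>2 + lam * mu - 1 = 0" "cmod mu < 1"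
proof -
  define d where "d = csqrt (lam\<^sup>2 + 4)"
  have d: "d\<^sup>2 = lam\<^sup>2 + 4" by (simp add: d_def)
  define m1 where "m1 = (d - lam) / 2"
  define m2 where "m2 = (- d - lam) / 2"
  have r1: "m1\<^sup>2 + lam * m1 - 1 = 0" and r2: "m2\<^sup>2 + lam * m2 - 1 = 0"
    using d by (simp_all add: m1_def m2_def field_simps power2_eq_square)
  have "m1 * m2 = -1" using d by (simp add: m1_def m2_def field_simps power2_eq_square)
  then have prod: "cmod m1 * cmod m2 = 1" by (metis norm_minus_cancel norm_mult norm_one)
  have "cmod m1 \<noteq> 1"
  proof
    assume "cmod m1 = 1"
    then have "m1 * cnj m1 = 1" by (simp add: complex_norm_square[symmetric])
    then have "cnj m1 = (m1\<^sup>2 + lam * m1) * cnj m1" using r1 by simp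
    also have "\<dots> = (m1 * cnj m1) * (m1 + lam)" by (simp add: power2_eq_square algebra_simps)
    finally have "cnj m1 = m1 + lam" using \<open>m1 * cnj m1 = 1\<close> by simp
    then have "Re (cnj m1) = Re (m1 + lam)" by (rule arg_cong)
    with assms show False by simp
  qed
  then consider "cmod m1 < 1" | "1 < cmod m1" by linarith
  then show thesis
  proof cases
    case 1
    then show thesis using that r1 by blast
  next
    case 2
    then have "cmod m2 < 1" using prod by (smt (verit) mult_cancel_left1 mult_le_cancel_right1 norm_ge_zero)
    then show thesis using that r2 by blast
  qed
qed

lemma bigo_inverse_square_bound:
  fixes f :: "nat \<Rightarrow> real"
  assumes "f \<in> O(\<lambda>n. 1 / real n ^ 2)"
  obtains C where "0 < C" "\<And>n. \<bar>f n\<bar> \<le> C / (real n + 1)\<^sup>2"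
proof -
  obtain K where K: "0 < K" "\<forall>\<^sub>F n in sequentially. norm (f n) \<le> K * norm (1 / real n ^ 2)"
    using landau_o.bigE[OF assms] by blast
  have "\<forall>\<^sub>F n in sequentially. norm (f n * (real n + 1)\<^sup>2) \<le> norm (4 * K)"
    using K(2) eventually_ge_at_top[of 1]
  proof eventually_elim
    case (elim n)
    have "norm (f n * (real n + 1)\<^sup>2) = \<bar>f n\<bar> * (real n + 1)\<^sup>2" by (simp add: abs_mult)
    also have "\<dots> \<le> (K / (real n)\<^sup>2) * (2 * real n)\<^sup>2"
      using elim K(1) by (intro mult_mono power_mono) auto
    also have "\<dots> = norm (4 * K)" using elim K(1) by (simp add: field_simps)
    finally show ?case .
  qed
  then have "Bseq (\<lambda>n. f n * (real n + 1)\<^sup>2)"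
    by (rule Bseq_eventually_mono[where g="\<lambda>_. 4 * K"]) (rule BseqI'[of _ "norm (4 * K)"], simp)
  then obtain C where C: "0 < C" "\<And>n. norm (f n * (real n + 1)\<^sup>2) \<le> C"
    unfolding Bseq_def by blast
  have "\<bar>f n\<bar> \<le> C / (real n + 1)\<^sup>2" for n
    using C(2)[of n] by (simp add: abs_mult pos_le_divide_eq)
  with C(1) show thesis by (rule that)
qed

lemma c_seq_bound:
  fixes \<rho> :: "nat \<Rightarrow> real"
  assumes "\<And>n. \<bar>\<rho> n - 1\<bar> \<le> C / (real n + 1)\<^sup>2" and "\<And>n. \<rho> n < 1"
  shows "cmod (c_seq \<rho> n) \<le> sqrt C / (real n + 1)"
proof -
  have "sqrt (1 - \<rho> n) \<le> sqrt (C / (real n + 1)\<^sup>2)"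
    using assms(1)[of n] by (simp add: abs_le_iff)
  then show ?thesis using assms(2)[of n] by (simp add: c_seq_def real_sqrt_divide)
qed

theorem corollary1p2:
  fixes \<rho> :: "nat \<Rightarrow> real" and lam :: complex
  assumes "\<rho> 0 < 0"
    and "\<And>n. n \<ge> 1 \<Longrightarrow> 0 < \<rho> n \<and> \<rho> n < 1"
    and "(\<lambda>n. \<rho> n - 1) \<in> O(\<lambda>n. 1 / real n ^ 2)"
    and "Re lam > 0"
  shows "G_plus \<rho> lam = det_I_minus_K (b_seq \<rho> lam) (c_seq \<rho>) lam \<and>
         det_I_minus_K (b_seq \<rho> lam) (c_seq \<rho>) lam = det_I_minus_T (b_seq \<rho> lam) (c_seq \<rho>) lam \<and>
         det_I_minus_T (b_seq \<rho> lam) (c_seq \<rho>) lam = Evans (b_seq \<rho> lam) (c_seq \<rho>) lam \<and>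
         Evans (b_seq \<rho> lam) (c_seq \<rho>) lam = Jost_function (b_seq \<rho> lam) (c_seq \<rho>) lam"
proof -
  let ?b = "b_seq \<rho> lam" and ?c = "c_seq \<rho>"
  have lt1: "\<rho> n < 1" and nz: "\<rho> n \<noteq> 0" for n
    using assms(1) assms(2)[of n] by (cases n; force)+
  obtain C where C: "0 < C" "\<And>n. \<bar>\<rho> n - 1\<bar> \<le> C / (real n + 1)\<^sup>2"
    using bigo_inverse_square_bound[OF assms(3)] by blast
  note c = c_seq_bound[of \<rho>, OF C(2) lt1]
  have "(\<lambda>n. C * (inverse (real (Suc n)))\<^sup>2) \<longlonglongrightarrow> C * 0\<^sup>2"
    by (intro tendsto_intros LIMSEQ_inverse_real_of_nat)
  then have "(\<lambda>n. C / (real n + 1)\<^sup>2) \<longlonglongrightarrow> 0"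
    by (simp add: divide_inverse power_inverse add.commute)
  then have "(\<lambda>n. \<rho> n - 1) \<longlonglongrightarrow> 0"
    by (rule Lim_null_comparison[rotated]) (simp add: C(2))
  then have "\<rho> \<longlonglongrightarrow> 1" by (simp add: LIM_zero_iff)
  from tendsto_inverse[OF this] have "convergent (\<lambda>n. inverse (\<rho> n))" by (auto simp: convergent_def)
  then have "Bseq (\<lambda>n. inverse (\<rho> n))" by (rule convergent_imp_Bseq)
  then obtain D where D: "0 < D" "\<And>n. norm (inverse (\<rho> n)) \<le> D" unfolding Bseq_def by blast
  define \<beta> where "\<beta> = cmod lam * D * sqrt C"
  have b: "cmod (?b n) \<le> \<beta> / (real n + 1)" for n
  proof -
    have "cmod (?b n) = cmod lam * norm (inverse (\<rho> n)) * cmod (?c n)"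
      by (simp add: b_seq_def c_seq_def norm_mult norm_divide norm_inverse divide_inverse)
    also have "\<dots> \<le> cmod lam * D * (sqrt C / (real n + 1))"
      using D by (intro mult_mono mult_left_mono c) auto
    finally show ?thesis by (simp add: \<beta>_def)
  qed
  define V where "V = (\<lambda>n. ?b n * ?c n)"
  have V: "lam - V n = lam / of_real (\<rho> n)" for n
  proof -
    have "complex_of_real (sqrt (1 - \<rho> n)) * complex_of_real (sqrt (1 - \<rho> n)) = of_real (1 - \<rho> n)"
      using lt1[of n] by (simp flip: of_real_mult)
    moreover have "V n = - lam * (of_real (sqrt (1 - \<rho> n)) * of_real (sqrt (1 - \<rho> n))) / of_real (\<rho> n)"
      by (simp add: V_def b_seq_def c_seq_def)
    ultimately have "V n = - lam * of_real (1 - \<rho> n) / of_real (\<rho> n)" by (simp only:)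
    then show ?thesis using nz[of n] by (simp add: field_simps)
  qed
  obtain mu where mu: "mu\<^sup>2 + lam * mu - 1 = 0" "cmod mu < 1" using decaying_root_exists[OF assms(4)] .
  have sum: "summable (\<lambda>n. cmod (V n))"
  proof (rule summable_comparison_test'[where N=0])
    show "summable (\<lambda>n. \<beta> * sqrt C * inverse ((real n + 1)\<^sup>2))"
      by (intro summable_mult summable_inverse_square)
    fix n
    have "cmod (V n) \<le> (\<beta> / (real n + 1)) * (sqrt C / (real n + 1))"
      unfolding V_def norm_mult using order_trans[OF norm_ge_zero b[of n]] by (intro mult_mono b c) auto
    then show "norm (cmod (V n)) \<le> \<beta> * sqrt C * inverse ((real n + 1)\<^sup>2)"
      by (simp add: power2_eq_square divide_inverse mult_ac)
  qed
  interpret half_plane lam mu V by unfold_locales (use mu sum assms(4) in auto)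
  obtain J where J: "sol J" "(\<lambda>k. J k / mu ^ k) \<longlonglongrightarrow> 1" using decaying_sol_exists by blast
  have K: "det_I_minus_K ?b ?c lam = J 0"
    unfolding det_I_minus_K_def by (rule det_I_minus_K_eq[OF V_def b c J])
  have Ga: "(\<lambda>k. lam / of_real (\<rho> k)) = (\<lambda>k. lam - V k)" by (simp add: V)
  have "Re lam \<le> Re (lam - V n)" if "n \<ge> 1" for n
  proof -
    have "Re lam * 1 \<le> Re lam * (1 / \<rho> n)"
      using assms(2)[OF that] assms(4) by (intro mult_left_mono) (auto simp: field_simps)
    then show ?thesis by (simp add: V Re_divide_of_real)
  qed
  from cfrac_limit[OF J this] have "lim (cfrac (\<lambda>n. lam - V n) 1) * J 1 = J 2" by simp
  then have "g_plus \<rho> lam * J 1 = J 2" by (simp add: g_plus_def Ga)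
  moreover have "J 0 = (lam - V 0) * J 1 + J 2"
    using sol_step[OF J(1), of 0] by (simp add: numeral_2_eq_2 algebra_simps)
  ultimately have "(g_plus \<rho> lam + lam / of_real (\<rho> 0)) * J 1 = J 0"
    by (simp add: V algebra_simps)
  then have "G_plus \<rho> lam = J 0"
    using mu_nonzero by (simp add: G_plus_def Jost_solution_eq[OF V_def J] mu_plus_eq mult_ac)
  then show ?thesis
    using K det_I_minus_T_eq_K[of ?b, OF b c] Evans_eq[OF V_def J] Jost_function_eq[OF V_def J] by simp
qed

end
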